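(* Let $f\in C_0(\mathbb{R})$ be locally absolutely continuous on $\mathbb{R}\setminus\{0\}$. If $A_1<\infty$, $f(t)=O(|t|^{-\alpha})$ for some $\alpha>0$ and $f'(t)=O(|t|^{-\beta})$ for some $\beta\in\mathbb{R}$ as $|t|\to\infty$, with $\alpha+\beta>1$, then $f\in A(\mathbb{R})$. If $\alpha+\beta<1$, such an assertion cannot be valid.
   Context: $C_0(\mathbb{R})$ is the space of continuous functions $f$ on $\mathbb{R}$ with $\lim f(t)=0$ as $|t|\to\infty$. For $f$ as in the claim, $f_1(t)=\operatorname{ess\,sup}_{|s|\ge|t|>0}|f'(s)|$ and $A_1=\int_0^1 f_1(t)\ln\frac{2}{t}\,dt$. One writes $f\in A(\mathbb{R})$ if $f(y)=\int_{\mathbb{R}}g(x)e^{ixy}\,dx$ for some $g\in L_1(\mathbb{R})$.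
   Formalization: The negative assertion is proved for every pair with 0 < α ≤ 1 and α+β < 1; for α > 1 it is false, since A_1 < ∞ makes f' essentially bounded away from 0, so f' = O(1), and α+0 > 1 then gives f ∈ A(ℝ) by the first part. *)

theory Defs
  imports "HOL-Probability.Essential_Supremum" "HOL-Library.Landau_Symbols"
begin

definition C0_real :: "(real \<Rightarrow> complex) set" where
  "C0_real = {f. continuous_on UNIV f \<and> (f \<longlongrightarrow> 0) at_infinity}"

text \<open>The members of the division \<open>d\<close> are compact intervals with disjoint interiors; the
  endpoints of such an interval \<open>k\<close> are \<open>Inf k\<close> and \<open>Sup k\<close>.\<close>

definition absolutely_continuous_on :: "real set \<Rightarrow> (real \<Rightarrow> complex) \<Rightarrow> bool" where
  "absolutely_continuous_on S f \<longleftrightarrow>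
     (\<forall>\<epsilon>>0. \<exists>\<delta>>0. \<forall>d. d division_of \<Union>d \<and> \<Union>d \<subseteq> S \<and> (\<Sum>k\<in>d. Sup k - Inf k) < \<delta>
        \<longrightarrow> (\<Sum>k\<in>d. norm (f (Sup k) - f (Inf k))) < \<epsilon>)"

definition locally_absolutely_continuous_on :: "real set \<Rightarrow> (real \<Rightarrow> complex) \<Rightarrow> bool" where
  "locally_absolutely_continuous_on S f \<longleftrightarrow>
     (\<forall>a b. {a..b} \<subseteq> S \<longrightarrow> absolutely_continuous_on {a..b} f)"

text \<open>\<open>vector_derivative\<close> has an unspecified value wherever \<open>f\<close> is not differentiable.  For a
  function that is locally absolutely continuous off the origin this happens only on a null set,
  so the derivative is used below only up to null sets; it is then Lebesgue measurable, and
  \<open>esssup\<close> does not take the value it has by convention for non-measurable functions.\<close>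

abbreviation deriv_at :: "(real \<Rightarrow> complex) \<Rightarrow> real \<Rightarrow> complex" where
  "deriv_at f t \<equiv> vector_derivative f (at t)"

definition f1 :: "(real \<Rightarrow> complex) \<Rightarrow> real \<Rightarrow> ennreal" where
  "f1 f t = esssup (lebesgue_on {s. \<bar>s\<bar> \<ge> \<bar>t\<bar>}) (\<lambda>s. ennreal (norm (deriv_at f s)))"

definition A1 :: "(real \<Rightarrow> complex) \<Rightarrow> ennreal" where
  "A1 f = (\<integral>\<^sup>+ t \<in> {0<..<1}. f1 f t * ennreal (ln (2 / t)) \<partial>lebesgue)"

definition ae_bigo_at_infinity :: "(real \<Rightarrow> complex) \<Rightarrow> (real \<Rightarrow> real) \<Rightarrow> bool" where
  "ae_bigo_at_infinity g h \<longleftrightarrow>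
     (\<exists>C T. AE t in lebesgue. \<bar>t\<bar> \<ge> T \<longrightarrow> norm (g t) \<le> C * \<bar>h t\<bar>)"

definition A_real :: "(real \<Rightarrow> complex) set" where
  "A_real = {f. \<exists>g :: real \<Rightarrow> complex. integrable lborel g \<and>
     (\<forall>y. f y = (LINT x|lborel. g x * exp (\<i> * complex_of_real (x * y))))}"

definition admissible :: "real \<Rightarrow> real \<Rightarrow> (real \<Rightarrow> complex) \<Rightarrow> bool" where
  "admissible \<alpha> \<beta> f \<longleftrightarrow>
     f \<in> C0_real \<and> locally_absolutely_continuous_on (- {0}) f \<and> A1 f < \<infinity> \<and>
     (\<lambda>t. norm (f t)) \<in> O[at_infinity](\<lambda>t. \<bar>t\<bar> powr (- \<alpha>)) \<and>
     ae_bigo_at_infinity (deriv_at f) (\<lambda>t. \<bar>t\<bar> powr (- \<beta>))"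

text \<open>On the range of the exponents in the negative assertion: \<open>A1 f < \<infinity>\<close> makes the derivative
  essentially bounded away from the origin, so for \<open>\<beta> < 0\<close> an admissible function for
  \<open>\<alpha>, \<beta>\<close> is also admissible for \<open>\<alpha>, 0\<close>.  If \<open>\<alpha> > 1\<close>, it is therefore in \<open>A_real\<close> by the
  positive assertion, however negative \<open>\<beta>\<close> is.  Hence the pairs with \<open>\<alpha> + \<beta> < 1\<close> for which
  the implication can fail at all have \<open>\<alpha> \<le> 1\<close>; note that \<open>\<alpha> + \<beta> < 1\<close> and \<open>\<beta> \<ge> 0\<close> already
  force \<open>\<alpha> < 1\<close>.\<close>

end

theory Submission
  imports Defs "HOL-Probability.Sinc_Integral"
begin

text \<open>For \<open>\<alpha> + \<beta> > 1\<close>, cut \<open>f\<close> into dyadic pieces \<open>t \<mapsto> f t * \<psi> (\<bar>t\<bar> / 2\<^sup>k)\<close>.  A function bounded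
  by \<open>M\<close>, with Lipschitz constant \<open>D\<close> and support of length \<open>L\<close>, is the transform of a function of
  \<open>L\<^sub>1\<close> norm \<open>O(sqrt (L M D))\<close>: expand it in hat functions of all dyadic scales; the hat is the
  transform of the Fejer kernel, and the integer characters are orthogonal with respect to that kernel.
  The pieces at infinity contribute a geometric series in \<open>2 powr ((1 - \<alpha> - \<beta>) / 2)\<close> and in \<open>2 powr (- \<alpha>)\<close>,
  and those at the origin a series that the logarithmic integral \<open>A1 f\<close> dominates.  The Lipschitz constants
  come from the essential bounds on \<open>f'\<close>; since \<open>deriv_at\<close> is arbitrary where \<open>f\<close> is not differentiable,
  this rests on the almost everywhere differentiability of absolutely continuous functions.

  For \<open>\<alpha> + \<beta> < 1\<close>, let \<open>f t = t powr (- \<alpha>) * exp (\<i> t powr \<gamma>)\<close> for \<open>t \<ge> 1\<close>, with \<open>\<gamma> > 2 \<alpha>\<close>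
  (or \<open>\<gamma> = 2\<close> if \<open>\<alpha> = 1\<close>).  If \<open>f\<close> were the transform of \<open>g\<close>, pairing \<open>f\<close> with \<open>exp (- \<i> t powr \<gamma>)\<close>
  on \<open>[1, R]\<close> would bound the integral of \<open>t powr (- \<alpha>)\<close> over \<open>[1, R]\<close> by \<open>O(R powr (1 - \<gamma> / 2))\<close>,
  by van der Corput's estimate; as \<open>R\<close> grows this fails.\<close>

section \<open>The hat function as a transform\<close>

text \<open>The logarithm in \<open>A1\<close> is the price of summing tails. Near the origin
  \<open>f\<close> itself need not be small, so \<open>f 0\<close> is subtracted; then
  \<open>f - f 0\<close> is bounded on \<open>\<bar>t\<bar> \<le> 2^-k\<close> by the tail over
  \<open>i > k\<close> of \<open>2^-i\<close> times the essential bound for \<open>f'\<close> beyond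
  \<open>2^-i\<close>. Summed over \<open>k\<close>, these tails count the term of index
  \<open>i\<close> exactly \<open>i\<close> times, as does the weight \<open>ln (2 / t)\<close> on a
  dyadic interval. For the negative part, finiteness of \<open>A1\<close> bounds the derivative at
  infinity, so the chirp must satisfy \<open>\<gamma> \<le> 1 + \<alpha> - max \<beta> 0\<close>,
  while the pairing argument needs \<open>\<gamma> > 2 * \<alpha>\<close>. For \<alpha> < 1 both can
  be met exactly when \<alpha> + \<beta> < 1. Two exponents are special: for \<gamma> = 1 the phase
  has no curvature, so \<gamma> is lowered; for \<alpha> = 1 only \<gamma> = 2 is left, where the
  powers of \<open>R\<close> balance and the divergence of the logarithm decides.\<close>

definition fejer_kernel :: "real \<Rightarrow> real" where
  "fejer_kernel x = (1 - cos x) / x\<^sup>2"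

definition hat :: "real \<Rightarrow> real" where
  "hat y = max 0 (1 - \<bar>y\<bar>)"

lemma fejer_kernel_nonneg: "0 \<le> fejer_kernel x"
  by (simp add: fejer_kernel_def)

lemma fejer_kernel_measurable [measurable]: "fejer_kernel \<in> borel_measurable borel"
  unfolding fejer_kernel_def by measurable

lemma one_minus_cos_le: "1 - cos x \<le> x\<^sup>2 / 2" for x :: real
proof -
  have "cos x = 1 - 2 * (sin (x/2))\<^sup>2"
    using cos_double_sin[of "x/2"] by simp
  moreover have "(sin (x/2))\<^sup>2 \<le> (x/2)\<^sup>2"
    using abs_sin_x_le_abs_x[of "x/2"] by (metis abs_le_square_iff)
  ultimately show ?thesis by (simp add: power_divide)
qed

lemma integrable_inverse_1_plus_sq: "integrable lborel (\<lambda>x::real. inverse (1 + x\<^sup>2))"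
  using integrable_inverse_1_plus_square by (simp add: set_integrable_def einterval_def)

lemma one_minus_cos_scaled_integrable: "integrable lborel (\<lambda>x. (1 - cos (a * x)) / x\<^sup>2)" for a :: real
proof -
  have "norm ((1 - cos (a * x)) / x\<^sup>2) \<le> norm ((a\<^sup>2 + 2) * inverse (1 + x\<^sup>2))" for x :: real
  proof (cases "x = 0")
    case False
    have "1 - cos (a*x) \<le> a\<^sup>2 * x\<^sup>2 / 2" using one_minus_cos_le[of "a*x"] by (simp add: power_mult_distrib)
    moreover have "x\<^sup>2 * (1 - cos (a*x)) \<le> x\<^sup>2 * 2"
      using cos_ge_minus_one[of "a*x"] by (intro mult_left_mono) auto
    moreover have "0 \<le> a\<^sup>2 * x\<^sup>2" by simp
    moreover have "(1 - cos (a*x)) * (1 + x\<^sup>2) = (1 - cos (a*x)) + x\<^sup>2 * (1 - cos (a*x))"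
      "(a\<^sup>2 + 2) * x\<^sup>2 = a\<^sup>2 * x\<^sup>2 + x\<^sup>2 * 2"
      by (simp_all add: algebra_simps)
    ultimately have "(1 - cos (a*x)) * (1 + x\<^sup>2) \<le> (a\<^sup>2 + 2) * x\<^sup>2"
      by linarith
    moreover have "0 < 1 + x\<^sup>2" by (simp add: add_pos_nonneg)
    ultimately show ?thesis using False by (simp add: field_simps)
  qed auto
  then show ?thesis
    by (intro Bochner_Integration.integrable_bound[OF integrable_mult_right[OF integrable_inverse_1_plus_sq, of "a\<^sup>2 + 2"]])
      auto
qed

lemma fejer_kernel_integrable: "integrable lborel fejer_kernel"
  using one_minus_cos_scaled_integrable[of 1] by (simp add: fejer_kernel_def [abs_def])

definition fejer_mass :: real where
  "fejer_mass = (LINT x|lborel. fejer_kernel x)"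

lemma one_minus_cos_scaled_integral:
  fixes a :: real
  shows "(LINT x|lborel. (1 - cos (a * x)) / x\<^sup>2) = \<bar>a\<bar> * fejer_mass"
proof (cases "a = 0")
  case False
  have "fejer_mass = \<bar>a\<bar> * (LINT x|lborel. fejer_kernel (0 + a * x))"
    unfolding fejer_mass_def using lborel_integral_real_affine[OF False, of fejer_kernel 0] by simp
  also have "(LINT x|lborel. fejer_kernel (0 + a * x)) = (LINT x|lborel. (1 - cos (a * x)) / x\<^sup>2 / a\<^sup>2)"
    by (simp add: fejer_kernel_def power_mult_distrib mult.commute)
  also have "\<dots> = (LINT x|lborel. (1 - cos (a * x)) / x\<^sup>2) / a\<^sup>2"
    by (rule integral_divide_zero)
  finally have "fejer_mass = \<bar>a\<bar> * ((LINT x|lborel. (1 - cos (a * x)) / x\<^sup>2) / a\<^sup>2)" .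
  then have "\<bar>a\<bar> * fejer_mass = (\<bar>a\<bar> * \<bar>a\<bar>) * ((LINT x|lborel. (1 - cos (a * x)) / x\<^sup>2) / a\<^sup>2)"
    by (simp only: mult.assoc)
  also have "\<bar>a\<bar> * \<bar>a\<bar> = a\<^sup>2" by (simp add: power2_eq_square)
  finally show ?thesis using False by simp
qed simp

lemma fejer_mass_pos: "0 < fejer_mass"
proof -
  have "fejer_mass \<noteq> 0"
  proof
    assume "fejer_mass = 0"
    then have "AE x in lborel. fejer_kernel x = 0"
      using integral_nonneg_eq_0_iff_AE[OF fejer_kernel_integrable] fejer_kernel_nonneg
      by (simp add: fejer_mass_def)
    moreover have "fejer_kernel x \<noteq> 0" if "x \<in> {0<..<1}" for x
    proof -
      have "cos x < cos 0" using that pi_gt3 by (intro cos_monotone_0_pi) auto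
      then show ?thesis using that by (simp add: fejer_kernel_def)
    qed
    ultimately have "AE x in lborel. x \<notin> {0<..<1::real}" by (auto elim: eventually_mono)
    then have "emeasure lborel {0<..<1::real} = 0"
      by (subst (asm) AE_iff_measurable[where N="{0<..<1::real}"]) auto
    then show False by simp
  qed
  moreover have "0 \<le> fejer_mass"
    unfolding fejer_mass_def by (intro integral_nonneg_AE) (simp add: fejer_kernel_nonneg)
  ultimately show ?thesis by simp
qed

text \<open>By the addition theorem \<open>(1 - cos x) cos (x y)\<close> is a combination of three functions
  \<open>1 - cos (a x)\<close>, and each of these has integral \<open>\<bar>a\<bar> * fejer_mass\<close> against \<open>x\<^sup>-\<^sup>2\<close> by scaling.\<close>

lemma fejer_kernel_cos_integral:
  "(LINT x|lborel. fejer_kernel x * cos (x * y)) = fejer_mass * hat y"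
proof -
  let ?g = "\<lambda>a x::real. (1 - cos (a * x)) / x\<^sup>2"
  have eq: "fejer_kernel x * cos (x * y) = (?g (1 + y) x + ?g (1 - y) x - 2 * ?g y x) / 2" for x
  proof -
    have "cos ((1+y)*x) + cos ((1-y)*x) = 2 * cos x * cos (x*y)"
      by (simp add: distrib_right left_diff_distrib cos_add cos_diff mult.commute[of x y])
    then have "(1 - cos ((1+y)*x)) + (1 - cos ((1-y)*x)) - 2 * (1 - cos (y*x)) = 2 * (1 - cos x) * cos (x*y)"
      by (simp add: algebra_simps)
    then have "(?g (1 + y) x + ?g (1 - y) x - 2 * ?g y x) = 2 * (1 - cos x) * cos (x*y) / x\<^sup>2"
      by (metis (no_types, lifting) add_divide_distrib diff_divide_distrib times_divide_eq_right)
    moreover have "fejer_kernel x * cos (x * y) = (2 * (1 - cos x) * cos (x*y) / x\<^sup>2) / 2"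
      by (simp add: fejer_kernel_def) (cases "x = 0"; simp add: field_simps)
    ultimately show ?thesis by (simp only:)
  qed
  define G where "G = ?g"
  have G: "integrable lborel (G a)" "(LINT x|lborel. G a x) = \<bar>a\<bar> * fejer_mass" for a
    unfolding G_def by (rule one_minus_cos_scaled_integrable, rule one_minus_cos_scaled_integral)
  have "(LINT x|lborel. fejer_kernel x * cos (x * y)) = (LINT x|lborel. (G (1 + y) x + G (1 - y) x - 2 * G y x) / 2)"
    unfolding eq G_def ..
  also have "\<dots> = fejer_mass * ((\<bar>1 + y\<bar> + \<bar>1 - y\<bar> - 2 * \<bar>y\<bar>) / 2)"
    using G by (simp add: algebra_simps)
  also have "(\<bar>1 + y\<bar> + \<bar>1 - y\<bar> - 2 * \<bar>y\<bar>) / 2 = hat y"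
    by (auto simp: hat_def abs_if max_def)
  finally show ?thesis .
qed

lemma fejer_kernel_mult_integrable:
  fixes u :: "real \<Rightarrow> 'b::{banach, second_countable_topology, real_normed_field}"
  assumes "u \<in> borel_measurable borel" "\<And>x. norm (u x) \<le> B"
  shows "integrable lborel (\<lambda>x. of_real (fejer_kernel x) * u x)"
proof (rule Bochner_Integration.integrable_bound[OF integrable_mult_right[OF fejer_kernel_integrable, of B]])
  show "AE x in lborel. norm (of_real (fejer_kernel x) * u x) \<le> norm (B * fejer_kernel x)"
  proof (rule AE_I2)
    fix x
    have "norm (of_real (fejer_kernel x) * u x) \<le> fejer_kernel x * B"
      using assms(2)[of x] by (simp add: norm_mult fejer_kernel_nonneg mult_left_mono)
    then show "norm (of_real (fejer_kernel x) * u x) \<le> norm (B * fejer_kernel x)"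
      by (simp add: mult.commute)
  qed
qed (use assms in measurable)

lemma fejer_kernel_transform:
  "(LINT x|lborel. complex_of_real (fejer_kernel x) * exp (\<i> * complex_of_real (x * y)))
    = complex_of_real (fejer_mass * hat y)"
proof -
  have int: "integrable lborel (\<lambda>x. complex_of_real (fejer_kernel x) * exp (\<i> * complex_of_real (x * y)))"
    by (rule fejer_kernel_mult_integrable[where B=1]) (auto simp: norm_exp_i_times)
  \<comment> \<open>The kernel is even, so reflecting \<open>x\<close> sends the sine integral to
    its negative; only the cosine integral, already known, survives.\<close>
  have "(LINT x|lborel. fejer_kernel x * sin (x * y)) = (LINT x|lborel. fejer_kernel (0 + (-1) * x) * sin ((0 + (-1) * x) * y))"
    using lborel_integral_real_affine[of "-1" "\<lambda>x. fejer_kernel x * sin (x * y)" 0] by simp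
  also have "\<dots> = - (LINT x|lborel. fejer_kernel x * sin (x * y))"
    by (simp add: fejer_kernel_def)
  finally have sin0: "(LINT x|lborel. fejer_kernel x * sin (x * y)) = 0" by simp
  show ?thesis
  proof (rule complex_eqI)
    show "Re (LINT x|lborel. complex_of_real (fejer_kernel x) * exp (\<i> * complex_of_real (x * y)))
      = Re (complex_of_real (fejer_mass * hat y))"
      unfolding integral_Re[OF int, symmetric] by (simp add: Re_exp fejer_kernel_cos_integral)
    show "Im (LINT x|lborel. complex_of_real (fejer_kernel x) * exp (\<i> * complex_of_real (x * y)))
      = Im (complex_of_real (fejer_mass * hat y))"
      unfolding integral_Im[OF int, symmetric] by (simp add: Im_exp sin0)
  qed
qed

section \<open>Bounds on the L1 norm of a representing function\<close>

text \<open>A relation between \<open>f\<close> and a bound rather than a norm: it asks for one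
  representing function of small norm, so it makes sense for every \<open>f\<close> and passes
  through sums, dilations and series.\<close>

definition A_norm_le :: "(real \<Rightarrow> complex) \<Rightarrow> real \<Rightarrow> bool" where
  "A_norm_le f K \<longleftrightarrow> (\<exists>g. integrable lborel g \<and>
     (\<forall>y. f y = (LINT x|lborel. g x * exp (\<i> * complex_of_real (x * y)))) \<and>
     (LINT x|lborel. norm (g x)) \<le> K)"

lemma A_real_iff_A_norm_le: "f \<in> A_real \<longleftrightarrow> (\<exists>K. A_norm_le f K)"
  unfolding A_real_def A_norm_le_def by blast

lemma A_norm_le_mono: "A_norm_le f K \<Longrightarrow> K \<le> K' \<Longrightarrow> A_norm_le f K'"
  unfolding A_norm_le_def by (meson order_trans)

lemma integrable_mult_character:
  fixes g :: "real \<Rightarrow> complex"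
  assumes "integrable lborel g"
  shows "integrable lborel (\<lambda>x. g x * exp (\<i> * complex_of_real (x * y)))"
  by (rule Bochner_Integration.integrable_bound[OF assms]) (use assms in \<open>auto simp: norm_mult\<close>)

lemma A_norm_le_add:
  assumes "A_norm_le f K" "A_norm_le h L"
  shows "A_norm_le (\<lambda>y. f y + h y) (K + L)"
proof -
  obtain g1 where g1: "integrable lborel g1"
     "\<And>y. f y = (LINT x|lborel. g1 x * exp (\<i> * complex_of_real (x * y)))"
     "(LINT x|lborel. norm (g1 x)) \<le> K" using assms(1) unfolding A_norm_le_def by blast
  obtain g2 where g2: "integrable lborel g2"
     "\<And>y. h y = (LINT x|lborel. g2 x * exp (\<i> * complex_of_real (x * y)))"
     "(LINT x|lborel. norm (g2 x)) \<le> L" using assms(2) unfolding A_norm_le_def by blast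
  have "(LINT x|lborel. norm (g1 x + g2 x)) \<le> (LINT x|lborel. norm (g1 x) + norm (g2 x))"
    using g1(1) g2(1) by (intro integral_mono) (auto simp: norm_triangle_ineq)
  also have "\<dots> \<le> K + L" using g1 g2 by simp
  finally show ?thesis
    unfolding A_norm_le_def using g1 g2
    by (intro exI[of _ "\<lambda>x. g1 x + g2 x"]) (simp add: distrib_right integrable_mult_character del: of_real_mult)
qed

lemma A_norm_le_cmult:
  assumes "A_norm_le f K"
  shows "A_norm_le (\<lambda>y. c * f y) (norm c * K)"
proof -
  obtain g where g: "integrable lborel g"
     "\<And>y. f y = (LINT x|lborel. g x * exp (\<i> * complex_of_real (x * y)))"
     "(LINT x|lborel. norm (g x)) \<le> K" using assms(1) unfolding A_norm_le_def by blast
  show ?thesis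
    unfolding A_norm_le_def using g
    by (intro exI[of _ "\<lambda>x. c * g x"]) (simp add: mult.assoc norm_mult mult_left_mono)
qed

lemma A_norm_le_zero: "A_norm_le (\<lambda>y. 0) 0"
  unfolding A_norm_le_def by (intro exI[of _ "\<lambda>x. 0"]) simp

text \<open>Dilating the transform by \<open>s\<close> replaces \<open>g x\<close> by
  \<open>\<bar>r\<bar> * g (r * x)\<close> with \<open>r = 1 / s\<close>, which has the same norm.
  This lets estimates on the integer grid serve at every dyadic scale.\<close>

lemma A_norm_le_scale:
  assumes "A_norm_le f K" "s \<noteq> 0"
  shows "A_norm_le (\<lambda>y. f (s * y)) K"
proof -
  obtain g where g: "integrable lborel g"
     "\<And>y. f y = (LINT x|lborel. g x * exp (\<i> * complex_of_real (x * y)))"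
     "(LINT x|lborel. norm (g x)) \<le> K" using assms(1) unfolding A_norm_le_def by blast
  define r where "r = inverse s"
  have r: "r \<noteq> 0" "s * r = 1" using assms(2) by (auto simp: r_def)
  let ?G = "\<lambda>x. \<bar>r\<bar> *\<^sub>R g (0 + r * x)"
  have "integrable lborel ?G"
    using lborel_integrable_real_affine[OF g(1) r(1), of 0] by simp
  moreover have "f (s * y) = (LINT x|lborel. ?G x * exp (\<i> * complex_of_real (x * y)))" for y
  proof -
    have "f (s * y) = \<bar>r\<bar> *\<^sub>R (LINT x|lborel. g (0 + r * x) * exp (\<i> * complex_of_real ((0 + r * x) * (s * y))))"
      unfolding g(2) by (rule lborel_integral_real_affine[OF r(1)])
    also have "\<dots> = (LINT x|lborel. ?G x * exp (\<i> * complex_of_real ((r * s) * (x * y))))"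
      by (simp add: mult_ac)
    finally show ?thesis using r(2) by (simp add: mult.commute[of r s])
  qed
  moreover have "(LINT x|lborel. norm (?G x)) \<le> K"
    using g(3) lborel_integral_real_affine[OF r(1), of "\<lambda>x. norm (g x)" 0] by simp
  ultimately show ?thesis unfolding A_norm_le_def by blast
qed

text \<open>Completeness of \<open>L\<^sub>1\<close> in explicit form: summable norms make the
  series of the \<open>g n\<close> converge absolutely almost everywhere to an integrable function,
  and the sum may be exchanged with the transform.\<close>

lemma A_norm_le_series:
  assumes h: "\<And>n. A_norm_le (h n) (B n)" and B: "summable B"
    and sums: "\<And>y. (\<lambda>n. h n y) sums f y"
  shows "A_norm_le f (suminf B)"
proof -
  have "\<exists>g. \<forall>n. integrable lborel (g n) \<and>
     (\<forall>y. h n y = (LINT x|lborel. g n x * exp (\<i> * complex_of_real (x * y)))) \<and>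
     (LINT x|lborel. norm (g n x)) \<le> B n"
    using h unfolding A_norm_le_def by (intro choice) auto
  then obtain g where g: "\<And>n. integrable lborel (g n)"
     "\<And>n y. h n y = (LINT x|lborel. g n x * exp (\<i> * complex_of_real (x * y)))"
     "\<And>n. (LINT x|lborel. norm (g n x)) \<le> B n" by blast
  have sn: "summable (\<lambda>n. LINT x|lborel. norm (g n x))"
    by (rule summable_comparison_test'[OF B, of 0]) (use g(3) in auto)
  have "(\<integral>\<^sup>+x. (\<Sum>n. ennreal (norm (g n x))) \<partial>lborel) = (\<Sum>n. \<integral>\<^sup>+x. ennreal (norm (g n x)) \<partial>lborel)"
    using g(1) by (intro nn_integral_suminf) auto
  also have "\<dots> = (\<Sum>n. ennreal (LINT x|lborel. norm (g n x)))"
    using g(1) by (intro suminf_cong nn_integral_eq_integral) auto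
  also have "\<dots> < \<infinity>" using sn by (subst suminf_ennreal2) (auto simp: less_top)
  finally have "AE x in lborel. (\<Sum>n. ennreal (norm (g n x))) \<noteq> \<infinity>"
    using g(1) by (intro nn_integral_PInf_AE) auto
  then have ae: "AE x in lborel. summable (\<lambda>n. norm (g n x))"
    by eventually_elim (simp add: summable_suminf_not_top)
  have 1: "integrable lborel (\<lambda>x. \<Sum>n. g n x)"
    by (rule integrable_suminf[OF g(1) ae sn])
  have 2: "f y = (LINT x|lborel. (\<Sum>n. g n x) * exp (\<i> * complex_of_real (x * y)))" for y
  proof -
    let ?e = "\<lambda>x. exp (\<i> * complex_of_real (x * y))"
    have "(LINT x|lborel. (\<Sum>n. g n x * ?e x)) = (\<Sum>n. LINT x|lborel. g n x * ?e x)"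
      by (rule integral_suminf) (use ae sn g(1) in \<open>auto simp: norm_mult integrable_mult_character simp del: of_real_mult\<close>)
    also have "\<dots> = f y" using sums[of y] g(2) by (simp add: sums_iff)
    also have "(LINT x|lborel. (\<Sum>n. g n x * ?e x)) = (LINT x|lborel. (\<Sum>n. g n x) * ?e x)"
    proof (rule integral_cong_AE)
      show "AE x in lborel. (\<Sum>n. g n x * ?e x) = (\<Sum>n. g n x) * ?e x"
        using ae by eventually_elim (auto simp: suminf_mult2 summable_norm_cancel)
    qed (use g(1) in auto)
    finally show ?thesis by simp
  qed
  have "(LINT x|lborel. norm (\<Sum>n. g n x)) \<le> (LINT x|lborel. (\<Sum>n. norm (g n x)))"
  proof (rule integral_mono_AE)
    show "integrable lborel (\<lambda>x. \<Sum>n. norm (g n x))"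
      by (rule integrable_suminf) (use ae sn g(1) in auto)
    show "AE x in lborel. norm (\<Sum>n. g n x) \<le> (\<Sum>n. norm (g n x))"
      using ae by eventually_elim (rule summable_norm)
  qed (use 1 in auto)
  also have "\<dots> = (\<Sum>n. LINT x|lborel. norm (g n x))"
    by (rule integral_suminf) (use ae sn g(1) in auto)
  also have "\<dots> \<le> suminf B" by (rule suminf_le[OF g(3) sn B])
  finally show ?thesis unfolding A_norm_le_def using 1 2 by blast
qed

text \<open>By \<open>fejer_kernel_transform\<close> the characters with integer frequencies are orthonormal for the
  weight \<open>fejer_kernel x / fejer_mass\<close>, since \<open>hat\<close> vanishes at all integers except \<open>0\<close>.\<close>

lemma A_norm_le_hat_sum:
  fixes c :: "int \<Rightarrow> complex"
  assumes "finite S"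
  shows "A_norm_le (\<lambda>y. \<Sum>m\<in>S. c m * of_real (hat (y - of_int m))) (sqrt (\<Sum>m\<in>S. (norm (c m))\<^sup>2))"
proof -
  define e :: "real \<Rightarrow> real \<Rightarrow> complex" where "e y x = exp (\<i> * complex_of_real (x * y))" for y x
  \<comment> \<open>Multiplying the kernel by the character of frequency \<open>- m\<close> moves
    its transform, a hat at \<open>0\<close>, to a hat at \<open>m\<close>.\<close>
  define P where "P x = (\<Sum>m\<in>S. c m * e (- of_int m) x)" for x
  define g where "g x = complex_of_real (fejer_kernel x) * (P x / fejer_mass)" for x
  define s where "s = sqrt (\<Sum>m\<in>S. (norm (c m))\<^sup>2)"
  have em[measurable]: "e y \<in> borel_measurable borel" for y unfolding e_def by measurable
  have Pm[measurable]: "P \<in> borel_measurable borel" unfolding P_def by measurable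
  have ne: "norm (e y x) = 1" for y x by (simp add: e_def norm_exp_i_times)
  have ee: "e y x * e z x = e (y + z) x" for x y z
    by (simp add: e_def exp_add[symmetric] algebra_simps)
  have ce: "cnj (e y x) = e (- y) x" for x y by (simp add: e_def exp_cnj)
  have nP: "norm (P x) \<le> (\<Sum>m\<in>S. norm (c m))" for x
    unfolding P_def by (rule order_trans[OF norm_sum]) (simp add: norm_mult ne)
  have FT: "(LINT x|lborel. complex_of_real (fejer_kernel x) * e y x) = complex_of_real (fejer_mass * hat y)" for y
    unfolding e_def by (rule fejer_kernel_transform)
  have ie: "integrable lborel (\<lambda>x. complex_of_real (fejer_kernel x) * e y x)" for y
    by (rule fejer_kernel_mult_integrable[where B=1]) (auto simp: ne)
  have ie': "integrable lborel (\<lambda>x. a * (complex_of_real (fejer_kernel x) * e y x))" for y a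
    using ie by simp
  have gi: "integrable lborel g"
    unfolding g_def
  proof (rule fejer_kernel_mult_integrable)
    show "norm (P x / complex_of_real fejer_mass) \<le> (\<Sum>m\<in>S. norm (c m)) / fejer_mass" for x
      using nP[of x] fejer_mass_pos by (simp add: norm_divide divide_right_mono)
  qed measurable
  have tr: "(LINT x|lborel. g x * e y x) = (\<Sum>m\<in>S. c m * of_real (hat (y - of_int m)))" for y
  proof -
    have "g x * e y x = (\<Sum>m\<in>S. (c m / fejer_mass) * (complex_of_real (fejer_kernel x) * e (y - of_int m) x))" for x
    proof -
      have "g x * e y x = (fejer_kernel x / fejer_mass) * (\<Sum>m\<in>S. c m * (e (- of_int m) x * e y x))"
        by (simp add: g_def P_def sum_distrib_left sum_distrib_right sum_divide_distrib mult_ac)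
      also have "\<dots> = (\<Sum>m\<in>S. (c m / fejer_mass) * (complex_of_real (fejer_kernel x) * e (y - of_int m) x))"
        unfolding ee by (simp add: sum_distrib_left mult_ac)
      finally show ?thesis .
    qed
    then have "(LINT x|lborel. g x * e y x)
      = (\<Sum>m\<in>S. LINT x|lborel. (c m / fejer_mass) * (complex_of_real (fejer_kernel x) * e (y - of_int m) x))"
      using ie' by simp
    also have "\<dots> = (\<Sum>m\<in>S. (c m / fejer_mass) * complex_of_real (fejer_mass * hat (y - of_int m)))"
      by (simp only: integral_mult_right_zero FT)
    also have "\<dots> = (\<Sum>m\<in>S. c m * of_real (hat (y - of_int m)))"
      using fejer_mass_pos by simp
    finally show ?thesis .
  qed
  have P2: "complex_of_real (fejer_kernel x * (norm (P x))\<^sup>2) =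
      (\<Sum>m\<in>S. \<Sum>n\<in>S. (c m * cnj (c n)) * (complex_of_real (fejer_kernel x) * e (of_int n - of_int m) x))" for x
  proof -
    have "complex_of_real ((norm (P x))\<^sup>2) = P x * cnj (P x)" by (rule complex_norm_square)
    also have "\<dots> = (\<Sum>m\<in>S. \<Sum>n\<in>S. (c m * cnj (c n)) * (e (- of_int m) x * e (of_int n) x))"
      unfolding P_def cnj_sum complex_cnj_mult ce sum_product by (simp add: mult_ac)
    finally show ?thesis
      unfolding ee of_real_mult by (simp add: sum_distrib_left mult_ac)
  qed
  have i2: "integrable lborel (\<lambda>x. fejer_kernel x * (norm (P x))\<^sup>2)"
    using fejer_kernel_mult_integrable[of "\<lambda>x. (norm (P x))\<^sup>2" "(\<Sum>m\<in>S. norm (c m))\<^sup>2"] nP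
    by (simp add: power_mono)
  have hat_int: "hat (of_int n - of_int m) = (if n = m then 1 else 0)" for n m :: int
  proof -
    have "(1::real) \<le> \<bar>of_int (n - m)\<bar>" if "n \<noteq> m" using that by linarith
    then show ?thesis by (auto simp: hat_def)
  qed
  have "complex_of_real (LINT x|lborel. fejer_kernel x * (norm (P x))\<^sup>2)
    = (LINT x|lborel. complex_of_real (fejer_kernel x * (norm (P x))\<^sup>2))"
    by (rule integral_complex_of_real[symmetric])
  also have "\<dots> = (\<Sum>m\<in>S. \<Sum>n\<in>S. (c m * cnj (c n)) * complex_of_real (fejer_mass * hat (of_int n - of_int m)))"
    unfolding P2 by (subst Bochner_Integration.integral_sum, use ie' in simp)
      (subst Bochner_Integration.integral_sum, use ie' in simp, simp only: integral_mult_right_zero FT)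
  also have "\<dots> = (\<Sum>m\<in>S. (c m * cnj (c m)) * complex_of_real fejer_mass)"
    unfolding hat_int using assms
    by (intro sum.cong) (auto simp: if_distrib[of "\<lambda>x. fejer_mass * x"] if_distrib[of complex_of_real] if_distrib[of "\<lambda>x. _ * x"] cong: if_cong)
  also have "\<dots> = complex_of_real (fejer_mass * s\<^sup>2)"
    unfolding s_def by (simp add: sum_nonneg complex_norm_square[symmetric] sum_distrib_left mult_ac
        flip: of_real_power of_real_mult of_real_sum)
  finally have I2: "(LINT x|lborel. fejer_kernel x * (norm (P x))\<^sup>2) = fejer_mass * s\<^sup>2"
    by (simp only: of_real_eq_iff)
  have "(LINT x|lborel. norm (g x)) \<le> s"
  proof (cases "s = 0")
    case True
    then have "\<forall>m\<in>S. c m = 0" using assms by (auto simp: s_def sum_nonneg_eq_0_iff)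
    then have "P x = 0" for x by (simp add: P_def)
    then show ?thesis using True by (simp add: g_def)
  next
    case False
    then have s: "0 < s" by (simp add: s_def sum_nonneg less_le)
    \<comment> \<open>The arithmetic-geometric mean inequality in place of Cauchy-Schwarz: weighting
      with the expected bound \<open>s\<close> makes the integral of the right side exactly
      \<open>s\<close>.\<close>
    have "norm (g x) \<le> (s * fejer_kernel x + (fejer_kernel x * (norm (P x))\<^sup>2) / s) / (2 * fejer_mass)" for x
    proof -
      have "0 \<le> (s - norm (P x))\<^sup>2" by simp
      then have "norm (P x) \<le> (s + (norm (P x))\<^sup>2 / s) / 2"
        using s by (simp add: field_simps power2_eq_square)
      then have "fejer_kernel x / fejer_mass * norm (P x) \<le> fejer_kernel x / fejer_mass * ((s + (norm (P x))\<^sup>2 / s) / 2)"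
        using fejer_mass_pos fejer_kernel_nonneg[of x] by (intro mult_left_mono) auto
      moreover have "norm (g x) = fejer_kernel x / fejer_mass * norm (P x)"
        using fejer_mass_pos fejer_kernel_nonneg[of x] by (simp add: g_def norm_mult norm_divide)
      ultimately show ?thesis by (simp add: field_simps)
    qed
    then have "(LINT x|lborel. norm (g x)) \<le>
      (LINT x|lborel. (s * fejer_kernel x + (fejer_kernel x * (norm (P x))\<^sup>2) / s) / (2 * fejer_mass))"
      using gi i2 fejer_kernel_integrable by (intro integral_mono) auto
    also have "\<dots> = (s * fejer_mass + (fejer_mass * s\<^sup>2) / s) / (2 * fejer_mass)"
      using i2 fejer_kernel_integrable I2 by (simp add: fejer_mass_def)
    also have "\<dots> = s" using s fejer_mass_pos by (simp add: field_simps power2_eq_square)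
    finally show ?thesis .
  qed
  then show ?thesis
    unfolding A_norm_le_def s_def[symmetric] using gi tr by (intro exI[of _ g]) (simp add: e_def)
qed

section \<open>Compactly supported Lipschitz functions\<close>

definition affine_interp :: "real \<Rightarrow> (real \<Rightarrow> complex) \<Rightarrow> real \<Rightarrow> complex" where
  "affine_interp N h y = of_real (1 - frac (N * y)) * h (of_int \<lfloor>N * y\<rfloor> / N)
     + of_real (frac (N * y)) * h ((of_int \<lfloor>N * y\<rfloor> + 1) / N)"

text \<open>The Faber-Schauder coefficient of \<open>h\<close> on the cell from \<open>m / N\<close>
  to \<open>(m + 1) / N\<close>: the deviation at the midpoint from linear interpolation.\<close>

definition mid_defect :: "real \<Rightarrow> (real \<Rightarrow> complex) \<Rightarrow> int \<Rightarrow> complex" where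
  "mid_defect N h m = h ((2 * of_int m + 1) / (2 * N)) - (h (of_int m / N) + h ((of_int m + 1) / N)) / 2"

text \<open>Both interpolants agree at the coarse nodes, so on a coarse cell they differ by a
  multiple of the hat over that cell, whose height is the defect at the midpoint. The two cases are
  the halves of the cell that contains \<open>y\<close>.\<close>

lemma affine_interp_double:
  assumes "N > 0"
  shows "affine_interp (2 * N) h y - affine_interp N h y
    = mid_defect N h \<lfloor>N * y\<rfloor> * of_real (hat (2 * N * y - of_int (2 * \<lfloor>N * y\<rfloor> + 1)))"
proof -
  define m where "m = \<lfloor>N * y\<rfloor>"
  define th where "th = frac (N * y)"
  have th: "0 \<le> th" "th < 1" "N * y = of_int m + th"
    using frac_lt_1[of "N * y"] by (auto simp: th_def m_def frac_def)
  have e: "of_int (2 * m) / (2 * N) = of_int m / N" "(of_int (2 * m + 1) + 1) / (2 * N) = (of_int m + 1) / N"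
    "of_int (2 * m + 1) / (2 * N) = (2 * of_int m + 1) / (2 * N)"
    "(of_int (2 * m) + 1) / (2 * N) = (2 * of_int m + 1) / (2 * N)"
    using assms by (auto simp: field_simps)
  show ?thesis
  proof (cases "th < 1/2")
    case True
    have fl: "\<lfloor>2 * N * y\<rfloor> = 2 * m" using True th by (intro floor_unique) auto
    have fr: "frac (2 * N * y) = 2 * th" using th by (simp add: frac_def fl)
    have ht: "hat (2 * N * y - of_int (2 * m + 1)) = 2 * th" using th True by (simp add: hat_def)
    show ?thesis
      unfolding affine_interp_def mid_defect_def m_def[symmetric] th_def[symmetric] fl fr ht e
      by (simp add: algebra_simps)
  next
    case False
    have fl: "\<lfloor>2 * N * y\<rfloor> = 2 * m + 1" using False th by (intro floor_unique) auto
    have fr: "frac (2 * N * y) = 2 * th - 1" using th by (simp add: frac_def fl)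
    have ht: "hat (2 * N * y - of_int (2 * m + 1)) = 2 - 2 * th" using th False by (simp add: hat_def)
    show ?thesis
      unfolding affine_interp_def mid_defect_def m_def[symmetric] th_def[symmetric] fl fr ht e
      by (simp add: field_simps)
  qed
qed

text \<open>The refinement is a combination of hats centred at odd integers, dilated by
  \<open>2 * N\<close>. Dilation leaves the bound unchanged, so orthogonality on the integer grid
  gives the Euclidean norm of the defects.\<close>

lemma A_norm_le_affine_interp_double:
  assumes N: "N > 0" and S: "finite S" "\<And>m. m \<notin> S \<Longrightarrow> mid_defect N h m = 0"
  shows "A_norm_le (\<lambda>y. affine_interp (2 * N) h y - affine_interp N h y) (sqrt (\<Sum>m\<in>S. (norm (mid_defect N h m))\<^sup>2))"
proof -
  let ?o = "\<lambda>m::int. 2 * m + 1"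
  define c where "c k = mid_defect N h ((k - 1) div 2)" for k
  have inj: "inj_on ?o S" by (auto simp: inj_on_def)
  have cm: "c (?o m) = mid_defect N h m" for m by (simp add: c_def)
  have "A_norm_le (\<lambda>y. \<Sum>k\<in>?o ` S. c k * of_real (hat (y - of_int k))) (sqrt (\<Sum>k\<in>?o ` S. (norm (c k))\<^sup>2))"
    using S(1) by (intro A_norm_le_hat_sum) auto
  then have "A_norm_le (\<lambda>y. \<Sum>m\<in>S. mid_defect N h m * of_real (hat (y - of_int (?o m)))) (sqrt (\<Sum>m\<in>S. (norm (mid_defect N h m))\<^sup>2))"
    by (simp only: sum.reindex[OF inj] o_def cm)
  from A_norm_le_scale[OF this, of "2 * N"]
  have "A_norm_le (\<lambda>y. \<Sum>m\<in>S. mid_defect N h m * of_real (hat (2 * N * y - of_int (?o m)))) (sqrt (\<Sum>m\<in>S. (norm (mid_defect N h m))\<^sup>2))"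
    using N by simp
  moreover have "(\<Sum>m\<in>S. mid_defect N h m * of_real (hat (2 * N * y - of_int (?o m)))) = affine_interp (2 * N) h y - affine_interp N h y" for y
  proof -
    let ?t = "\<lambda>m. mid_defect N h m * of_real (hat (2 * N * y - of_int (?o m)))"
    \<comment> \<open>After the dilation each hat vanishes outside its own coarse cell, so only the
      cell containing \<open>y\<close> contributes.\<close>
    have z: "?t m = 0" if "m \<noteq> \<lfloor>N * y\<rfloor>" for m
    proof -
      have "m < \<lfloor>N * y\<rfloor> \<or> m > \<lfloor>N * y\<rfloor>" using that by linarith
      then have "of_int m + 1 \<le> N * y \<or> N * y \<le> of_int m" by linarith
      then show ?thesis by (auto simp: hat_def)
    qed
    have "?t m = (if m = \<lfloor>N * y\<rfloor> then ?t m else 0)" for m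
    proof (cases "m = \<lfloor>N * y\<rfloor>")
      case False
      then show ?thesis by (simp only: z[OF False] if_False)
    qed simp
    then have "sum ?t S = (\<Sum>m\<in>S. if m = \<lfloor>N * y\<rfloor> then ?t m else 0)"
      by (intro sum.cong) auto
    also have "\<dots> = (if \<lfloor>N * y\<rfloor> \<in> S then ?t \<lfloor>N * y\<rfloor> else 0)"
      using S(1) by simp
    also have "\<dots> = ?t \<lfloor>N * y\<rfloor>" using S(2) by auto
    finally show ?thesis using affine_interp_double[OF N, of h y] by simp
  qed
  ultimately show ?thesis by simp
qed

lemma affine_interp_one_eq_sum:
  assumes S: "finite S" "\<And>m::int. m \<notin> S \<Longrightarrow> h (of_int m) = 0"
  shows "affine_interp 1 h y = (\<Sum>m\<in>S. h (of_int m) * of_real (hat (y - of_int m)))"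
proof -
  let ?t = "\<lambda>m::int. h (of_int m) * of_real (hat (y - of_int m))"
  let ?T = "{\<lfloor>y\<rfloor>, \<lfloor>y\<rfloor> + 1}"
  have z: "?t m = 0" if "m \<notin> ?T" for m
  proof -
    have "m < \<lfloor>y\<rfloor> \<or> m > \<lfloor>y\<rfloor> + 1" using that by auto
    then have "of_int m + 1 \<le> y \<or> y + 1 \<le> of_int m" by linarith
    then show ?thesis by (auto simp: hat_def)
  qed
  have "sum ?t S = sum ?t (S \<union> ?T)" using S by (intro sum.mono_neutral_left) auto
  also have "\<dots> = sum ?t ?T" using S(1) z by (intro sum.mono_neutral_right) auto
  also have "\<dots> = affine_interp 1 h y"
  proof -
    have "hat (y - of_int \<lfloor>y\<rfloor>) = 1 - frac y" "hat (y - of_int (\<lfloor>y\<rfloor> + 1)) = frac y"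
      using frac_lt_1[of y] frac_ge_0[of y] by (auto simp: hat_def frac_def)
    then show ?thesis by (simp add: affine_interp_def mult.commute)
  qed
  finally show ?thesis ..
qed

lemma affine_interp_error:
  assumes N: "N > 0" and lip: "\<And>x y. norm (h x - h y) \<le> \<bar>x - y\<bar>"
  shows "norm (affine_interp N h y - h y) \<le> 1 / N"
proof -
  define m where "m = \<lfloor>N * y\<rfloor>"
  define th where "th = frac (N * y)"
  have th: "0 \<le> th" "th < 1" "N * y = of_int m + th"
    using frac_lt_1[of "N * y"] by (auto simp: th_def m_def frac_def)
  have y: "y = of_int m / N + th / N" using th(3) N by (simp add: field_simps)
  have "affine_interp N h y - h y = of_real (1 - th) * (h (of_int m / N) - h y) + of_real th * (h ((of_int m + 1) / N) - h y)"
    unfolding affine_interp_def m_def th_def by (simp add: algebra_simps)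
  also have "norm \<dots> \<le> (1 - th) * norm (h (of_int m / N) - h y) + th * norm (h ((of_int m + 1) / N) - h y)"
    using th by (intro order_trans[OF norm_triangle_ineq]) (simp add: norm_mult del: of_real_diff)
  also have "\<dots> \<le> (1 - th) * (1 / N) + th * (1 / N)"
  proof -
    have "norm (h (of_int m / N) - h y) \<le> 1 / N"
      using lip[of "of_int m / N" y] th N y by (auto intro!: order_trans[OF lip] divide_right_mono)
    moreover have "norm (h ((of_int m + 1) / N) - h y) \<le> 1 / N"
    proof -
      have "(of_int m + 1) / N - y = (1 - th) / N" using y N by (simp add: field_simps)
      then show ?thesis using lip[of "(of_int m + 1) / N" y] th N
        by (auto intro!: order_trans[OF lip] divide_right_mono)
    qed
    ultimately show ?thesis using th by (intro add_mono mult_left_mono) auto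
  qed
  also have "\<dots> = 1 / N" by (simp add: algebra_simps flip: add_divide_distrib)
  finally show ?thesis .
qed

text \<open>At unit scale there are \<open>2 * L + 1\<close> coefficients of size at most
  \<open>1\<close>, hence a norm of at most \<open>2 * sqrt L\<close>. At scale
  \<open>N = 2 ^ n\<close> there are \<open>2 * N * L\<close> defects of size at most
  \<open>1 / (2 * N)\<close>, hence a norm of at most \<open>sqrt (L / (2 * N))\<close>: the growing
  number of hats loses against the decay of the defects, and the refinements form a geometric
  series.\<close>

lemma A_norm_le_lipschitz_normalized:
  fixes L :: nat
  assumes L: "L \<ge> 1" and supp: "\<And>t::real. \<bar>t\<bar> \<ge> L \<Longrightarrow> h t = 0"
    and bd: "\<And>t. norm (h t) \<le> 1" and lip: "\<And>x y. norm (h x - h y) \<le> \<bar>x - y\<bar>"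
  shows "A_norm_le h (5 * sqrt L)"
proof -
  have supp': "h t = 0" if "real L \<le> t \<or> t \<le> - real L" for t
    using that by (intro supp) auto
  have A: "A_norm_le (affine_interp 1 h) (2 * sqrt L)"
  proof -
    let ?S = "{- int L..int L}"
    have 0: "h (of_int m) = 0" if "m \<notin> ?S" for m using that by (intro supp) auto
    have "affine_interp 1 h = (\<lambda>y. \<Sum>m\<in>?S. h (of_int m) * of_real (hat (y - of_int m)))"
      by (intro ext affine_interp_one_eq_sum 0) auto
    then have "A_norm_le (affine_interp 1 h) (sqrt (\<Sum>m\<in>?S. (norm (h (of_int m)))\<^sup>2))"
      using A_norm_le_hat_sum[of ?S "\<lambda>m. h (of_int m)"] by simp
    moreover have "sqrt (\<Sum>m\<in>?S. (norm (h (of_int m)))\<^sup>2) \<le> 2 * sqrt L"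
    proof -
      have "(\<Sum>m\<in>?S. (norm (h (of_int m)))\<^sup>2) \<le> (\<Sum>m\<in>?S. 1)"
        using bd by (intro sum_mono) (simp add: power_le_one)
      also have "\<dots> \<le> 4 * L" using L by simp
      finally have "sqrt (\<Sum>m\<in>?S. (norm (h (of_int m)))\<^sup>2) \<le> sqrt (4 * L)"
        by (rule real_sqrt_le_mono)
      then show ?thesis by (simp add: real_sqrt_mult)
    qed
    ultimately show ?thesis by (rule A_norm_le_mono)
  qed
  \<comment> \<open>The true ratio is \<open>1 / sqrt 2\<close>; the rational \<open>3/4\<close>
    dominates it because \<open>1/2 \<le> 9/16\<close>, and makes the refinements add up to
    \<open>3 * sqrt L\<close>.\<close>
  have B: "A_norm_le (\<lambda>y. affine_interp (2 ^ Suc n) h y - affine_interp (2 ^ n) h y) (sqrt L * (3/4) ^ Suc n)" for n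
  proof -
    define N :: real where "N = 2 ^ n"
    define K :: int where "K = 2 ^ n * int L"
    have N: "N > 0" by (simp add: N_def)
    have KN: "real_of_int K = N * L" by (simp add: N_def K_def)
    \<comment> \<open>The index \<open>m\<close> names the cell to the right of
      \<open>m / N\<close>, so the cells between \<open>- L\<close> and \<open>L\<close> form a
      half-open range.\<close>
    let ?S = "{-K..<K}"
    have 0: "mid_defect N h m = 0" if "m \<notin> ?S" for m
    proof (cases "m \<ge> K")
      case True
      then have "N * L \<le> real_of_int m" unfolding KN[symmetric] by simp
      then have "L \<le> real_of_int m / N" "L \<le> (real_of_int m + 1) / N" "L \<le> (2 * real_of_int m + 1) / (2 * N)"
        using N by (auto simp: field_simps)
      then have "h (real_of_int m / N) = 0" "h ((real_of_int m + 1) / N) = 0" "h ((2 * real_of_int m + 1) / (2 * N)) = 0"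
        by (auto intro!: supp')
      then show ?thesis by (simp add: mid_defect_def)
    next
      case False
      then have "m + 1 \<le> - K" using that by auto
      then have "real_of_int m + 1 \<le> - (N * L)" unfolding KN[symmetric] by linarith
      then have "real_of_int m / N \<le> - L" "(real_of_int m + 1) / N \<le> - L" "(2 * real_of_int m + 1) / (2 * N) \<le> - L"
        using N by (auto simp: field_simps)
      then have "h (real_of_int m / N) = 0" "h ((real_of_int m + 1) / N) = 0" "h ((2 * real_of_int m + 1) / (2 * N)) = 0"
        by (auto intro!: supp')
      then show ?thesis by (simp add: mid_defect_def)
    qed
    have md: "norm (mid_defect N h m) \<le> 1 / (2 * N)" for m
    proof -
      let ?c = "h ((2 * of_int m + 1) / (2 * N))"
      have eq0: "mid_defect N h m = ((?c - h (of_int m / N)) + (?c - h ((of_int m + 1) / N))) / 2"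
        by (simp add: mid_defect_def field_simps)
      have eq: "norm (mid_defect N h m)
          = norm ((?c - h (of_int m / N)) + (?c - h ((of_int m + 1) / N))) / 2"
        unfolding eq0 by (simp add: norm_divide)
      have d: "(2 * of_int m + 1) / (2 * N) - of_int m / N = 1 / (2 * N)"
        "(2 * of_int m + 1) / (2 * N) - (of_int m + 1) / N = - (1 / (2 * N))"
        using N by (simp_all add: field_simps)
      have "norm (?c - h (of_int m / N)) \<le> \<bar>1 / (2 * N)\<bar>"
        "norm (?c - h ((of_int m + 1) / N)) \<le> \<bar>- (1 / (2 * N))\<bar>"
        using lip[of "(2 * of_int m + 1) / (2 * N)" "of_int m / N"]
          lip[of "(2 * of_int m + 1) / (2 * N)" "(of_int m + 1) / N"]
        unfolding d by - assumption+
      then have "norm (?c - h (of_int m / N)) + norm (?c - h ((of_int m + 1) / N)) \<le> 1 / (2 * N) + 1 / (2 * N)"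
        using N by (intro add_mono) auto
      then show ?thesis
        unfolding eq using norm_triangle_ineq[of "?c - h (of_int m / N)" "?c - h ((of_int m + 1) / N)"] by linarith
    qed
    have "A_norm_le (\<lambda>y. affine_interp (2 * N) h y - affine_interp N h y) (sqrt (\<Sum>m\<in>?S. (norm (mid_defect N h m))\<^sup>2))"
      by (rule A_norm_le_affine_interp_double[OF N _ 0]) auto
    moreover have "sqrt (\<Sum>m\<in>?S. (norm (mid_defect N h m))\<^sup>2) \<le> sqrt L * (3/4) ^ Suc n"
    proof (rule real_le_lsqrt)
      have "(\<Sum>m\<in>?S. (norm (mid_defect N h m))\<^sup>2) \<le> (\<Sum>m\<in>?S. (1 / (2 * N))\<^sup>2)"
        using md by (intro sum_mono power_mono) auto
      also have "\<dots> = (2 * (N * L)) * (1 / (2 * N))\<^sup>2"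
        using L by (simp add: KN[symmetric] K_def)
      also have "\<dots> = L * (1/2) ^ Suc n"
      proof -
        have "(2 * (N * L)) * (1 / (2 * N))\<^sup>2 = L / (2 * N)"
          using N by (simp add: power2_eq_square)
        then show ?thesis by (simp add: N_def power_one_over)
      qed
      also have "\<dots> \<le> L * (9/16) ^ Suc n" by (intro mult_left_mono power_mono) auto
      also have "\<dots> = (sqrt L * (3/4) ^ Suc n)\<^sup>2"
      proof -
        have "((3/4::real) ^ Suc n)\<^sup>2 = ((3/4)\<^sup>2) ^ Suc n" by (metis power_mult mult.commute)
        then have "((3/4::real) ^ Suc n)\<^sup>2 = (9/16) ^ Suc n" by (simp add: power_divide)
        then show ?thesis by (simp only: power_mult_distrib) simp
      qed
      finally show "(\<Sum>m\<in>?S. (norm (mid_defect N h m))\<^sup>2) \<le> (sqrt L * (3/4) ^ Suc n)\<^sup>2" .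
    qed auto
    ultimately show ?thesis unfolding N_def using A_norm_le_mono by simp
  qed
  have "(\<lambda>n. affine_interp (2 ^ n) h y) \<longlonglongrightarrow> h y" for y
  proof (rule Lim_null_comparison[where g="\<lambda>n. (1/2)^n", THEN LIM_zero_cancel])
    show "\<forall>\<^sub>F n in sequentially. norm (affine_interp (2 ^ n) h y - h y) \<le> (1/2) ^ n"
      using affine_interp_error[OF _ lip, of "2 ^ _"] by (intro always_eventually allI) (simp add: power_one_over)
  qed (intro LIMSEQ_realpow_zero; simp)
  from telescope_sums[OF this]
  have *: "(\<lambda>n. affine_interp (2 ^ Suc n) h y - affine_interp (2 ^ n) h y) sums (h y - affine_interp 1 h y)" for y by simp
  have "A_norm_le (\<lambda>y. h y - affine_interp 1 h y) (\<Sum>n. sqrt L * (3/4) ^ Suc n)"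
    by (rule A_norm_le_series[OF B _ *]) (simp add: summable_mult summable_geometric)
  also have "(\<Sum>n. sqrt L * (3/4) ^ Suc n) = sqrt L * 3"
  proof -
    have "(\<lambda>n. sqrt L * (3/4) * (3/4) ^ n) sums (sqrt L * (3/4) * (1 / (1 - 3/4)))"
      by (intro sums_mult geometric_sums) simp
    then show ?thesis by (simp add: sums_iff mult_ac)
  qed
  finally have "A_norm_le (\<lambda>y. h y - affine_interp 1 h y + affine_interp 1 h y) (sqrt L * 3 + 2 * sqrt L)"
    by (rule A_norm_le_add[OF _ A])
  then show ?thesis by (simp add: mult.commute)
qed

text \<open>Rescaling the argument by \<open>M / D\<close> and dividing by \<open>M\<close> makes
  the bound and the Lipschitz constant \<open>1\<close> and the support radius
  \<open>r = L * D / M\<close>, which is at least \<open>1\<close> since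
  \<open>D * L \<ge> M\<close>. Rounding \<open>r\<close> up to an integer at most doubles it, and
  \<open>5 * sqrt 2 \<le> 8\<close>.\<close>

lemma A_norm_le_lipschitz:
  assumes D: "D * L \<ge> M" "M \<ge> 0" "L > 0"
    and supp: "\<And>t::real. \<bar>t\<bar> \<ge> L \<Longrightarrow> h t = 0"
    and bd: "\<And>t. norm (h t) \<le> M" and lip: "\<And>x y. norm (h x - h y) \<le> D * \<bar>x - y\<bar>"
  shows "A_norm_le h (8 * sqrt (L * M * D))"
proof (cases "M = 0")
  case True
  then have "h = (\<lambda>t. 0)" using bd by auto
  then show ?thesis using True A_norm_le_zero by simp
next
  case False
  then have M: "M > 0" using D by simp
  then have "0 < D * L" using D by linarith
  then have D0: "D > 0" using D(3) by (simp add: zero_less_mult_iff)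
  define r where "r = L * D / M"
  have r: "r \<ge> 1" using M D by (simp add: r_def mult.commute)
  define n where "n = nat \<lceil>r\<rceil>"
  have n: "n \<ge> 1" "r \<le> n" "n \<le> 2 * r" using r unfolding n_def by linarith+
  define H where "H s = h (s * (M / D)) / M" for s
  have "A_norm_le H (5 * sqrt n)"
  proof (rule A_norm_le_lipschitz_normalized[OF n(1)])
    show "H t = 0" if "\<bar>t\<bar> \<ge> n" for t :: real
    proof -
    have "r \<le> \<bar>t\<bar>" using n that by linarith
    then have "L \<le> \<bar>t * (M / D)\<bar>" using M D0
      by (simp add: r_def abs_mult pos_divide_le_eq pos_le_divide_eq)
    then show "H t = 0" by (simp add: H_def supp)
    qed
  next
    show "norm (H t) \<le> 1" for t using bd[of "t * (M / D)"] M by (simp add: H_def norm_divide)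
    show "norm (H x - H y) \<le> \<bar>x - y\<bar>" for x y
    proof -
      have "H x - H y = (h (x * (M / D)) - h (y * (M / D))) / M"
        by (simp add: H_def diff_divide_distrib)
      then have "norm (H x - H y) = norm (h (x * (M / D)) - h (y * (M / D))) / M"
        using M by (simp add: norm_divide)
      also have "\<dots> \<le> D * \<bar>x * (M / D) - y * (M / D)\<bar> / M"
        using M lip by (intro divide_right_mono) auto
      also have "\<bar>x * (M / D) - y * (M / D)\<bar> = \<bar>x - y\<bar> * (M / D)"
        using M D0 by (simp only: left_diff_distrib[symmetric] abs_mult) simp
      also have "D * (\<bar>x - y\<bar> * (M / D)) / M = \<bar>x - y\<bar>" using M D0 by simp
      finally show ?thesis .
    qed
  qed
  from A_norm_le_cmult[OF A_norm_le_scale[OF this, of "D / M"], of M]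
  have "A_norm_le h (M * (5 * sqrt n))" using M D0 by (simp add: H_def)
  moreover have "M * (5 * sqrt n) \<le> 8 * sqrt (L * M * D)"
  proof -
    have "M * (5 * sqrt n) = sqrt (25 * M\<^sup>2 * n)" using M by (simp add: real_sqrt_mult)
    also have "\<dots> \<le> sqrt (64 * (L * M * D))"
    proof (rule real_sqrt_le_mono)
      have "25 * M\<^sup>2 * n \<le> 25 * M\<^sup>2 * (2 * r)" using n M by (intro mult_left_mono) auto
      also have "\<dots> = 50 * (L * M * D)" using M by (simp add: r_def power2_eq_square)
      also have "\<dots> \<le> 64 * (L * M * D)" using M D0 D by simp
      finally show "25 * M\<^sup>2 * n \<le> 64 * (L * M * D)" .
    qed
    also have "\<dots> = 8 * sqrt (L * M * D)"
      by (simp add: real_sqrt_mult)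
    finally show ?thesis .
  qed
  ultimately show ?thesis by (rule A_norm_le_mono)
qed

section \<open>Differentiability of absolutely continuous functions\<close>

text \<open>The Vitali covering theorem yields a countable disjoint family that misses only a null
  set of \<open>S\<close>, and finitely many members already have nearly the full measure. As
  \<open>S\<close> may be non-measurable, what remains of it is enclosed in a measurable set
  \<open>T\<close>. In the applications \<open>F\<close> is a condition on the slope over the
  interval.\<close>

lemma finite_Vitali_intervals:
  fixes S U :: "real set" and F :: "real \<Rightarrow> real \<Rightarrow> bool"
  assumes U: "open U" "U \<in> lmeasurable" and SU: "S \<subseteq> U" and e: "e > 0"
    and cov: "\<And>x d. x \<in> S \<Longrightarrow> d > 0 \<Longrightarrow> \<exists>u v. u < v \<and> u \<le> x \<and> x \<le> v \<and> v - u < d \<and> F u v"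
  obtains D T where "D division_of \<Union>D" "\<Union>D \<subseteq> U"
    "\<And>k. k \<in> D \<Longrightarrow> \<exists>u v. u < v \<and> k = {u..v} \<and> F u v"
    "T \<in> lmeasurable" "measure lebesgue T < e" "S \<subseteq> \<Union>D \<union> T"
proof -
  define K where "K = {(u, v). u < v \<and> {u..v} \<subseteq> U \<and> F u v}"
  \<comment> \<open>The covering theorem speaks of balls, so an interval is encoded by its pair of
    end points and viewed as a ball about its midpoint.\<close>
  let ?a = "\<lambda>(u::real, v). (u + v) / 2" and ?r = "\<lambda>(u::real, v). (v - u) / 2"
  have ball: "cball ((u + v) / 2) ((v - u) / 2) = {u..v}" for u v :: real
    by (auto simp: cball_def dist_real_def abs_if field_simps)
  have r: "0 < ?r i" if "i \<in> K" for i using that by (auto simp: K_def)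
  have c: "\<exists>i. i \<in> K \<and> x \<in> cball (?a i) (?r i) \<and> ?r i < d" if x: "x \<in> S" and d: "0 < d" for x d
  proof -
    obtain d' where d': "d' > 0" "ball x d' \<subseteq> U" using U(1) SU x by (meson openE subsetD)
    obtain u v where uv: "u < v" "u \<le> x" "x \<le> v" "v - u < min d d'" "F u v"
      using cov[OF x, of "min d d'"] d d' by auto
    have "{u..v} \<subseteq> ball x d'" using uv by (auto simp: dist_real_def)
    then have "(u, v) \<in> K" using uv d' by (auto simp: K_def)
    then show ?thesis using uv by (intro exI[of _ "(u, v)"]) (auto simp: ball)
  qed
  obtain C where C: "countable C" "C \<subseteq> K"
     "pairwise (\<lambda>i j. disjnt (cball (?a i) (?r i)) (cball (?a j) (?r j))) C"
     "negligible (S - (\<Union>i\<in>C. cball (?a i) (?r i)))"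
    using Vitali_covering_theorem_cballs[of K ?r S ?a, OF r c] by blast
  define J where "J = (\<lambda>(u::real, v). {u..v})"
  have J: "cball (?a i) (?r i) = J i" for i by (cases i) (simp add: J_def ball)
  note C = C[unfolded J]
  have JU: "J i \<subseteq> U" "J i \<in> lmeasurable" if "i \<in> C" for i
    using that C(2) by (auto simp: J_def K_def)
  have bound: "measure lebesgue (\<Union>\<D>') \<le> measure lebesgue U" if "\<D>' \<subseteq> J ` C" "finite \<D>'" for \<D>'
  proof (rule measure_mono_fmeasurable[OF _ _ U(2)])
    show "\<Union>\<D>' \<subseteq> U" using that(1) JU(1) by fast
    show "\<Union>\<D>' \<in> sets lebesgue"
      using that JU(2) by (intro sets.finite_Union) (auto dest: fmeasurableD)
  qed
  obtain \<D>' where D': "\<D>' \<subseteq> J ` C" "finite \<D>'" "measure lebesgue (\<Union>(J ` C)) - e < measure lebesgue (\<Union>\<D>')"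
  proof (rule measure_countable_Union_approachable[of "J ` C" e, OF _ e _ bound])
    show "countable (J ` C)" using C(1) by simp
    show "d \<in> lmeasurable" if "d \<in> J ` C" for d using that JU(2) by fast
  qed
  define T where "T = (S - \<Union>(J ` C)) \<union> (\<Union>(J ` C) - \<Union>\<D>')"
  have UJ: "\<Union>(J ` C) \<in> lmeasurable"
    using C(1) JU U by (intro fmeasurableI2[OF U(2)]) (auto intro!: sets.countable_UN'' dest: fmeasurableD)
  have UD: "\<Union>\<D>' \<in> lmeasurable"
    using D' JU by (intro fmeasurable.finite_Union) auto
  have neg: "negligible (S - \<Union>(J ` C))" using C(4) by simp
  have Tm: "T \<in> lmeasurable"
    unfolding T_def by (rule fmeasurable.Un[OF negligible_imp_measurable[OF neg] fmeasurable.Diff[OF UJ UD]])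
  have "measure lebesgue T \<le> measure lebesgue (S - \<Union>(J ` C)) + measure lebesgue (\<Union>(J ` C) - \<Union>\<D>')"
    unfolding T_def using neg UJ UD by (intro measure_Un_le) (auto simp: negligible_imp_sets dest: fmeasurableD)
  also have "\<dots> = measure lebesgue (\<Union>(J ` C)) - measure lebesgue (\<Union>\<D>')"
    using neg UJ UD D'(1) by (subst measurable_measure_Diff) (auto simp: negligible_imp_measure0 dest: fmeasurableD)
  also have "\<dots> < e" using D' by simp
  finally have Te: "measure lebesgue T < e" .
  have fm: "\<exists>u v. u < v \<and> k = {u..v} \<and> F u v" if k: "k \<in> \<D>'" for k
  proof -
    obtain i where "i \<in> C" "k = J i" using k D'(1) by fast
    then obtain u v where "(u, v) \<in> C" "k = J (u, v)" by (cases i) simp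
    then show ?thesis using C(2) by (auto simp: K_def J_def)
  qed
  have div: "\<D>' division_of \<Union>\<D>'"
  proof (rule division_ofI)
    fix k assume k: "k \<in> \<D>'"
    from fm[OF k] show "k \<noteq> {}" "\<exists>a b. k = cbox a b" by auto
    fix k' assume k': "k' \<in> \<D>'" "k \<noteq> k'"
    obtain i j where ij: "i \<in> C" "j \<in> C" "k = J i" "k' = J j" using k k' D'(1) by blast
    then have "i \<noteq> j" using k' by auto
    from pairwiseD[OF C(3) ij(1,2) this] have "disjnt k k'" by (simp add: ij)
    then show "interior k \<inter> interior k' = {}"
      using interior_subset[of k] interior_subset[of k'] by (auto simp: disjnt_def)
  qed (use D' in auto)
  show ?thesis
  proof (rule that[OF div _ fm Tm Te])
    show "\<Union>\<D>' \<subseteq> U" using D'(1) JU(1) by fast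
    show "S \<subseteq> \<Union>\<D>' \<union> T" by (auto simp: T_def)
  qed
qed

text \<open>Here \<open>w\<close> is the outer measure of \<open>S\<close>, an infimum over
  measurable supersets, because the exceptional sets are not known to be measurable. It is positive,
  since supersets of arbitrarily small measure would make \<open>S\<close> negligible.\<close>

lemma non_negligible_outer_measure:
  fixes S :: "real set"
  assumes "\<not> negligible S" "S \<subseteq> V" "open V" "V \<in> lmeasurable"
  obtains w where "w > 0" "\<And>T. T \<in> lmeasurable \<Longrightarrow> S \<subseteq> T \<Longrightarrow> w \<le> measure lebesgue T"
    "\<And>e. e > 0 \<Longrightarrow> \<exists>U. open U \<and> S \<subseteq> U \<and> U \<subseteq> V \<and> U \<in> lmeasurable \<and> measure lebesgue U < w + e"
proof -
  define Q where "Q = {measure lebesgue T |T. T \<in> lmeasurable \<and> S \<subseteq> T}"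
  have Q: "Q \<noteq> {}" "bdd_below Q" using assms by (auto simp: Q_def intro!: bdd_belowI[of _ 0])
  have le: "Inf Q \<le> measure lebesgue T" if "T \<in> lmeasurable" "S \<subseteq> T" for T
    using that Q by (intro cInf_lower) (auto simp: Q_def)
  have ex: "\<exists>U. open U \<and> S \<subseteq> U \<and> U \<subseteq> V \<and> U \<in> lmeasurable \<and> measure lebesgue U < Inf Q + e" if e: "e > 0" for e
  proof -
    have "\<exists>q\<in>Q. q < Inf Q + e/2" using Q e by (intro cInf_lessD) auto
    then obtain T where T: "T \<in> lmeasurable" "S \<subseteq> T" "measure lebesgue T < Inf Q + e/2" by (auto simp: Q_def)
    obtain W where W: "open W" "T \<subseteq> W" "(W - T) \<in> lmeasurable" "emeasure lebesgue (W - T) < ennreal (e/2)"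
      using sets_lebesgue_outer_open[of T "e/2"] T e by (metis fmeasurableD half_gt_zero)
    have "measure lebesgue (W - T) < e/2"
      using W(3,4) e by (simp add: emeasure_eq_measure2 ennreal_less_iff)
    moreover have Wm: "W \<in> lmeasurable"
      using fmeasurable.Un[OF W(3) T(1)] W(2) by (simp add: Un_absorb2)
    moreover have "measure lebesgue (W - T) = measure lebesgue W - measure lebesgue T"
      using W Wm T by (intro measurable_measure_Diff) (auto dest: fmeasurableD)
    moreover have "measure lebesgue (W \<inter> V) \<le> measure lebesgue W"
      using W assms Wm by (intro measure_mono_fmeasurable) auto
    ultimately have "measure lebesgue (W \<inter> V) < Inf Q + e" using T(3) by linarith
    then show ?thesis using W assms T Wm by (intro exI[of _ "W \<inter> V"]) auto
  qed
  have "Inf Q > 0"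
  proof (rule ccontr)
    assume "\<not> Inf Q > 0"
    have "\<exists>T. S \<subseteq> T \<and> T \<in> lmeasurable \<and> measure lebesgue T \<le> e" if e: "e > 0" for e
    proof -
      obtain U where "S \<subseteq> U" "U \<in> lmeasurable" "measure lebesgue U < Inf Q + e"
        using ex[OF e] by blast
      then show ?thesis using \<open>\<not> Inf Q > 0\<close> by (intro exI[of _ U]) simp
    qed
    then show False using assms(1) negligible_outer_le by blast
  qed
  then show ?thesis using that le ex by blast
qed

section \<open>Null sets of points with exceptional slopes\<close>

definition real_abs_cont :: "real \<Rightarrow> real \<Rightarrow> (real \<Rightarrow> real) \<Rightarrow> bool" where
  "real_abs_cont a b g \<longleftrightarrow> (\<forall>\<epsilon>>0. \<exists>\<delta>>0. \<forall>d. d division_of \<Union>d \<and> \<Union>d \<subseteq> {a..b} \<and> (\<Sum>k\<in>d. Sup k - Inf k) < \<delta>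
        \<longrightarrow> (\<Sum>k\<in>d. \<bar>g (Sup k) - g (Inf k)\<bar>) < \<epsilon>)"

lemma additive_division_1:
  fixes f :: "real \<Rightarrow> 'a::real_normed_vector"
  assumes "a \<le> b" and "p division_of {a..b}"
  shows "(\<Sum>K\<in>p. f (Sup K) - f (Inf K)) = f b - f a"
proof -
  let ?f = "(\<lambda>K::real set. if K = {} then 0 else f(interval_upperbound K) - f(interval_lowerbound K))"
  interpret operative_real plus 0 ?f
    rewrites "comm_monoid_set.F (+) 0 = sum"
    by standard[1] (auto simp add: sum_def)
  have p_td: "p division_of cbox a b"
    using assms(2) box_real(2) by presburger
  have "cbox a b \<noteq> {}"
    using assms(1) by auto
  then have "f b - f a = (\<Sum>l\<in>p. if l = {} then 0 else f (interval_upperbound l) - f (interval_lowerbound l))"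
    using division[OF p_td[unfolded box_real]] assms by simp
  moreover have "k \<noteq> {}" if "k \<in> p" for k using assms(2) that by blast
  ultimately show ?thesis
    by (simp add: if_split cong: sum.cong)
qed

lemma division_length:
  assumes "p division_of (S :: real set)"
  shows "(\<Sum>k\<in>p. Sup k - Inf k) = measure lebesgue S" "S \<in> lmeasurable"
proof -
  have "(\<Sum>k\<in>p. Sup k - Inf k) = (\<Sum>k\<in>p. measure lebesgue k)"
  proof (rule sum.cong)
    fix k assume "k \<in> p"
    then obtain u v where "k = {u..v}" "k \<noteq> {}" using assms by (metis division_ofD(3,4) box_real(2))
    then show "Sup k - Inf k = measure lebesgue k" by simp
  qed simp
  then show "(\<Sum>k\<in>p. Sup k - Inf k) = measure lebesgue S" using content_division[OF assms] by simp
  show "S \<in> lmeasurable" using lmeasurable_division[OF assms] .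
qed

text \<open>A first Vitali family of intervals with slopes below \<open>p\<close> covers \<open>S\<close> almost economically;
  a second one, with slopes above \<open>q\<close>, is chosen inside the first.  What is left between the two
  is short, so absolute continuity makes the increments comparable, against \<open>p < q\<close>.\<close>

lemma negligible_two_slopes:
  fixes g :: "real \<Rightarrow> real"
  assumes ac: "real_abs_cont a b g" and pq: "p < q" and S: "S \<subseteq> {a<..<b}"
    and low: "\<And>x d. x \<in> S \<Longrightarrow> d > 0 \<Longrightarrow> \<exists>u v. u < v \<and> u \<le> x \<and> x \<le> v \<and> v - u < d \<and> g v - g u \<le> p * (v - u)"
    and high: "\<And>x d. x \<in> S \<Longrightarrow> d > 0 \<Longrightarrow> \<exists>u v. u < v \<and> u \<le> x \<and> x \<le> v \<and> v - u < d \<and> g v - g u \<ge> q * (v - u)"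
  shows "negligible S"
proof (rule ccontr)
  assume "\<not> negligible S"
  then obtain w where w: "w > 0" "\<And>T. T \<in> lmeasurable \<Longrightarrow> S \<subseteq> T \<Longrightarrow> w \<le> measure lebesgue T"
    "\<And>e. e > 0 \<Longrightarrow> \<exists>U. open U \<and> S \<subseteq> U \<and> U \<subseteq> {a<..<b} \<and> U \<in> lmeasurable \<and> measure lebesgue U < w + e"
    using non_negligible_outer_measure[of S "{a<..<b}"] S by (auto simp: bounded_set_imp_lmeasurable)
  then have "S \<noteq> {}" by (metis \<open>\<not> negligible S\<close> negligible_empty)
  then have ab: "a \<le> b" using S by force
  define \<epsilon> where "\<epsilon> = (q - p) * w / 4"
  have \<epsilon>: "\<epsilon> > 0" using pq w by (simp add: \<epsilon>_def)
  have "\<exists>\<delta>>0. \<forall>d. d division_of \<Union>d \<and> \<Union>d \<subseteq> {a..b} \<and> (\<Sum>k\<in>d. Sup k - Inf k) < \<delta> \<longrightarrow>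
      (\<Sum>k\<in>d. \<bar>g (Sup k) - g (Inf k)\<bar>) < \<epsilon>"
    using ac \<epsilon> unfolding real_abs_cont_def by simp
  then obtain \<delta> where \<delta>: "\<delta> > 0" "\<And>d. d division_of \<Union>d \<Longrightarrow> \<Union>d \<subseteq> {a..b} \<Longrightarrow> (\<Sum>k\<in>d. Sup k - Inf k) < \<delta> \<Longrightarrow>
      (\<Sum>k\<in>d. \<bar>g (Sup k) - g (Inf k)\<bar>) < \<epsilon>"
    by blast
  \<comment> \<open>The first entry makes \<open>l1 - l2 < 3 * \<eta>\<close> smaller than \<delta>,
    the second makes \<open>l2\<close> at least \<open>3 / 4 * w\<close>, and the third keeps
    \<open>p * (l1 - l2)\<close> at most \<open>(q - p) * w / 4\<close>.\<close>
  define \<eta> where "\<eta> = min (\<delta> / 4) (min (w / 8) ((q - p) * w / (12 * (\<bar>p\<bar> + 1))))"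
  have \<eta>: "\<eta> > 0" "\<eta> \<le> \<delta> / 4" "\<eta> \<le> w / 8" "\<eta> \<le> (q - p) * w / (12 * (\<bar>p\<bar> + 1))"
    using \<delta>(1) w(1) pq unfolding \<eta>_def by (auto simp del: divide_const_simps intro: add_nonneg_pos)
  obtain U where U: "open U" "S \<subseteq> U" "U \<subseteq> {a<..<b}" "U \<in> lmeasurable" "measure lebesgue U < w + \<eta>"
    using w(3)[OF \<eta>(1)] by blast
  obtain D1 T1 where D1: "D1 division_of \<Union>D1" "\<Union>D1 \<subseteq> U"
    "\<And>k. k \<in> D1 \<Longrightarrow> \<exists>u v. u < v \<and> k = {u..v} \<and> g v - g u \<le> p * (v - u)"
    and T1: "T1 \<in> lmeasurable" "measure lebesgue T1 < \<eta>" "S \<subseteq> \<Union>D1 \<union> T1"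
    by (rule finite_Vitali_intervals[OF U(1,4,2) \<eta>(1) low]) (assumption | rule that)+
  \<comment> \<open>A Vitali family is chosen inside an open set, so the second family lives in the
    interiors of the first; the lost end points form a null set.\<close>
  define V where "V = (\<Union>k\<in>D1. interior k)"
  have fin1: "finite D1" using D1(1) by blast
  have V: "open V" "V \<subseteq> \<Union>D1" "V \<in> lmeasurable"
  proof -
    show V: "open V" "V \<subseteq> \<Union>D1" unfolding V_def using interior_subset by (auto intro!: open_UN)
    have "V \<in> sets lebesgue" using V(1) by (metis borel_open sets_completionI_sets sets_lborel)
    then show "V \<in> lmeasurable" by (rule fmeasurableI2[OF lmeasurable_division[OF D1(1)] V(2)])
  qed
  have neg1: "negligible (\<Union>D1 - V)"
  proof (rule negligible_subset)
    show "negligible (\<Union>k\<in>D1. k - interior k)"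
    proof (intro negligible_Union finite_imageI fin1)
      fix t assume "t \<in> (\<lambda>k. k - interior k) ` D1"
      then obtain u v where "t = {u..v} - {u<..<v}" "u < v" using D1(3) by (force simp: interior_atLeastAtMost_real)
      then have "t = {u, v}" by auto
      then show "negligible t" by (auto intro: negligible_finite)
    qed
    show "\<Union>D1 - V \<subseteq> (\<Union>k\<in>D1. k - interior k)" by (auto simp: V_def)
  qed
  obtain D2 T2 where D2: "D2 division_of \<Union>D2" "\<Union>D2 \<subseteq> V"
    "\<And>k. k \<in> D2 \<Longrightarrow> \<exists>u v. u < v \<and> k = {u..v} \<and> g v - g u \<ge> q * (v - u)"
    and T2: "T2 \<in> lmeasurable" "measure lebesgue T2 < \<eta>" "S \<inter> V \<subseteq> \<Union>D2 \<union> T2"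
    by (rule finite_Vitali_intervals[OF V(1,3) Int_lower2 \<eta>(1) high[OF IntD1]]) (assumption | rule that)+
  define l1 where "l1 = (\<Sum>k\<in>D1. Sup k - Inf k)"
  define l2 where "l2 = (\<Sum>k\<in>D2. Sup k - Inf k)"
  have l1m: "l1 = measure lebesgue (\<Union>D1)" and l2m: "l2 = measure lebesgue (\<Union>D2)"
    unfolding l1_def l2_def using division_length D1(1) D2(1) by auto
  have l1: "l1 < w + \<eta>"
  proof -
    have "l1 \<le> measure lebesgue U" unfolding l1m using D1 U division_length(2)[OF D1(1)]
      by (intro measure_mono_fmeasurable) (auto dest: fmeasurableD)
    then show ?thesis using U by simp
  qed
  have l21: "l2 \<le> l1" unfolding l1m l2m using D2 V division_length(2)[OF D1(1)] division_length(2)[OF D2(1)]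
      by (intro measure_mono_fmeasurable) (auto dest: fmeasurableD)
  have l2: "w - 2 * \<eta> < l2"
  proof -
    have m: "\<Union>D2 \<in> lmeasurable" "\<Union>D1 - V \<in> lmeasurable"
      using division_length(2)[OF D2(1)] neg1 negligible_imp_measurable by auto
    have "S \<subseteq> \<Union>D2 \<union> T2 \<union> (\<Union>D1 - V) \<union> T1" using T1 T2 by auto
    then have "w \<le> measure lebesgue (\<Union>D2 \<union> T2 \<union> (\<Union>D1 - V) \<union> T1)"
      using m T1 T2 by (intro w(2)) (auto intro!: fmeasurable.Un)
    also have "\<dots> \<le> measure lebesgue (\<Union>D2) + measure lebesgue T2 + measure lebesgue (\<Union>D1 - V) + measure lebesgue T1"
      using m T1 T2 by (intro order_trans[OF measure_Un_le] add_right_mono) (auto intro!: sets.Un dest: fmeasurableD)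
    also have "\<dots> < l2 + 2 * \<eta>" using T1 T2 negligible_imp_measure0[OF neg1] by (simp add: l2m)
    finally show ?thesis by simp
  qed
  have "{a<..<b} \<subseteq> cbox a b" by auto
  with D1(2) U(3) have D1ab: "\<Union>D1 \<subseteq> cbox a b" by (meson order_trans)
  obtain q1 where q1: "D1 \<subseteq> q1" "q1 division_of cbox a b"
    by (rule partial_division_extend_interval[OF D1(1) D1ab])
  \<comment> \<open>The intervals that complete \<open>D1\<close> to a division of the whole
    interval. The same \<open>R\<close> is then completed together with \<open>D2\<close>, so that
    \<open>K\<close> fills what \<open>D1\<close> covers and \<open>D2\<close> leaves out.\<close>
  define R where "R = q1 - D1"
  have Rint: "interior k \<inter> V = {}" if "k \<in> R" for k
    using that q1 division_ofD(5)[OF q1(2)] unfolding R_def V_def by blast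
  have D2int: "interior k \<noteq> {}" "k \<subseteq> V" if "k \<in> D2" for k
    using D2(2) D2(3)[OF that] that by (auto simp: interior_atLeastAtMost_real)
  have RD2: "R \<inter> D2 = {}" using Rint D2int interior_subset by fastforce
  have divRD2: "(R \<union> D2) division_of \<Union>(R \<union> D2)"
  proof (rule division_ofI)
    show "finite (R \<union> D2)" using q1(2) D2(1) by (auto simp: R_def)
    fix k assume k: "k \<in> R \<union> D2"
    then show "k \<noteq> {}" "\<exists>a b. k = cbox a b"
      using division_ofD(3,4)[OF q1(2)] division_ofD(3,4)[OF D2(1)] by (auto simp: R_def)
    fix k' assume k': "k' \<in> R \<union> D2" "k \<noteq> k'"
    have mix: "interior i \<inter> interior j = {}" if "i \<in> R" "j \<in> D2" for i j
      using Rint[OF that(1)] D2int(2)[OF that(2)] interior_subset[of j] by blast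
    show "interior k \<inter> interior k' = {}"
      using k k' mix[of k k'] mix[of k' k] division_ofD(5)[OF q1(2), of k k'] division_ofD(5)[OF D2(1), of k k']
      by (auto simp: R_def)
  qed auto
  have "\<Union>(R \<union> D2) \<subseteq> cbox a b"
  proof -
    have "k \<subseteq> cbox a b" if "k \<in> R" for k using that division_ofD(2)[OF q1(2)] by (auto simp: R_def)
    moreover have "\<Union>D2 \<subseteq> cbox a b" using D2(2) V(2) D1ab by (meson order_trans)
    ultimately show ?thesis by blast
  qed
  then obtain q2 where q2: "R \<union> D2 \<subseteq> q2" "q2 division_of cbox a b"
    by (rule partial_division_extend_interval[OF divRD2])
  define K where "K = q2 - (R \<union> D2)"
  have fins: "finite R" "finite D2" "finite K" "finite q1" "finite q2"
    using q1 q2 D2(1) by (auto simp: R_def K_def)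
  \<comment> \<open>Both completed divisions telescope to \<open>h b - h a\<close>, and
    \<open>R\<close> cancels. With the identity for \<open>h\<close> this gives the length of
    \<open>K\<close>; with \<open>g\<close> it compares the increments over the two
    families.\<close>
  have split: "(\<Sum>k\<in>D1. h (Sup k) - h (Inf k)) = (\<Sum>k\<in>D2. h (Sup k) - h (Inf k)) + (\<Sum>k\<in>K. h (Sup k) - h (Inf k))"
    for h :: "real \<Rightarrow> real"
  proof -
    let ?h = "\<lambda>k. h (Sup k) - h (Inf k)"
    have "sum ?h q1 = h b - h a" "sum ?h q2 = h b - h a"
      using additive_division_1[OF ab] q1(2) q2(2) by auto
    moreover have "sum ?h q1 = sum ?h R + sum ?h D1"
      unfolding R_def using q1 fins by (intro sum.subset_diff) auto
    moreover have "sum ?h q2 = sum ?h K + (sum ?h R + sum ?h D2)"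
      unfolding K_def using q2 fins RD2 by (subst sum.subset_diff[of "R \<union> D2"]) (auto simp: sum.union_disjoint)
    ultimately show ?thesis by linarith
  qed
  have "(\<Sum>k\<in>K. \<bar>g (Sup k) - g (Inf k)\<bar>) < \<epsilon>"
  proof (rule \<delta>(2))
    show "K division_of \<Union>K" using division_of_subset[OF division_of_union_self[OF q2(2)], of K] by (simp add: K_def)
    show "\<Union>K \<subseteq> {a..b}" using division_ofD(6)[OF q2(2)] by (auto simp: K_def)
    have "(\<Sum>k\<in>K. Sup k - Inf k) = l1 - l2" using split[of "\<lambda>x. x"] by (simp add: l1_def l2_def)
    also have "\<dots> < \<delta>" using l1 l2 \<eta>(1,2) by linarith
    finally show "(\<Sum>k\<in>K. Sup k - Inf k) < \<delta>" .
  qed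
  moreover have "(\<Sum>k\<in>K. \<bar>g (Sup k) - g (Inf k)\<bar>) \<ge> \<bar>\<Sum>k\<in>K. g (Sup k) - g (Inf k)\<bar>" by (rule sum_abs)
  moreover have "(\<Sum>k\<in>D1. g (Sup k) - g (Inf k)) \<le> p * l1"
    unfolding l1_def sum_distrib_left using D1(3) by (intro sum_mono) force
  moreover have "(\<Sum>k\<in>D2. g (Sup k) - g (Inf k)) \<ge> q * l2"
    unfolding l2_def sum_distrib_left using D2(3) by (intro sum_mono) force
  \<comment> \<open>With \<open>X = (q - p) * w\<close>, this says that
    \<open>q * l2 - p * l1\<close> is below \<open>X / 4\<close>, while the choice of \<eta> makes
    it at least \<open>X / 2\<close>.\<close>
  ultimately have "q * l2 - \<epsilon> < p * l1" using split[of g] by linarith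
  moreover have "q * l2 - p * l1 = (q - p) * l2 - p * (l1 - l2)" by (simp add: algebra_simps)
  moreover have "p * (l1 - l2) \<le> (q - p) * w / 4"
  proof -
    have "p * (l1 - l2) \<le> \<bar>p\<bar> * (l1 - l2)" using l21 by (intro mult_right_mono) auto
    also have "\<dots> \<le> (\<bar>p\<bar> + 1) * (3 * \<eta>)" using l1 l2 l21 by (intro mult_mono) auto
    also have "\<dots> \<le> (\<bar>p\<bar> + 1) * (3 * ((q - p) * w / (12 * (\<bar>p\<bar> + 1))))" using \<eta> by (intro mult_left_mono) auto
    also have "\<dots> = (q - p) * w / 4"
    proof -
      have "\<bar>p\<bar> + 1 \<noteq> 0" by linarith
      then show ?thesis by (simp add: field_simps)
    qed
    finally show ?thesis .
  qed
  moreover have "(q - p) * l2 \<ge> (q - p) * (3 / 4 * w)" using l2 \<eta> pq by (intro mult_left_mono) auto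
  moreover have "(q - p) * w > 0" using pq w by simp
  moreover have "(q - p) * (3 / 4 * w) = 3 / 4 * ((q - p) * w)" by simp
  ultimately show False unfolding \<epsilon>_def by linarith
qed

text \<open>If a part of \<open>S\<close> inside an interval shorter than \<delta> had outer measure
  \<open>w > 0\<close>, a finite disjoint family with slopes at least \<open>2 / w\<close> would
  have total length at least \<open>w / 2\<close> and so total increment at least \<open>1\<close>,
  against the choice of \<delta>. The localisation keeps the length of the family below
  \<delta>.\<close>

lemma negligible_unbounded_slopes:
  fixes g :: "real \<Rightarrow> real"
  assumes ac: "real_abs_cont a b g" and S: "S \<subseteq> {a<..<b}"
    and steep: "\<And>x B d. x \<in> S \<Longrightarrow> d > 0 \<Longrightarrow> \<exists>u v. u < v \<and> u \<le> x \<and> x \<le> v \<and> v - u < d \<and> \<bar>g v - g u\<bar> \<ge> B * (v - u)"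
  shows "negligible S"
proof -
  have "\<exists>\<delta>>0. \<forall>d. d division_of \<Union>d \<and> \<Union>d \<subseteq> {a..b} \<and> (\<Sum>k\<in>d. Sup k - Inf k) < \<delta> \<longrightarrow>
      (\<Sum>k\<in>d. \<bar>g (Sup k) - g (Inf k)\<bar>) < 1"
    using ac unfolding real_abs_cont_def by simp
  then obtain \<delta> where \<delta>: "\<delta> > 0" "\<And>d. d division_of \<Union>d \<Longrightarrow> \<Union>d \<subseteq> {a..b} \<Longrightarrow> (\<Sum>k\<in>d. Sup k - Inf k) < \<delta> \<Longrightarrow>
      (\<Sum>k\<in>d. \<bar>g (Sup k) - g (Inf k)\<bar>) < 1"
    by blast
  have loc: "negligible (S \<inter> {z - \<delta>/3<..<z + \<delta>/3})" for z
  proof (rule ccontr)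
    let ?S = "S \<inter> {z - \<delta>/3<..<z + \<delta>/3}" and ?U = "{max a (z - \<delta>/3)<..<min b (z + \<delta>/3)}"
    assume "\<not> negligible ?S"
    moreover have SU: "?S \<subseteq> ?U" using S by auto
    moreover have Um: "open ?U" "?U \<in> lmeasurable" by (auto simp: bounded_set_imp_lmeasurable)
    ultimately obtain w where w: "w > 0" "\<And>T. T \<in> lmeasurable \<Longrightarrow> ?S \<subseteq> T \<Longrightarrow> w \<le> measure lebesgue T"
      by (rule non_negligible_outer_measure) (rule that; blast)
    have cov: "\<exists>u v. u < v \<and> u \<le> x \<and> x \<le> v \<and> v - u < d \<and> \<bar>g v - g u\<bar> \<ge> 2 / w * (v - u)"
      if "x \<in> ?S" "d > 0" for x d using steep[of x d "2 / w"] that by blast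
    have "w / 2 > 0" using w(1) by simp
    obtain D T where D: "D division_of \<Union>D" "\<Union>D \<subseteq> ?U"
      "\<And>k. k \<in> D \<Longrightarrow> \<exists>u v. u < v \<and> k = {u..v} \<and> \<bar>g v - g u\<bar> \<ge> 2 / w * (v - u)"
      and T: "T \<in> lmeasurable" "measure lebesgue T < w / 2" "?S \<subseteq> \<Union>D \<union> T"
      by (rule finite_Vitali_intervals[OF Um SU \<open>w / 2 > 0\<close> cov]) (assumption | rule that)+
    have len: "(\<Sum>k\<in>D. Sup k - Inf k) = measure lebesgue (\<Union>D)" using division_length(1)[OF D(1)] .
    have "w \<le> measure lebesgue (\<Union>D \<union> T)" using T division_length(2)[OF D(1)] by (intro w(2)) (auto intro!: fmeasurable.Un)
    also have "\<dots> \<le> measure lebesgue (\<Union>D) + measure lebesgue T"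
      using T division_length(2)[OF D(1)] by (intro measure_Un_le) (auto dest: fmeasurableD)
    finally have "w / 2 \<le> (\<Sum>k\<in>D. Sup k - Inf k)" using T len by simp
    then have "2 / w * (w / 2) \<le> 2 / w * (\<Sum>k\<in>D. Sup k - Inf k)" using w(1) by (intro mult_left_mono) auto
    also have "\<dots> \<le> (\<Sum>k\<in>D. \<bar>g (Sup k) - g (Inf k)\<bar>)"
      unfolding sum_distrib_left using D(3) by (intro sum_mono) force
    also have "\<dots> < 1"
    proof (rule \<delta>(2)[OF D(1)])
      have "?U \<subseteq> {a..b}" by auto
      then show "\<Union>D \<subseteq> {a..b}" using D(2) by (rule order_trans[rotated])
      have "measure lebesgue (\<Union>D) \<le> measure lebesgue {z - \<delta>/3<..<z + \<delta>/3}"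
        using D(2) division_length(2)[OF D(1)] by (intro measure_mono_fmeasurable) (auto dest: fmeasurableD simp: bounded_set_imp_lmeasurable)
      also have "\<dots> < \<delta>" using \<delta>(1) by simp
      finally show "(\<Sum>k\<in>D. Sup k - Inf k) < \<delta>" using len by simp
    qed
    finally show False using w(1) by simp
  qed
  show ?thesis
  proof (rule iffD2[OF locally_negligible_alt], rule ballI)
    fix x assume x: "x \<in> S"
    have "openin (top_of_set S) (S \<inter> {x - \<delta>/3<..<x + \<delta>/3})"
      by (intro openin_open_Int) auto
    then show "\<exists>U. openin (top_of_set S) U \<and> x \<in> U \<and> negligible U"
      using loc[of x] \<delta>(1) x by (intro exI[of _ "S \<inter> {x - \<delta>/3<..<x + \<delta>/3}"]) simp
  qed
qed

lemma slope_interval: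
  fixes g :: "real \<Rightarrow> real"
  assumes "y \<noteq> x"
  shows "\<exists>u v. u < v \<and> u \<le> x \<and> x \<le> v \<and> v - u = \<bar>y - x\<bar> \<and> (g v - g u) = (g y - g x) / (y - x) * (v - u)"
proof (cases "y > x")
  case True
  then show ?thesis by (intro exI[of _ x] exI[of _ y]) simp
next
  case False
  then have "g x - g y = (g y - g x) / (y - x) * (x - y)" using assms by (simp add: field_simps)
  then show ?thesis using False assms by (intro exI[of _ y] exI[of _ x]) simp
qed

text \<open>Where \<open>g\<close> is not differentiable, either the difference quotients are
  unbounded near the point, or their lower and upper limits are separated by two rationals. This
  leaves countably many null sets.\<close>

lemma real_abs_cont_differentiable_ae:
  fixes g :: "real \<Rightarrow> real"
  assumes ac: "real_abs_cont a b g"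
  shows "negligible {x \<in> {a<..<b}. \<not> g differentiable (at x)}"
proof -
  define Q where "Q x y = (g y - g x) / (y - x)" for x y
  define E where "E p q = {x \<in> {a<..<b}. (\<exists>\<^sub>F y in at x. Q x y \<le> p) \<and> (\<exists>\<^sub>F y in at x. Q x y \<ge> q)}" for p q
  define N where "N = {x \<in> {a<..<b}. \<forall>B. \<exists>\<^sub>F y in at x. \<bar>Q x y\<bar> \<ge> B}"
  have near: "\<exists>y. y \<noteq> x \<and> \<bar>y - x\<bar> < d \<and> P y" if "\<exists>\<^sub>F y in at x. P y" "d > 0" for x d :: real and P
  proof -
    have "\<forall>\<^sub>F y in at x. y \<noteq> x \<and> \<bar>y - x\<bar> < d"
      using that(2) by (auto simp: eventually_at dist_real_def)
    from frequently_ex[OF frequently_eventually_conj[OF that(1) this]] show ?thesis by blast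
  qed
  have "negligible (E p q)" if "p < q" for p q
  proof (rule negligible_two_slopes[OF ac that])
    show "E p q \<subseteq> {a<..<b}" by (auto simp: E_def)
    fix x d :: real assume x: "x \<in> E p q" and d: "d > 0"
    obtain y where y: "y \<noteq> x" "\<bar>y - x\<bar> < d" "Q x y \<le> p" using near[where x=x and d=d and P="\<lambda>y. Q x y \<le> p"] x d by (auto simp: E_def)
    show "\<exists>u v. u < v \<and> u \<le> x \<and> x \<le> v \<and> v - u < d \<and> g v - g u \<le> p * (v - u)"
      using slope_interval[OF y(1), where g=g] y(2,3) unfolding Q_def[symmetric]
      by (smt (verit) mult_right_mono)
    obtain y where y: "y \<noteq> x" "\<bar>y - x\<bar> < d" "Q x y \<ge> q" using near[where x=x and d=d and P="\<lambda>y. Q x y \<ge> q"] x d by (auto simp: E_def)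
    show "\<exists>u v. u < v \<and> u \<le> x \<and> x \<le> v \<and> v - u < d \<and> g v - g u \<ge> q * (v - u)"
      using slope_interval[OF y(1), where g=g] y(2,3) unfolding Q_def[symmetric]
      by (smt (verit) mult_right_mono)
  qed
  moreover have "negligible N"
  proof (rule negligible_unbounded_slopes[OF ac])
    show "N \<subseteq> {a<..<b}" by (auto simp: N_def)
    fix x B d :: real assume x: "x \<in> N" and d: "d > 0"
    obtain y where y: "y \<noteq> x" "\<bar>y - x\<bar> < d" "\<bar>Q x y\<bar> \<ge> B" using near[where x=x and d=d and P="\<lambda>y. \<bar>Q x y\<bar> \<ge> B"] x d by (auto simp: N_def)
    obtain u v where "u < v" "u \<le> x" "x \<le> v" "v - u < d" "g v - g u = Q x y * (v - u)"
      using slope_interval[OF y(1), where g=g] y(2) unfolding Q_def[symmetric] by auto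
    then show "\<exists>u v. u < v \<and> u \<le> x \<and> x \<le> v \<and> v - u < d \<and> \<bar>g v - g u\<bar> \<ge> B * (v - u)"
      using y(3) by (intro exI[of _ u] exI[of _ v]) (simp add: abs_mult mult_right_mono)
  qed
  ultimately have "negligible (N \<union> (\<Union>(p, q)\<in>{(p, q). p \<in> \<rat> \<and> q \<in> \<rat> \<and> p < q}. E p q))"
  proof (intro negligible_Un negligible_countable_Union)
    have "countable (\<rat> \<times> \<rat> :: (real \<times> real) set)" by (simp add: countable_rat)
    then have "countable {(p::real, q). p \<in> \<rat> \<and> q \<in> \<rat> \<and> p < q}" by (rule countable_subset[rotated]) auto
    then show "countable ((\<lambda>(p, q). E p q) ` {(p, q). p \<in> \<rat> \<and> q \<in> \<rat> \<and> p < q})" by (rule countable_image)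
  qed auto
  moreover have "{x \<in> {a<..<b}. \<not> g differentiable (at x)} \<subseteq> N \<union> (\<Union>(p, q)\<in>{(p, q). p \<in> \<rat> \<and> q \<in> \<rat> \<and> p < q}. E p q)"
  proof
    fix x assume x: "x \<in> {x \<in> {a<..<b}. \<not> g differentiable (at x)}"
    show "x \<in> N \<union> (\<Union>(p, q)\<in>{(p, q). p \<in> \<rat> \<and> q \<in> \<rat> \<and> p < q}. E p q)"
    proof (rule ccontr)
      assume not: "x \<notin> N \<union> (\<Union>(p, q)\<in>{(p, q). p \<in> \<rat> \<and> q \<in> \<rat> \<and> p < q}. E p q)"
      then have "x \<notin> N" by blast
      then obtain B where B: "\<forall>\<^sub>F y in at x. \<bar>Q x y\<bar> < B" using x by (auto simp: N_def not_frequently not_le)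
      let ?L = "Liminf (at x) (\<lambda>y. ereal (Q x y))" and ?U = "Limsup (at x) (\<lambda>y. ereal (Q x y))"
      have le: "?L \<le> ?U" by (rule Liminf_le_Limsup) simp
      have LB: "ereal (- B) \<le> ?L" by (rule Liminf_bounded) (use B in \<open>auto elim!: eventually_mono\<close>)
      have UB: "?U \<le> ereal B" by (rule Limsup_bounded) (use B in \<open>auto elim!: eventually_mono\<close>)
      have "?L = ?U"
      proof (rule ccontr)
        assume "?L \<noteq> ?U"
        then have "?L < ?U" using le by simp
        then obtain r s where rs: "?L < ereal r" "ereal r < ereal s" "ereal s < ?U"
          by (metis ereal_dense2)
        then obtain p q where pq: "p \<in> \<rat>" "q \<in> \<rat>" "p < q" "r < p" "q < s"
          by (metis Rats_dense_in_real ereal_less_eq(3) less_ereal.simps(1))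
        have "?L < ereal p" "ereal q < ?U" using rs(1,3) pq(4,5) by (meson less_ereal.simps(1) less_trans)+
        have "\<exists>\<^sub>F y in at x. Q x y \<le> p"
        proof (rule ccontr)
          assume "\<not> ?thesis"
          then have "\<forall>\<^sub>F y in at x. ereal p \<le> ereal (Q x y)" by (auto simp: not_frequently elim!: eventually_mono)
          from Liminf_bounded[OF this] \<open>?L < ereal p\<close> show False by simp
        qed
        moreover have "\<exists>\<^sub>F y in at x. Q x y \<ge> q"
        proof (rule ccontr)
          assume "\<not> ?thesis"
          then have "\<forall>\<^sub>F y in at x. ereal (Q x y) \<le> ereal q" by (auto simp: not_frequently elim!: eventually_mono)
          from Limsup_bounded[OF this] \<open>ereal q < ?U\<close> show False by simp
        qed
        ultimately have "x \<in> E p q" using x by (auto simp: E_def)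
        then show False using not pq by blast
      qed
      moreover obtain D where "?L = ereal D"
        using LB UB le by (cases ?L) auto
      ultimately have "((\<lambda>y. ereal (Q x y)) \<longlongrightarrow> ereal D) (at x)"
        by (intro Liminf_eq_Limsup) auto
      then have "(Q x \<longlongrightarrow> D) (at x)" by simp
      then have "(g has_field_derivative D) (at x)"
        by (simp add: has_field_derivative_iff Q_def [abs_def])
      then show False using x real_differentiable_def by blast
    qed
  qed
  ultimately show ?thesis by (rule negligible_subset)
qed

section \<open>From bounds on the derivative to bounds on increments\<close>

lemma absolutely_continuous_onE:
  assumes "absolutely_continuous_on S f" "e > 0"
  obtains \<delta> where "\<delta> > 0" "\<And>d. d division_of \<Union>d \<Longrightarrow> \<Union>d \<subseteq> S \<Longrightarrow> (\<Sum>k\<in>d. Sup k - Inf k) < \<delta> \<Longrightarrow>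
    (\<Sum>k\<in>d. norm (f (Sup k) - f (Inf k))) < e"
proof -
  have "\<exists>\<delta>>0. \<forall>d. d division_of \<Union>d \<and> \<Union>d \<subseteq> S \<and> (\<Sum>k\<in>d. Sup k - Inf k) < \<delta>
        \<longrightarrow> (\<Sum>k\<in>d. norm (f (Sup k) - f (Inf k))) < e"
    using assms unfolding absolutely_continuous_on_def by simp
  then obtain \<delta> where \<delta>: "\<delta> > 0" "\<forall>d. d division_of \<Union>d \<and> \<Union>d \<subseteq> S \<and> (\<Sum>k\<in>d. Sup k - Inf k) < \<delta>
        \<longrightarrow> (\<Sum>k\<in>d. norm (f (Sup k) - f (Inf k))) < e"
    by (elim exE conjE)
  show ?thesis by (rule that[OF \<delta>(1)]) (use \<delta>(2) in simp)
qed

lemma real_abs_cont_part: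
  assumes "absolutely_continuous_on {a..b} f" "\<And>z w. \<bar>h z - h w\<bar> \<le> norm (z - w :: complex)"
  shows "real_abs_cont a b (\<lambda>x. h (f x))"
  unfolding real_abs_cont_def
proof (intro allI impI)
  fix e :: real assume "e > 0"
  then obtain \<delta> where \<delta>: "\<delta> > 0" and
    *: "\<And>d. d division_of \<Union>d \<Longrightarrow> \<Union>d \<subseteq> {a..b} \<Longrightarrow> (\<Sum>k\<in>d. Sup k - Inf k) < \<delta> \<Longrightarrow> (\<Sum>k\<in>d. norm (f (Sup k) - f (Inf k))) < e"
    by (rule absolutely_continuous_onE[OF assms(1)]) (assumption | rule that)+
  have "(\<Sum>k\<in>d. \<bar>h (f (Sup k)) - h (f (Inf k))\<bar>) < e"
    if "d division_of \<Union>d" "\<Union>d \<subseteq> {a..b}" "(\<Sum>k\<in>d. Sup k - Inf k) < \<delta>" for d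
    using *[OF that] by (rule le_less_trans[OF sum_mono[OF assms(2)]])
  then show "\<exists>\<delta>>0. \<forall>d. d division_of \<Union>d \<and> \<Union>d \<subseteq> {a..b} \<and> (\<Sum>k\<in>d. Sup k - Inf k) < \<delta> \<longrightarrow>
      (\<Sum>k\<in>d. \<bar>h (f (Sup k)) - h (f (Inf k))\<bar>) < e"
    using \<delta> by (intro exI[of _ \<delta>]) simp
qed

lemma absolutely_continuous_differentiable_ae:
  assumes ac: "absolutely_continuous_on {a..b} f"
  shows "negligible {x \<in> {a<..<b}. \<not> f differentiable (at x)}"
proof (rule negligible_subset)
  show "negligible ({x \<in> {a<..<b}. \<not> (\<lambda>x. Re (f x)) differentiable (at x)} \<union> {x \<in> {a<..<b}. \<not> (\<lambda>x. Im (f x)) differentiable (at x)})"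
  proof (intro negligible_Un real_abs_cont_differentiable_ae real_abs_cont_part[OF ac])
    show "\<bar>Re z - Re w\<bar> \<le> norm (z - w)" "\<bar>Im z - Im w\<bar> \<le> norm (z - w)" for z w
      using abs_Re_le_cmod[of "z - w"] abs_Im_le_cmod[of "z - w"] by simp_all
  qed
  have "f differentiable (at x)" if d: "(\<lambda>x. Re (f x)) differentiable (at x)" "(\<lambda>x. Im (f x)) differentiable (at x)" for x
  proof -
    obtain D1 D2 where "((\<lambda>x. Re (f x)) has_vector_derivative D1) (at x)" "((\<lambda>x. Im (f x)) has_vector_derivative D2) (at x)"
      using d vector_derivative_works by blast
    then have "((\<lambda>x. complex_of_real (Re (f x)) + \<i> * complex_of_real (Im (f x))) has_vector_derivative (of_real D1 + \<i> * of_real D2)) (at x)"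
      by (intro has_vector_derivative_add has_vector_derivative_mult_right has_vector_derivative_of_real)
        (auto simp: has_real_derivative_iff_has_vector_derivative)
    then show ?thesis by (simp flip: complex_eq add: differentiableI_vector)
  qed
  then show "{x \<in> {a<..<b}. \<not> f differentiable (at x)} \<subseteq> {x \<in> {a<..<b}. \<not> (\<lambda>x. Re (f x)) differentiable (at x)} \<union> {x \<in> {a<..<b}. \<not> (\<lambda>x. Im (f x)) differentiable (at x)}"
    by blast
qed

text \<open>A Cousin partition: intervals tagged outside the exceptional null set have slope at most
  about \<open>D\<close>, and the remaining ones lie in a short open set, where absolute continuity applies.\<close>

lemma absolutely_continuous_increment_bound:
  assumes ac: "absolutely_continuous_on {a..b} f" and ab: "a \<le> b" and D: "D \<ge> 0"
    and ae: "AE x in lebesgue. x \<in> {a<..<b} \<longrightarrow> norm (deriv_at f x) \<le> D"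
  shows "norm (f b - f a) \<le> D * (b - a)"
proof -
  \<comment> \<open>The end points join the exceptional set because differentiability and the bound
    on the derivative are available only inside the open interval.\<close>
  define N where "N = {x \<in> {a<..<b}. \<not> f differentiable (at x)} \<union> {x \<in> {a<..<b}. \<not> norm (deriv_at f x) \<le> D} \<union> {a, b}"
  have "negligible {x \<in> {a<..<b}. \<not> norm (deriv_at f x) \<le> D}"
  proof -
    obtain M where M: "{x \<in> space lebesgue. \<not> (x \<in> {a<..<b} \<longrightarrow> norm (deriv_at f x) \<le> D)} \<subseteq> M" "M \<in> null_sets lebesgue"
      using iffD1[OF eventually_ae_filter ae] by (elim bexE)
    have "{x \<in> {a<..<b}. \<not> norm (deriv_at f x) \<le> D} \<subseteq> M"
      by (rule order_trans[OF _ M(1)]) auto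
    then show ?thesis
      by (rule negligible_subset[OF iffD2[OF negligible_iff_null_sets M(2)]])
  qed
  then have N: "negligible N"
    unfolding N_def using absolutely_continuous_differentiable_ae[OF ac] by (simp add: negligible_finite)
  have main: "norm (f b - f a) \<le> D * (b - a) + e * (b - a + 1)" if e: "e > 0" for e
  proof -
    obtain \<delta> where \<delta>: "\<delta> > 0" and
      small: "\<And>d. d division_of \<Union>d \<Longrightarrow> \<Union>d \<subseteq> {a..b} \<Longrightarrow> (\<Sum>k\<in>d. Sup k - Inf k) < \<delta> \<Longrightarrow> (\<Sum>k\<in>d. norm (f (Sup k) - f (Inf k))) < e"
      by (rule absolutely_continuous_onE[OF ac e]) (assumption | rule that)+
    obtain O' where O': "open O'" "N \<subseteq> O'" "(O' - N) \<in> lmeasurable" "emeasure lebesgue (O' - N) < ennreal \<delta>"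
      using sets_lebesgue_outer_open[of N \<delta>] negligible_imp_sets[OF N] \<delta> by blast
    have Om: "O' \<in> lmeasurable" "measure lebesgue O' < \<delta>"
    proof -
      have "(O' - N) \<union> N \<in> lmeasurable" using O'(3) negligible_imp_measurable[OF N] by (rule fmeasurable.Un)
      then show Om: "O' \<in> lmeasurable" using O'(2) by (simp add: Un_absorb2)
      have "measure lebesgue O' = measure lebesgue (O' - N)"
        using N Om by (simp add: measure_Diff_null_set negligible_iff_null_sets fmeasurableD)
      then show "measure lebesgue O' < \<delta>" using O'(3,4) \<delta> by (simp add: emeasure_eq_measure2 ennreal_less_iff)
    qed
    \<comment> \<open>Straddle estimate: differentiability at a tag controls the increment over
      every small interval that contains the tag, not only over those starting there.\<close>
    have ex: "\<exists>r>0. \<forall>u v. u \<le> x \<longrightarrow> x \<le> v \<longrightarrow> {u..v} \<subseteq> ball x r \<longrightarrow> norm (f v - f u) \<le> (D + e) * (v - u)"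
      if x: "x \<in> {a..b} - N" for x
    proof -
      have "f differentiable (at x)" and Dx: "norm (deriv_at f x) \<le> D" using x by (auto simp: N_def)
      then have "(f has_vector_derivative deriv_at f x) (at x)" by (simp add: vector_derivative_works)
      then have "(f has_derivative (\<lambda>h. h *\<^sub>R deriv_at f x)) (at x)" by (simp add: has_vector_derivative_def)
      then obtain r where r: "r > 0" "\<And>y. norm (y - x) < r \<Longrightarrow> norm (f y - f x - (y - x) *\<^sub>R deriv_at f x) \<le> e * norm (y - x)"
        unfolding has_derivative_at_alt using e by blast
      have r': "norm (f y - f x - (y - x) *\<^sub>R deriv_at f x) \<le> e * \<bar>y - x\<bar>" if "y \<in> ball x r" for y
        using r(2)[of y] that by (simp add: dist_norm norm_minus_commute)
      have "norm (f v - f u) \<le> (D + e) * (v - u)" if "u \<le> x" "x \<le> v" "{u..v} \<subseteq> ball x r" for u v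
      proof -
        let ?d = "deriv_at f x"
        have "u \<in> {u..v}" "v \<in> {u..v}" using that(1,2) by auto
        then have uv: "u \<in> ball x r" "v \<in> ball x r" using that(3) by blast+
        have "f v - f u = (f v - f x - (v - x) *\<^sub>R ?d) - (f u - f x - (u - x) *\<^sub>R ?d) + (v - u) *\<^sub>R ?d"
          by (simp add: algebra_simps)
        also have "norm \<dots> \<le> norm (f v - f x - (v - x) *\<^sub>R ?d) + norm (f u - f x - (u - x) *\<^sub>R ?d) + norm ((v - u) *\<^sub>R ?d)"
          by (intro order_trans[OF norm_triangle_ineq] add_right_mono norm_triangle_ineq4)
        also have "\<dots> \<le> e * (v - x) + e * (x - u) + (v - u) * D"
          using r'[OF uv(1)] r'[OF uv(2)] that Dx by (intro add_mono) (auto simp: mult_left_mono)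
        also have "\<dots> = (D + e) * (v - u)" by (simp add: algebra_simps)
        finally show ?thesis .
      qed
      then show ?thesis using r(1) by blast
    qed
    then obtain r where r: "\<And>x. x \<in> {a..b} - N \<Longrightarrow> r x > 0"
      "\<And>x u v. x \<in> {a..b} - N \<Longrightarrow> u \<le> x \<Longrightarrow> x \<le> v \<Longrightarrow> {u..v} \<subseteq> ball x (r x) \<Longrightarrow> norm (f v - f u) \<le> (D + e) * (v - u)"
      by metis
    \<comment> \<open>Tags in \<open>N\<close> all use the open set \<open>O'\<close> as their
      neighbourhood, so their intervals together lie in a set of measure below \<delta>.\<close>
    define \<gamma> where "\<gamma> x = (if x \<in> N then O' else if x \<in> {a..b} then ball x (r x) else UNIV)" for x
    have "gauge \<gamma>"
      unfolding gauge_def \<gamma>_def using O'(1,2) r(1) by auto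
    then obtain p where p: "p tagged_division_of {a..b}" "\<gamma> fine p" by (rule fine_division_exists_real)
    have kI: "\<exists>u v. k = {u..v} \<and> u \<le> x \<and> x \<le> v \<and> a \<le> u \<and> v \<le> b \<and> x \<in> {a..b} \<and> k \<subseteq> \<gamma> x" if xk: "(x, k) \<in> p" for x k
    proof -
      obtain u v where uv: "k = {u..v}" using tagged_division_ofD(4)[OF p(1) xk] by auto
      have "x \<in> k" "k \<subseteq> {a..b}" "k \<subseteq> \<gamma> x"
        using tagged_division_ofD(2,3)[OF p(1) xk] fineD[OF p(2) xk] by auto
      then show ?thesis using uv by (intro exI[of _ u] exI[of _ v]) auto
    qed
    have finp: "finite p" using p(1) by blast
    define p1 where "p1 = {(x, k) \<in> p. x \<notin> N}"
    define p2 where "p2 = {(x, k) \<in> p. x \<in> N}"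
    have pp: "p = p1 \<union> p2" "p1 \<inter> p2 = {}" "finite p1" "finite p2"
      using finp by (auto simp: p1_def p2_def intro: finite_subset)
    have "f b - f a = (\<Sum>(x, k)\<in>p. f (Sup k) - f (Inf k))"
      by (rule additive_tagged_division_1[OF ab p(1), symmetric])
    then have "norm (f b - f a) \<le> (\<Sum>(x, k)\<in>p. norm (f (Sup k) - f (Inf k)))"
      by (simp add: split_def) (rule norm_sum)
    also have "\<dots> = (\<Sum>(x, k)\<in>p1. norm (f (Sup k) - f (Inf k))) + (\<Sum>(x, k)\<in>p2. norm (f (Sup k) - f (Inf k)))"
      using pp by (simp add: sum.union_disjoint)
    also have "\<dots> \<le> (D + e) * (b - a) + e"
    proof (rule add_mono)
      have "(\<Sum>(x, k)\<in>p1. norm (f (Sup k) - f (Inf k))) \<le> (\<Sum>(x, k)\<in>p1. (D + e) * (Sup k - Inf k))"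
      proof (rule sum_mono, clarify)
        fix x k assume xk: "(x, k) \<in> p1"
        then obtain u v where "k = {u..v}" "u \<le> x" "x \<le> v" "x \<in> {a..b}" "k \<subseteq> \<gamma> x" "x \<notin> N"
          using kI[of x k] by (auto simp: p1_def)
        then show "norm (f (Sup k) - f (Inf k)) \<le> (D + e) * (Sup k - Inf k)"
          using r(2)[of x u v] by (auto simp: \<gamma>_def)
      qed
      also have "\<dots> \<le> (\<Sum>(x, k)\<in>p. (D + e) * (Sup k - Inf k))"
      proof (rule sum_mono2[OF finp])
        show "p1 \<subseteq> p" using pp by auto
        fix i assume "i \<in> p - p1"
        then obtain x k where i: "i = (x, k)" "(x, k) \<in> p" by (cases i) auto
        then obtain u v where "k = {u..v}" "u \<le> v" using kI[of x k] by force
        then show "0 \<le> (case i of (x, k) \<Rightarrow> (D + e) * (Sup k - Inf k))" using D e i by simp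
      qed
      also have "\<dots> = (D + e) * (\<Sum>(x, k)\<in>p. Sup k - Inf k)" by (simp add: sum_distrib_left split_def)
      also have "(\<Sum>(x, k)\<in>p. Sup k - Inf k) = b - a" using additive_tagged_division_1[OF ab p(1), of "\<lambda>x. x"] .
      finally show "(\<Sum>(x, k)\<in>p1. norm (f (Sup k) - f (Inf k))) \<le> (D + e) * (b - a)" .
    next
      have tp: "p2 tagged_partial_division_of {a..b}"
        by (rule tagged_partial_division_subset[of p]) (use p(1) pp(1) in \<open>simp_all add: tagged_division_of_def\<close>)
      have td: "p2 tagged_division_of \<Union>(snd ` p2)" by (rule tagged_partial_division_of_Union_self[OF tp])
      have dv: "(snd ` p2) division_of \<Union>(snd ` p2)" by (rule partial_division_of_tagged_division[OF tp])
      \<comment> \<open>Absolute continuity speaks of untagged divisions. Two tags can share an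
        interval only if it is degenerate, and such an interval contributes
        \<open>0\<close>.\<close>
      have "(\<Sum>(x, k)\<in>p2. norm (f (Sup k) - f (Inf k))) = (\<Sum>k\<in>snd ` p2. norm (f (Sup k) - f (Inf k)))"
      proof -
        have "(\<Sum>(x, k)\<in>p2. if k = {} then 0 else norm (f (Sup k) - f (Inf k)))
          = (\<Sum>k\<in>snd ` p2. if k = {} then 0 else norm (f (Sup k) - f (Inf k)))"
        proof (rule sum.over_tagged_division_lemma[OF td])
          fix u v :: real assume "box u v = {}"
          then show "(if cbox u v = {} then 0 else norm (f (Sup (cbox u v)) - f (Inf (cbox u v)))) = 0"
            by (cases "u = v") auto
        qed
        moreover have ne: "k \<noteq> {}" if "(x, k) \<in> p2" for x k using kI[of x k] that by (auto simp: p2_def)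
        have "(\<Sum>(x, k)\<in>p2. if k = {} then 0 else norm (f (Sup k) - f (Inf k))) = (\<Sum>(x, k)\<in>p2. norm (f (Sup k) - f (Inf k)))"
          "(\<Sum>k\<in>snd ` p2. if k = {} then 0 else norm (f (Sup k) - f (Inf k))) = (\<Sum>k\<in>snd ` p2. norm (f (Sup k) - f (Inf k)))"
          by (rule sum.cong, use ne in auto)+
        ultimately show ?thesis by simp
      qed
      also have "\<dots> < e"
      proof (rule small[OF dv])
        show "\<Union>(snd ` p2) \<subseteq> {a..b}" using tagged_partial_division_ofD(3)[OF tp] by fastforce
        have "\<Union>(snd ` p2) \<subseteq> O'"
        proof
          fix z assume "z \<in> \<Union>(snd ` p2)"
          then obtain x k where "(x, k) \<in> p2" "z \<in> k" by auto
          then show "z \<in> O'" using kI[of x k] by (auto simp: p2_def \<gamma>_def)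
        qed
        then have "measure lebesgue (\<Union>(snd ` p2)) \<le> measure lebesgue O'"
          using division_length(2)[OF dv] Om by (intro measure_mono_fmeasurable) (auto dest: fmeasurableD)
        then show "(\<Sum>k\<in>snd ` p2. Sup k - Inf k) < \<delta>" using Om division_length(1)[OF dv] by simp
      qed
      finally show "(\<Sum>(x, k)\<in>p2. norm (f (Sup k) - f (Inf k))) \<le> e" by simp
    qed
    also have "\<dots> = D * (b - a) + e * (b - a + 1)" by (simp add: algebra_simps)
    finally show ?thesis .
  qed
  show ?thesis
  proof (rule field_le_epsilon)
    fix e :: real assume "e > 0"
    then show "norm (f b - f a) \<le> D * (b - a) + e"
      using main[of "e / (b - a + 1)"] ab by simp
  qed
qed

section \<open>Dyadic pieces\<close>

definition cutoff :: "real \<Rightarrow> real" where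
  "cutoff s = min 1 (max 0 (2 - s))"

text \<open>A difference of two cutoffs at neighbouring dyadic scales: it lives between
  \<open>a\<close> and \<open>4 * a\<close>, and sums over consecutive scales telescope, which
  yields the partition of unity.\<close>

definition bump :: "real \<Rightarrow> real \<Rightarrow> real" where
  "bump a t = cutoff (t / (2 * a)) - cutoff (t / a)"

lemma cutoff_bounds: "0 \<le> cutoff s" "cutoff s \<le> 1"
  by (auto simp: cutoff_def)

lemma cutoff_eq_1: "s \<le> 1 \<Longrightarrow> cutoff s = 1" and cutoff_eq_0: "s \<ge> 2 \<Longrightarrow> cutoff s = 0"
  by (auto simp: cutoff_def)

lemma cutoff_lipschitz: "\<bar>cutoff s - cutoff r\<bar> \<le> \<bar>s - r\<bar>"
  by (auto simp: cutoff_def min_def max_def abs_if)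

lemma bump_eq_0: "a > 0 \<Longrightarrow> t \<le> a \<or> t \<ge> 4 * a \<Longrightarrow> bump a t = 0"
  by (auto simp: bump_def cutoff_def field_simps min_def max_def)

lemma abs_bump_le: "\<bar>bump a t\<bar> \<le> 1"
  using cutoff_bounds[of "t / (2 * a)"] cutoff_bounds[of "t / a"] by (auto simp: bump_def abs_if)

lemma bump_lipschitz:
  assumes "a > 0" shows "\<bar>bump a t - bump a s\<bar> \<le> 2 / a * \<bar>t - s\<bar>"
proof -
  have "\<bar>bump a t - bump a s\<bar> \<le> \<bar>t / (2 * a) - s / (2 * a)\<bar> + \<bar>t / a - s / a\<bar>"
    using cutoff_lipschitz[of "t / (2 * a)" "s / (2 * a)"] cutoff_lipschitz[of "t / a" "s / a"]
    unfolding bump_def by linarith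
  also have "\<dots> = 3 / 2 / a * \<bar>t - s\<bar>"
    using assms by (simp add: diff_divide_distrib[symmetric] abs_divide field_simps)
  also have "\<dots> \<le> 2 / a * \<bar>t - s\<bar>"
    using assms by (intro mult_right_mono divide_right_mono) auto
  finally show ?thesis .
qed

lemma bump_abs: "a > 0 \<Longrightarrow> bump a \<bar>t\<bar> = bump a t + bump a (- t)"
  by (cases "t \<ge> 0") (auto simp: bump_eq_0)

text \<open>Control of \<open>f\<close> is given only between \<open>a\<close> and
  \<open>4 * a\<close>; clamping the argument to that interval extends \<open>f\<close> to the line
  with the same bounds and changes nothing where the bump is nonzero. The Lipschitz constant
  \<open>D + 2 * M / a\<close> comes from the product rule, as the bump has slope at most
  \<open>2 / a\<close>.\<close>

lemma A_norm_le_bump_right: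
  assumes a: "a > 0" and M: "M \<ge> 0" and D: "D \<ge> 0"
    and bd: "\<And>t. a \<le> t \<Longrightarrow> t \<le> 4 * a \<Longrightarrow> norm (f t) \<le> M"
    and lip: "\<And>s t. s \<in> {a..4 * a} \<Longrightarrow> t \<in> {a..4 * a} \<Longrightarrow> norm (f s - f t) \<le> D * \<bar>s - t\<bar>"
  shows "A_norm_le (\<lambda>t. f t * of_real (bump a t)) (8 * sqrt (4 * a * M * (D + 2 * M / a)))"
proof -
  define c where "c t = max a (min t (4 * a))" for t
  have c: "c t \<in> {a..4 * a}" "\<bar>c s - c t\<bar> \<le> \<bar>s - t\<bar>" for s t
    using a by (auto simp: c_def min_def max_def abs_if)
  have eq: "f t * of_real (bump a t) = f (c t) * of_real (bump a t)" for t
  proof (cases "t \<in> {a..4 * a}")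
    case True then show ?thesis by (simp add: c_def)
  next
    case False then have "bump a t = 0" using a by (intro bump_eq_0) auto
    then show ?thesis by simp
  qed
  have "A_norm_le (\<lambda>t. f (c t) * of_real (bump a t)) (8 * sqrt (4 * a * M * (D + 2 * M / a)))"
  proof (rule A_norm_le_lipschitz)
    \<comment> \<open>The slope of the bump alone makes the Lipschitz constant large enough for
      \<open>A_norm_le_lipschitz\<close>, even if \<open>D = 0\<close>.\<close>
    have "M \<le> 8 * M" using M by simp
    also have "\<dots> \<le> (D + 2 * M / a) * (4 * a)" using a D by (simp add: field_simps)
    finally show "M \<le> (D + 2 * M / a) * (4 * a)" .
    show "0 \<le> M" "0 < 4 * a" using M a by auto
    show "f (c t) * of_real (bump a t) = 0" if "4 * a \<le> \<bar>t\<bar>" for t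
      using that bump_eq_0[OF a, of t] a by (cases "t \<ge> 0") auto
    show "norm (f (c t) * of_real (bump a t)) \<le> M" for t
      using bd[of "c t"] c(1)[of t] abs_bump_le[of a t] M mult_mono[of "norm (f (c t))" M "\<bar>bump a t\<bar>" 1]
      by (simp add: norm_mult)
    show "norm (f (c x) * of_real (bump a x) - f (c y) * of_real (bump a y)) \<le> (D + 2 * M / a) * \<bar>x - y\<bar>" for x y
    proof -
      have "f (c x) * of_real (bump a x) - f (c y) * of_real (bump a y)
        = f (c x) * of_real (bump a x - bump a y) + of_real (bump a y) * (f (c x) - f (c y))"
        by (simp add: algebra_simps)
      also have "norm \<dots> \<le> norm (f (c x)) * \<bar>bump a x - bump a y\<bar> + \<bar>bump a y\<bar> * norm (f (c x) - f (c y))"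
        by (rule order_trans[OF norm_triangle_ineq]) (simp add: norm_mult del: of_real_diff)
      also have "\<dots> \<le> M * (2 / a * \<bar>x - y\<bar>) + 1 * (D * \<bar>x - y\<bar>)"
      proof (intro add_mono mult_mono)
        show "norm (f (c x)) \<le> M" using bd c(1)[of x] by auto
        show "\<bar>bump a x - bump a y\<bar> \<le> 2 / a * \<bar>x - y\<bar>" by (rule bump_lipschitz[OF a])
        show "\<bar>bump a y\<bar> \<le> 1" by (rule abs_bump_le)
        have "norm (f (c x) - f (c y)) \<le> D * \<bar>c x - c y\<bar>" by (rule lip[OF c(1) c(1)])
        also have "\<dots> \<le> D * \<bar>x - y\<bar>" by (rule mult_left_mono[OF c(2) D])
        finally show "norm (f (c x) - f (c y)) \<le> D * \<bar>x - y\<bar>" .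
      qed (use M in auto)
      also have "\<dots> = (D + 2 * M / a) * \<bar>x - y\<bar>" by (simp add: field_simps)
      finally show ?thesis .
    qed
  qed
  then show ?thesis unfolding eq .
qed

text \<open>The half-lines are treated separately, as no Lipschitz bound is available across the
  origin; the negative one is reflected by the dilation with factor \<open>-1\<close>.\<close>

lemma A_norm_le_bump:
  assumes a: "a > 0" and M: "M \<ge> 0" and D: "D \<ge> 0"
    and bd: "\<And>t. a \<le> \<bar>t\<bar> \<Longrightarrow> \<bar>t\<bar> \<le> 4 * a \<Longrightarrow> norm (f t) \<le> M"
    and lip: "\<And>s t. (s \<in> {a..4 * a} \<and> t \<in> {a..4 * a}) \<or> (s \<in> {-(4 * a)..-a} \<and> t \<in> {-(4 * a)..-a})
      \<Longrightarrow> norm (f s - f t) \<le> D * \<bar>s - t\<bar>"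
  shows "A_norm_le (\<lambda>t. f t * of_real (bump a \<bar>t\<bar>)) (16 * sqrt (4 * a * M * (D + 2 * M / a)))"
proof -
  let ?K = "8 * sqrt (4 * a * M * (D + 2 * M / a))"
  have 1: "A_norm_le (\<lambda>t. f t * of_real (bump a t)) ?K"
    by (rule A_norm_le_bump_right[OF a M D]) (use bd lip a in auto)
  have "A_norm_le (\<lambda>t. f (- t) * of_real (bump a t)) ?K"
  proof (rule A_norm_le_bump_right[OF a M D])
    show "norm (f (- s) - f (- t)) \<le> D * \<bar>s - t\<bar>" if "s \<in> {a..4 * a}" "t \<in> {a..4 * a}" for s t
      using lip[of "- s" "- t"] that by (simp add: abs_minus_commute)
  qed (use bd a in auto)
  from A_norm_le_scale[OF this, of "-1"] have "A_norm_le (\<lambda>t. f t * of_real (bump a (- t))) ?K" by simp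
  from A_norm_le_add[OF 1 this] show ?thesis
    using a by (simp add: bump_abs distrib_left)
qed

lemma locally_absolutely_continuous_increment_bound:
  assumes lac: "locally_absolutely_continuous_on (- {0}) f" and a: "a > 0" and D: "D \<ge> 0"
    and ae: "AE x in lebesgue. a \<le> \<bar>x\<bar> \<and> \<bar>x\<bar> \<le> b \<longrightarrow> norm (deriv_at f x) \<le> D"
    and st: "(s \<in> {a..b} \<and> t \<in> {a..b}) \<or> (s \<in> {-b..-a} \<and> t \<in> {-b..-a})"
  shows "norm (f s - f t) \<le> D * \<bar>s - t\<bar>"
proof -
  have *: "norm (f v - f u) \<le> D * (v - u)"
    if uv: "u \<le> v" "(u \<in> {a..b} \<and> v \<in> {a..b}) \<or> (u \<in> {-b..-a} \<and> v \<in> {-b..-a})" for u v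
  proof (rule absolutely_continuous_increment_bound[OF _ uv(1) D])
    have "{u..v} \<subseteq> - {0}" using uv a by auto
    then show "absolutely_continuous_on {u..v} f"
      using lac unfolding locally_absolutely_continuous_on_def by blast
    show "AE x in lebesgue. x \<in> {u<..<v} \<longrightarrow> norm (deriv_at f x) \<le> D"
      using ae by eventually_elim (use uv a in auto)
  qed
  show ?thesis
  proof (cases "s \<le> t")
    case True
    then show ?thesis using *[of s t] st by (simp add: norm_minus_commute)
  next
    case False
    then show ?thesis using st by (intro order_trans[OF *[of t s]]) auto
  qed
qed

section \<open>Essential bounds on the derivative and the logarithmic integral\<close>

lemma abs_ge_sets_lebesgue: "{s::real. r \<le> \<bar>s\<bar>} \<in> sets lebesgue"
proof -
  have "closed {s::real. r \<le> \<bar>s\<bar>}" by (intro closed_Collect_le continuous_intros)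
  then show ?thesis by (metis borel_closed sets_completionI_sets sets_lborel)
qed

text \<open>An essential supremum is itself an almost everywhere bound. Finiteness matters because
  \<open>enn2real\<close> sends infinity to \<open>0\<close>.\<close>

lemma f1_AE:
  assumes "r > 0" "f1 f r < \<infinity>"
  shows "AE x in lebesgue. \<bar>x\<bar> \<ge> r \<longrightarrow> norm (deriv_at f x) \<le> enn2real (f1 f r)"
proof -
  have S: "{s. \<bar>s\<bar> \<ge> \<bar>r\<bar>} \<in> sets lebesgue" by (rule abs_ge_sets_lebesgue)
  have "AE x in lebesgue_on {s. \<bar>s\<bar> \<ge> \<bar>r\<bar>}. ennreal (norm (deriv_at f x)) \<le> f1 f r"
    unfolding f1_def by (rule esssup_AE)
  then have "AE x in lebesgue. x \<in> {s. \<bar>s\<bar> \<ge> \<bar>r\<bar>} \<longrightarrow> ennreal (norm (deriv_at f x)) \<le> f1 f r"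
    using S by (subst (asm) AE_restrict_space_iff) auto
  then show ?thesis
  proof eventually_elim
    case (elim x)
    show ?case
    proof
      assume "r \<le> \<bar>x\<bar>"
      then have "ennreal (norm (deriv_at f x)) \<le> ennreal (enn2real (f1 f r))"
        using elim assms by simp
      then show "norm (deriv_at f x) \<le> enn2real (f1 f r)" by (simp add: ennreal_le_iff)
    qed
  qed
qed

text \<open>Besides the inclusion of the sets, the point is measurability: \<open>esssup\<close> is
  infinite by convention on non-measurable functions, so a finite \<open>f1 f r\<close> certifies
  measurability on the larger set and hence on the smaller one.\<close>

lemma f1_antimono:
  assumes "0 < r" "r \<le> r'"
  shows "f1 f r' \<le> f1 f r"
proof (cases "f1 f r = \<infinity>")
  case False
  let ?S = "\<lambda>r. {s::real. \<bar>s\<bar> \<ge> \<bar>r\<bar>}" and ?g = "\<lambda>s. ennreal (norm (deriv_at f s))"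
  have S: "?S r \<in> sets lebesgue" "?S r' \<in> sets lebesgue" by (rule abs_ge_sets_lebesgue)+
  have sub: "?S r' \<subseteq> ?S r" using assms by auto
  have "?g \<in> borel_measurable (lebesgue_on (?S r))"
    using False esssup_non_measurable[of ?g "lebesgue_on (?S r)"] unfolding f1_def by auto
  then have m: "?g \<in> borel_measurable (lebesgue_on (?S r'))"
    by (rule measurable_restrict_mono[OF _ sub])
  have "AE x in lebesgue_on (?S r). ?g x \<le> f1 f r"
    unfolding f1_def by (rule esssup_AE)
  then have "AE x in lebesgue. x \<in> ?S r \<longrightarrow> ?g x \<le> f1 f r"
    using S by (subst (asm) AE_restrict_space_iff) auto
  then have "AE x in lebesgue. x \<in> ?S r' \<longrightarrow> ?g x \<le> f1 f r"
    by eventually_elim (use sub in auto)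
  then have "AE x in lebesgue_on (?S r'). ?g x \<le> f1 f r"
    using S by (subst AE_restrict_space_iff) auto
  then show ?thesis unfolding f1_def[of f r'] by (rule esssup_I[OF m])
qed simp

text \<open>Between \<open>2^-(i+1)\<close> and \<open>2^-i\<close>, \<open>f1\<close> is at least
  its value at the right end, \<open>ln (2 / t)\<close> is at least \<open>(i + 1) * ln 2\<close>,
  and the interval has length \<open>2^-(i+1)\<close>.\<close>

lemma A1_dyadic_lower_bound:
  "(\<Sum>i<n. f1 f (1 / 2 ^ i) * ennreal ((real i + 1) * ln 2 / 2 ^ Suc i)) \<le> A1 f"
proof -
  define I where "I i = {1 / 2 ^ Suc i<..<1 / 2 ^ i :: real}" for i :: nat
  define c where "c i = f1 f (1 / 2 ^ i) * ennreal ((real i + 1) * ln 2)" for i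
  have disj: "i = j" if "t \<in> I i" "t \<in> I j" for i j t
  proof (rule ccontr)
    have *: False if "i < j" "t \<in> I i" "t \<in> I j" for i j
    proof -
      have "t < 1 / 2 ^ j" "1 / 2 ^ Suc i < t" using that by (auto simp: I_def)
      moreover have "(1::real) / 2 ^ j \<le> 1 / 2 ^ Suc i"
        using that by (intro divide_left_mono power_increasing) auto
      ultimately show False by linarith
    qed
    assume "i \<noteq> j"
    then show False using *[of i j] *[of j i] that by linarith
  qed
  have em: "emeasure lebesgue (I i) = ennreal (1 / 2 ^ Suc i)" for i
  proof -
    have "(1::real) / 2 ^ Suc i \<le> 1 / 2 ^ i" by (intro divide_left_mono power_increasing) auto
    then show ?thesis unfolding I_def by (simp add: field_simps)
  qed
  have "(\<Sum>i<n. f1 f (1 / 2 ^ i) * ennreal ((real i + 1) * ln 2 / 2 ^ Suc i)) = (\<Sum>i<n. c i * emeasure lebesgue (I i))"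
    unfolding em c_def by (intro sum.cong) (auto simp: mult.assoc ennreal_mult[symmetric])
  also have "\<dots> = (\<Sum>i<n. \<integral>\<^sup>+t. c i * indicator (I i) t \<partial>lebesgue)"
    by (intro sum.cong refl nn_integral_cmult_indicator[symmetric]) (simp add: I_def)
  also have "\<dots> = (\<integral>\<^sup>+t. (\<Sum>i<n. c i * indicator (I i) t) \<partial>lebesgue)"
    by (intro nn_integral_sum[symmetric] borel_measurable_times_ennreal borel_measurable_const
        borel_measurable_indicator) (simp add: I_def)
  also have "\<dots> \<le> A1 f"
    unfolding A1_def
  proof (rule nn_integral_mono)
    fix t :: real
    show "(\<Sum>i<n. c i * indicator (I i) t) \<le> f1 f t * ennreal (ln (2 / t)) * indicator {0<..<1} t"
    proof (cases "\<exists>j<n. t \<in> I j")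
      case True
      then obtain j where j: "j < n" "t \<in> I j" by blast
      have "(\<Sum>i<n. c i * indicator (I i) t) = (\<Sum>i<n. if i = j then c j else 0)"
        using j disj by (intro sum.cong) (auto simp: indicator_def)
      also have "\<dots> = c j" using j by simp
      also have "\<dots> \<le> f1 f t * ennreal (ln (2 / t))"
        unfolding c_def
      proof (intro mult_mono f1_antimono ennreal_leI)
        have t: "0 < 1 / (2 ^ Suc j :: real)" "1 / 2 ^ Suc j < t" "t < 1 / 2 ^ j" using j by (auto simp: I_def)
        then show t0: "0 < t" and "t \<le> 1 / 2 ^ j" by linarith+
        have "(real j + 1) * ln 2 = ln (2 ^ Suc j)" by (simp add: ln_realpow algebra_simps ln_mult)
        also have "\<dots> \<le> ln (2 / t)" using t t0 by (intro ln_mono) (auto simp: field_simps)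
        finally show "(real j + 1) * ln 2 \<le> ln (2 / t)" .
      qed auto
      also have "\<dots> = f1 f t * ennreal (ln (2 / t)) * indicator {0<..<1} t"
      proof -
        have "(1::real) / 2 ^ j \<le> 1" by simp
        moreover have "0 < 1 / (2 ^ Suc j :: real)" by simp
        ultimately have "t \<in> {0<..<1}" using j(2) unfolding I_def by (auto intro: less_trans less_le_trans)
        then show ?thesis by simp
      qed
      finally show ?thesis .
    next
      case False
      then have "(\<Sum>i<n. c i * indicator (I i) t) = 0" by (intro sum.neutral) auto
      then show ?thesis by simp
    qed
  qed
  finally show ?thesis .
qed

lemma f1_finite:
  assumes "A1 f < \<infinity>" "r > 0"
  shows "f1 f r < \<infinity>"
proof -
  obtain i where i: "1 / 2 ^ i < r"
    using assms(2) real_arch_pow_inv[of r "1/2"] by (auto simp: power_one_over)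
  have "f1 f (1 / 2 ^ i) * ennreal ((real i + 1) * ln 2 / 2 ^ Suc i) \<le> A1 f"
    using A1_dyadic_lower_bound[where f=f and n="Suc i"] by (simp add: order_trans[rotated])
  then have "f1 f (1 / 2 ^ i) * ennreal ((real i + 1) * ln 2 / 2 ^ Suc i) < \<infinity>"
    using assms(1) by (rule le_less_trans)
  moreover have "(real i + 1) * ln 2 / 2 ^ Suc i > 0" by simp
  ultimately have "f1 f (1 / 2 ^ i) < \<infinity>"
    by (auto simp: ennreal_mult_less_top)
  then show ?thesis using f1_antimono[of "1 / 2 ^ i" r f] i by (simp add: le_less_trans)
qed

lemma A1_summable:
  assumes "A1 f < \<infinity>"
  shows "summable (\<lambda>i. real i * (enn2real (f1 f (1 / 2 ^ i)) / 2 ^ i))" (is ?A)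
    and "summable (\<lambda>i. enn2real (f1 f (1 / 2 ^ i)) / 2 ^ i)" (is ?B)
proof -
  define F where "F i = enn2real (f1 f (1 / 2 ^ i))" for i
  have F: "f1 f (1 / 2 ^ i) = ennreal (F i)" "F i \<ge> 0" for i
    using f1_finite[OF assms, of "1 / 2 ^ i"] by (auto simp: F_def)
  have "(\<Sum>i<n. (real i + 1) * (F i / 2 ^ i)) \<le> 2 / ln 2 * enn2real (A1 f)" for n
  proof -
    have "ennreal (\<Sum>i<n. F i * ((real i + 1) * ln 2 / 2 ^ Suc i)) = (\<Sum>i<n. ennreal (F i * ((real i + 1) * ln 2 / 2 ^ Suc i)))"
      using F(2) by (intro sum_ennreal[symmetric]) simp
    also have "\<dots> = (\<Sum>i<n. f1 f (1 / 2 ^ i) * ennreal ((real i + 1) * ln 2 / 2 ^ Suc i))"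
      unfolding F(1) using F(2) by (intro sum.cong refl ennreal_mult) simp_all
    also have "\<dots> \<le> A1 f" by (rule A1_dyadic_lower_bound)
    also have "\<dots> = ennreal (enn2real (A1 f))" using assms by simp
    finally have "(\<Sum>i<n. F i * ((real i + 1) * ln 2 / 2 ^ Suc i)) \<le> enn2real (A1 f)"
      by (simp add: ennreal_le_iff)
    moreover have "(\<Sum>i<n. F i * ((real i + 1) * ln 2 / 2 ^ Suc i)) = ln 2 / 2 * (\<Sum>i<n. (real i + 1) * (F i / 2 ^ i))"
      unfolding sum_distrib_left by (intro sum.cong) auto
    ultimately show ?thesis by (simp add: field_simps)
  qed
  then have *: "summable (\<lambda>i. (real i + 1) * (F i / 2 ^ i))"
    using F(2) by (intro summableI_nonneg_bounded) auto
  show ?A unfolding F_def[symmetric]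
    by (rule summable_comparison_test'[OF *, of 0]) (use F(2) in \<open>auto simp: field_simps\<close>)
  show ?B unfolding F_def[symmetric]
    by (rule summable_comparison_test'[OF *, of 0]) (use F(2) in \<open>auto simp: field_simps\<close>)
qed

text \<open>The term \<open>b j\<close> occurs in exactly \<open>j\<close> of the tails, those with
  \<open>k < j\<close>, so the double sum is the sum of \<open>real j * b j\<close>. With the first
  series of \<open>A1_summable\<close> this is where the logarithmic weight is spent.\<close>

lemma summable_tails:
  fixes b :: "nat \<Rightarrow> real"
  assumes nn: "\<And>i. b i \<ge> 0" and s1: "summable (\<lambda>i. real i * b i)" and s0: "summable b"
  shows "summable (\<lambda>k. \<Sum>i. b (i + Suc k))"
proof -
  define R where "R k = (\<Sum>i. b (i + Suc k))" for k
  have sR: "summable (\<lambda>i. b (i + Suc k))" for k using s0 by (subst summable_iff_shift)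
  have R0: "R k \<ge> 0" for k unfolding R_def by (rule suminf_nonneg[OF sR]) (rule nn)
  have step: "R n = b (Suc n) + R (Suc n)" for n
    unfolding R_def using suminf_split_head[OF sR[of n]] by simp
  have sum: "(\<Sum>k<n. R k) = (\<Sum>j<n. real (Suc j) * b (Suc j)) + real n * R n" for n
  proof (induction n)
    case (Suc n)
    then show ?case using step[of n] by (simp add: algebra_simps)
  qed simp
  have "(\<Sum>k<n. R k) \<le> (\<Sum>i. real i * b i) + (\<Sum>i. real i * b i)" for n
  proof -
    have "(\<Sum>j<n. real (Suc j) * b (Suc j)) = (\<Sum>i<Suc n. real i * b i)" by (subst sum.lessThan_Suc_shift) simp
    also have "\<dots> \<le> (\<Sum>i. real i * b i)" using nn by (intro sum_le_suminf[OF s1]) auto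
    finally have 1: "(\<Sum>j<n. real (Suc j) * b (Suc j)) \<le> (\<Sum>i. real i * b i)" .
    have s2: "summable (\<lambda>i. real (i + Suc n) * b (i + Suc n))"
      using s1 by (subst summable_iff_shift[of "\<lambda>i. real i * b i" "Suc n"])
    have "real n * R n = (\<Sum>i. real n * b (i + Suc n))" unfolding R_def by (rule suminf_mult[OF sR, symmetric])
    also have "\<dots> \<le> (\<Sum>i. real (i + Suc n) * b (i + Suc n))"
      by (intro suminf_le summable_mult sR s2) (use nn in \<open>auto intro!: mult_right_mono\<close>)
    also have "\<dots> = (\<Sum>i. real i * b i) - (\<Sum>i<Suc n. real i * b i)" by (rule suminf_minus_initial_segment[OF s1])
    also have "\<dots> \<le> (\<Sum>i. real i * b i)"
      using sum_nonneg[of "{..<Suc n}" "\<lambda>i. real i * b i"] nn by simp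
    finally show ?thesis unfolding sum using 1 by linarith
  qed
  then show ?thesis unfolding R_def[symmetric] using R0 by (intro summableI_nonneg_bounded) auto
qed

section \<open>Summing the pieces at the origin and at infinity\<close>

text \<open>Decay estimates hold only for large arguments; the finitely many earlier pieces have
  merely some bound, which does not affect convergence.\<close>

lemma A_norm_le_eventual_series:
  assumes ex: "\<And>k. \<exists>K. A_norm_le (h k) K" and bd: "\<And>k. k \<ge> k0 \<Longrightarrow> A_norm_le (h k) (B k)" and B: "summable B"
    and sums: "\<And>y. (\<lambda>n. h n y) sums f y"
  shows "\<exists>K. A_norm_le f K"
proof -
  obtain K where K: "\<And>k. A_norm_le (h k) (K k)" using ex by metis
  define B' where "B' k = (if k \<ge> k0 then B k else K k)" for k
  have "A_norm_le (h k) (B' k)" for k using K bd by (simp add: B'_def)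
  moreover have "summable B'"
  proof (rule iffD1[OF summable_cong B])
    show "\<forall>\<^sub>F n in sequentially. B n = B' n"
      using eventually_ge_at_top[of k0] by eventually_elim (simp add: B'_def)
  qed
  ultimately have "A_norm_le f (suminf B')" using sums by (rule A_norm_le_series)
  then show ?thesis ..
qed

lemma summable_dyadic_powr:
  assumes "s > 0"
  shows "summable (\<lambda>k. (2 ^ k / 2 :: real) powr (- s))"
proof -
  have "(2 ^ k / 2 :: real) powr (- s) = 2 powr s * (2 powr (- s)) ^ k" for k
  proof -
    have "(2 ^ k / 2 :: real) = 2 powr (real k - 1)" by (simp add: powr_diff powr_realpow)
    then have "(2 ^ k / 2 :: real) powr (- s) = 2 powr ((real k - 1) * (- s))" by (simp only: powr_powr)
    also have "(real k - 1) * (- s) = s + (- s) * real k" by (simp add: algebra_simps)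
    also have "2 powr \<dots> = 2 powr s * (2 powr (- s)) powr real k" by (simp only: powr_add powr_powr)
    finally show ?thesis by (simp add: powr_realpow)
  qed
  moreover have "2 powr (- s) < (1::real)" using assms powr_less_one[of 2 "- s"] by simp
  ultimately show ?thesis by (simp add: summable_geometric summable_mult)
qed

lemma A_norm_le_cutoff: "A_norm_le (\<lambda>t. of_real (cutoff (2 * \<bar>t\<bar>))) (8 * sqrt 2)"
proof -
  have "A_norm_le (\<lambda>t. of_real (cutoff (2 * \<bar>t\<bar>))) (8 * sqrt (1 * 1 * 2))"
  proof (rule A_norm_le_lipschitz)
    show "norm (complex_of_real (cutoff (2 * \<bar>t\<bar>))) \<le> 1" for t
      using cutoff_bounds[of "2 * \<bar>t\<bar>"] by simp
    show "norm (complex_of_real (cutoff (2 * \<bar>x\<bar>)) - complex_of_real (cutoff (2 * \<bar>y\<bar>))) \<le> 2 * \<bar>x - y\<bar>" for x y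
    proof -
      have "norm (complex_of_real (cutoff (2 * \<bar>x\<bar>)) - complex_of_real (cutoff (2 * \<bar>y\<bar>))) = \<bar>cutoff (2 * \<bar>x\<bar>) - cutoff (2 * \<bar>y\<bar>)\<bar>"
        by (simp flip: of_real_diff)
      also have "\<dots> \<le> \<bar>2 * \<bar>x\<bar> - 2 * \<bar>y\<bar>\<bar>" by (rule cutoff_lipschitz)
      also have "\<dots> = 2 * \<bar>\<bar>x\<bar> - \<bar>y\<bar>\<bar>"
        by (simp only: right_diff_distrib[symmetric] abs_mult abs_numeral)
      also have "\<dots> \<le> 2 * \<bar>x - y\<bar>" using abs_triangle_ineq3[of x y] by simp
      finally show ?thesis .
    qed
  qed (auto simp: cutoff_eq_0)
  then show ?thesis by simp
qed

text \<open>On the piece of scale \<open>2^-(k+2)\<close> the function is bounded by the tail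
  \<open>R k\<close> and has Lipschitz constant \<open>F (k + 2)\<close>, so its norm is of order
  \<open>sqrt (R k * (b (k + 2) + R k))\<close>. This is at most a multiple of
  \<open>b (k + 2) + R k\<close>, and both series converge.\<close>

lemma A_norm_le_near_zero:
  fixes f :: "real \<Rightarrow> complex"
  assumes cont: "continuous_on UNIV f" and lac: "locally_absolutely_continuous_on (- {0}) f" and A1: "A1 f < \<infinity>"
  shows "\<exists>K. A_norm_le (\<lambda>t. (f t - f 0) * of_real (cutoff (2 * \<bar>t\<bar>))) K"
proof -
  define F where "F i = enn2real (f1 f (1 / 2 ^ i))" for i :: nat
  define b where "b i = F i / 2 ^ i" for i :: nat
  define R where "R k = (\<Sum>i. b (i + Suc k))" for k
  have F0: "F i \<ge> 0" and b0: "b i \<ge> 0" for i by (auto simp: F_def b_def)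
  have sb: "summable (\<lambda>i. real i * b i)" "summable b"
    using A1_summable[OF A1] unfolding b_def F_def by auto
  have sR: "summable R" unfolding R_def by (rule summable_tails[OF b0 sb])
  have sbk: "summable (\<lambda>i. b (i + k))" for k using sb(2) by (subst summable_iff_shift)
  have R0: "R k \<ge> 0" for k unfolding R_def by (rule suminf_nonneg[OF sbk b0])
  have ae: "AE x in lebesgue. 1 / 2 ^ i \<le> \<bar>x\<bar> \<and> \<bar>x\<bar> \<le> c \<longrightarrow> norm (deriv_at f x) \<le> F i" for i c
  proof -
    have "AE x in lebesgue. \<bar>x\<bar> \<ge> 1 / 2 ^ i \<longrightarrow> norm (deriv_at f x) \<le> F i"
      unfolding F_def by (rule f1_AE) (use f1_finite[OF A1] in auto)
    then show ?thesis by eventually_elim auto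
  qed
  have lip: "norm (f s - f t) \<le> F i * \<bar>s - t\<bar>"
    if "(s \<in> {1 / 2 ^ i..c} \<and> t \<in> {1 / 2 ^ i..c}) \<or> (s \<in> {-c..-(1 / 2 ^ i)} \<and> t \<in> {-c..-(1 / 2 ^ i)})" for i s t c
    by (rule locally_absolutely_continuous_increment_bound[OF lac _ F0 ae that]) simp
  \<comment> \<open>Walking from \<open>t\<close> towards \<open>0\<close> through dyadic points
    costs at most one \<open>b i\<close> per step, and continuity at \<open>0\<close> closes the
    path.\<close>
  have near: "norm (f t - f 0) \<le> R k" if t: "\<bar>t\<bar> \<le> 1 / 2 ^ k" for t k
  proof (cases "t = 0")
    case False
    define \<sigma> where "\<sigma> = sgn t"
    define x where "x = \<bar>t\<bar>"
    have \<sigma>: "\<sigma> = 1 \<or> \<sigma> = -1" "t = \<sigma> * x" "x > 0" "x \<le> 1 / 2 ^ k"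
      using False t by (auto simp: \<sigma>_def x_def sgn_if)
    have step: "norm (f (\<sigma> * u) - f (\<sigma> * (1 / 2 ^ Suc n))) \<le> b (Suc n)"
      if u: "1 / 2 ^ Suc n \<le> u" "u \<le> 1 / 2 ^ n" for u n
    proof -
      have le: "(1::real) / 2 ^ Suc n \<le> 1 / 2 ^ n" by (intro divide_left_mono power_increasing) auto
      have "norm (f (\<sigma> * u) - f (\<sigma> * (1 / 2 ^ Suc n))) \<le> F (Suc n) * \<bar>\<sigma> * u - \<sigma> * (1 / 2 ^ Suc n)\<bar>"
      proof (rule lip[where c="1 / 2 ^ n"])
        show "(\<sigma> * u \<in> {1 / 2 ^ Suc n..1 / 2 ^ n} \<and> \<sigma> * (1 / 2 ^ Suc n) \<in> {1 / 2 ^ Suc n..1 / 2 ^ n}) \<or>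
          (\<sigma> * u \<in> {- (1 / 2 ^ n)..- (1 / 2 ^ Suc n)} \<and> \<sigma> * (1 / 2 ^ Suc n) \<in> {- (1 / 2 ^ n)..- (1 / 2 ^ Suc n)})"
          using \<sigma>(1) u le by (elim disjE) (simp_all only: mult_1 mult_minus1 atLeastAtMost_iff neg_le_iff_le order_refl simp_thms)
      qed
      also have "\<bar>\<sigma> * u - \<sigma> * (1 / 2 ^ Suc n)\<bar> = u - 1 / 2 ^ Suc n"
      proof -
        have "\<bar>\<sigma>\<bar> = 1" using \<sigma>(1) by auto
        then have "\<bar>\<sigma> * u - \<sigma> * (1 / 2 ^ Suc n)\<bar> = \<bar>u - 1 / 2 ^ Suc n\<bar>"
          by (simp only: right_diff_distrib[symmetric] abs_mult mult_1)
        then show ?thesis using u by linarith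
      qed
      also have "F (Suc n) * (u - 1 / 2 ^ Suc n) \<le> F (Suc n) * (1 / 2 ^ Suc n)"
      proof (rule mult_left_mono[OF _ F0])
        have "(1::real) / 2 ^ n = 2 * (1 / 2 ^ Suc n)" by simp
        then show "u - 1 / 2 ^ Suc n \<le> 1 / 2 ^ Suc n" using u by linarith
      qed
      finally show ?thesis by (simp add: b_def)
    qed
    have claim: "norm (f (\<sigma> * u) - f (\<sigma> * (1 / 2 ^ (k + m)))) \<le> (\<Sum>i<m. b (i + Suc k))"
      if "1 / 2 ^ (k + m) \<le> u" "u \<le> 1 / 2 ^ k" for u m
      using that
    proof (induction m arbitrary: u)
      case 0
      then have "u = 1 / 2 ^ k" by simp
      then show ?case by simp
    next
      case (Suc m)
      show ?case
      proof (cases "u \<ge> 1 / 2 ^ (k + m)")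
        case True
        have "(1::real) / 2 ^ Suc (k + m) \<le> 1 / 2 ^ (k + m)" by (intro divide_left_mono power_increasing) auto
        then have "norm (f (\<sigma> * (1 / 2 ^ (k + m))) - f (\<sigma> * (1 / 2 ^ Suc (k + m)))) \<le> b (Suc (k + m))"
          by (intro step) auto
        moreover have "norm (f (\<sigma> * u) - f (\<sigma> * (1 / 2 ^ (k + m)))) \<le> (\<Sum>i<m. b (i + Suc k))"
          using Suc True by blast
        ultimately have "norm (f (\<sigma> * u) - f (\<sigma> * (1 / 2 ^ Suc (k + m)))) \<le> (\<Sum>i<m. b (i + Suc k)) + b (Suc (k + m))"
          by (rule norm_diff_triangle_le[rotated])
        then show ?thesis by (simp add: add.commute)
      next
        case False
        then have "norm (f (\<sigma> * u) - f (\<sigma> * (1 / 2 ^ Suc (k + m)))) \<le> b (Suc (k + m))"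
          using Suc.prems by (intro step) auto
        also have "\<dots> \<le> (\<Sum>i<Suc m. b (i + Suc k))"
          using b0 by (simp add: sum_nonneg add.commute)
        finally show ?thesis by simp
      qed
    qed
    have lim: "(\<lambda>m. f (\<sigma> * (1 / 2 ^ (k + m)))) \<longlonglongrightarrow> f 0"
    proof -
      have "(\<lambda>m. \<sigma> * ((1 / 2 ^ k) * (1 / 2) ^ m)) \<longlonglongrightarrow> \<sigma> * ((1 / 2 ^ k) * 0)"
        by (intro tendsto_mult tendsto_const LIMSEQ_realpow_zero) auto
      then have "(\<lambda>m. \<sigma> * (1 / 2 ^ (k + m))) \<longlonglongrightarrow> 0"
        by (simp add: power_add power_one_over divide_simps)
      then show ?thesis
        by (rule continuous_on_tendsto_compose[OF cont]) auto
    qed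
    have "(\<lambda>m. norm (f t - f (\<sigma> * (1 / 2 ^ (k + m))))) \<longlonglongrightarrow> norm (f t - f 0)"
      by (intro tendsto_intros lim)
    moreover have "\<forall>\<^sub>F m in sequentially. norm (f t - f (\<sigma> * (1 / 2 ^ (k + m)))) \<le> R k"
    proof -
      obtain m0 where m0: "(1/2::real) ^ m0 < x" using real_arch_pow_inv[OF \<sigma>(3), of "1/2"] by auto
      have "norm (f t - f (\<sigma> * (1 / 2 ^ (k + m)))) \<le> R k" if "m \<ge> m0" for m
      proof -
        have "(1::real) / 2 ^ (k + m) \<le> 1 / 2 ^ m0"
          using that by (intro divide_left_mono power_increasing) auto
        also have "\<dots> \<le> x" using m0 by (simp add: power_one_over)
        finally have "norm (f t - f (\<sigma> * (1 / 2 ^ (k + m)))) \<le> (\<Sum>i<m. b (i + Suc k))"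
          using claim[of m x] \<sigma> by simp
        also have "\<dots> \<le> R k" unfolding R_def by (intro sum_le_suminf sbk) (auto simp: b0)
        finally show ?thesis .
      qed
      then show ?thesis using eventually_sequentially by blast
    qed
    ultimately show ?thesis by (rule tendsto_upperbound) simp
  qed (use R0 in simp)
  \<comment> \<open>The shift by \<open>2\<close> makes the bump of index \<open>k\<close> end at
    \<open>2^-k\<close>, where \<open>R k\<close> bounds \<open>f - f 0\<close>, and begin at
    \<open>2^-(k+2)\<close>, where \<open>F (k + 2)\<close> bounds the slope.\<close>
  define a where "a k = 1 / (2::real) ^ (k + 2)" for k :: nat
  have a: "a k > 0" "4 * a k = 1 / 2 ^ k" for k by (auto simp: a_def)
  have piece: "A_norm_le (\<lambda>t. (f t - f 0) * of_real (bump (a k) \<bar>t\<bar>)) (16 * (b (k + 2) + 3 * R k))" for k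
  proof (rule A_norm_le_mono)
    show "A_norm_le (\<lambda>t. (f t - f 0) * of_real (bump (a k) \<bar>t\<bar>)) (16 * sqrt (4 * a k * R k * (F (k + 2) + 2 * R k / a k)))"
    proof (rule A_norm_le_bump[OF a(1) R0 F0])
      show "norm (f t - f 0) \<le> R k" if "\<bar>t\<bar> \<le> 4 * a k" for t
        using near that a(2) by simp
      show "norm (f s - f 0 - (f t - f 0)) \<le> F (k + 2) * \<bar>s - t\<bar>"
        if "(s \<in> {a k..4 * a k} \<and> t \<in> {a k..4 * a k}) \<or> (s \<in> {-(4 * a k)..-a k} \<and> t \<in> {-(4 * a k)..-a k})" for s t
        using lip[of s "k + 2" "4 * a k" t] that a(1)[of k] by (simp add: a_def)
    qed
    have "4 * a k * R k * (F (k + 2) + 2 * R k / a k) = 4 * R k * (b (k + 2) + 2 * R k)"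
      using a(1)[of k] by (simp add: b_def a_def field_simps)
    \<comment> \<open>The difference of the two sides is
      \<open>(b (k + 2) + R k)\<^sup>2\<close>.\<close>
    also have "\<dots> \<le> (b (k + 2) + 3 * R k)\<^sup>2"
      using R0[of k] b0[of "k + 2"] by (simp add: power2_eq_square algebra_simps)
    finally have "sqrt (4 * a k * R k * (F (k + 2) + 2 * R k / a k)) \<le> b (k + 2) + 3 * R k"
      using R0[of k] b0[of "k + 2"] by (intro real_le_lsqrt) auto
    then show "16 * sqrt (4 * a k * R k * (F (k + 2) + 2 * R k / a k)) \<le> 16 * (b (k + 2) + 3 * R k)" by simp
  qed
  have "A_norm_le (\<lambda>t. (f t - f 0) * of_real (cutoff (2 * \<bar>t\<bar>))) (\<Sum>k. 16 * (b (k + 2) + 3 * R k))"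
  proof (rule A_norm_le_series[OF piece])
    show "summable (\<lambda>k. 16 * (b (k + 2) + 3 * R k))"
      by (intro summable_mult summable_add sbk sR)
    fix t :: real
    show "(\<lambda>k. (f t - f 0) * of_real (bump (a k) \<bar>t\<bar>)) sums ((f t - f 0) * of_real (cutoff (2 * \<bar>t\<bar>)))"
    \<comment> \<open>At the origin every bump vanishes although the cutoff is \<open>1\<close>; the
      identity holds there because \<open>f t - f 0\<close> is \<open>0\<close>.\<close>
    proof (cases "t = 0")
      case False
      define u where "u k = cutoff (\<bar>t\<bar> * 2 ^ Suc k)" for k
      have bu: "bump (a k) \<bar>t\<bar> = u k - u (Suc k)" for k
        by (simp add: bump_def u_def a_def field_simps)
      have "u \<longlonglongrightarrow> 0"
      proof (rule tendsto_eventually)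
        obtain n0 where n0: "2 / \<bar>t\<bar> < 2 ^ n0" using real_arch_pow[of 2 "2 / \<bar>t\<bar>"] by auto
        have "u n = 0" if "n \<ge> n0" for n
        proof -
          have "(2::real) ^ n0 \<le> 2 ^ Suc n" using that by (intro power_increasing) auto
          then have "2 / \<bar>t\<bar> \<le> 2 ^ Suc n" using n0 by linarith
          then have "2 \<le> \<bar>t\<bar> * 2 ^ Suc n" using False by (simp add: pos_divide_le_eq mult.commute)
          then show ?thesis unfolding u_def by (rule cutoff_eq_0)
        qed
        then show "\<forall>\<^sub>F n in sequentially. u n = 0" using eventually_sequentially by blast
      qed
      from telescope_sums'[OF this] have "(\<lambda>k. bump (a k) \<bar>t\<bar>) sums (cutoff (2 * \<bar>t\<bar>))"
        unfolding bu by (simp add: u_def mult.commute)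
      then show ?thesis by (intro sums_mult sums_of_real)
    qed simp
  qed
  then show ?thesis ..
qed

lemma A_norm_le_at_infinity:
  fixes f :: "real \<Rightarrow> complex"
  assumes \<alpha>: "\<alpha> > 0" "\<alpha> + \<beta> > 1"
    and cont: "continuous_on UNIV f" and lac: "locally_absolutely_continuous_on (- {0}) f" and A1: "A1 f < \<infinity>"
    and bf: "(\<lambda>t. norm (f t)) \<in> O[at_infinity](\<lambda>t. \<bar>t\<bar> powr (- \<alpha>))"
    and bd: "ae_bigo_at_infinity (deriv_at f) (\<lambda>t. \<bar>t\<bar> powr (- \<beta>))"
  shows "\<exists>K. A_norm_le (\<lambda>t. f t * of_real (1 - cutoff (2 * \<bar>t\<bar>))) K"
proof -
  \<comment> \<open>Starting at \<open>1/2\<close>, the bumps telescope to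
    \<open>1 - cutoff (2 * \<bar>t\<bar>)\<close>, the complement of the cutoff used near the
    origin.\<close>
  define a where "a k = (2::real) ^ k / 2" for k :: nat
  have a: "a k > 0" for k by (simp add: a_def)
  obtain C T0 where C: "C > 0" "\<And>t. \<bar>t\<bar> \<ge> T0 \<Longrightarrow> norm (f t) \<le> C * \<bar>t\<bar> powr (- \<alpha>)"
  proof -
    obtain c where c: "c > 0" "\<forall>\<^sub>F t in at_infinity. norm (norm (f t)) \<le> c * norm (\<bar>t\<bar> powr (- \<alpha>))"
      using landau_o.bigE[OF bf] by blast
    obtain b where "\<And>t. b \<le> norm t \<Longrightarrow> norm (norm (f t)) \<le> c * norm (\<bar>t\<bar> powr (- \<alpha>))"
      using iffD1[OF eventually_at_infinity c(2)] by blast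
    then show ?thesis using c(1) by (intro that[of c b]) auto
  qed
  obtain C' T1 where C': "AE t in lebesgue. \<bar>t\<bar> \<ge> T1 \<longrightarrow> norm (deriv_at f t) \<le> C' * \<bar>t\<bar> powr (- \<beta>)"
    using bd unfolding ae_bigo_at_infinity_def by auto
  \<comment> \<open>On a bump the argument varies by a factor of \<open>4\<close>, so
    \<open>\<bar>t\<bar> powr (- \<beta>)\<close> exceeds its value at \<open>a k\<close> by a
    factor of at most \<open>4 powr \<bar>\<beta>\<bar>\<close>, for either sign of \<beta>.\<close>
  define E where "E = \<bar>C'\<bar> * 4 powr \<bar>\<beta>\<bar>"
  have E0: "E \<ge> 0" by (simp add: E_def)
  define s where "s = (\<alpha> + \<beta> - 1) / 2"
  have s: "s > 0" using \<alpha> by (simp add: s_def)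
  define B where "B k = 16 * (sqrt (4 * C * E) * a k powr (- s) + sqrt (8 * C\<^sup>2) * a k powr (- \<alpha>))" for k
  obtain k0 where k0: "max T0 T1 \<le> a k0"
  proof -
    obtain n where "2 * max T0 T1 < 2 ^ n" using real_arch_pow[of 2 "2 * max T0 T1"] by auto
    then show ?thesis using that[of n] by (simp add: a_def)
  qed
  have Bk: "A_norm_le (\<lambda>t. f t * of_real (bump (a k) \<bar>t\<bar>)) (B k)" if k: "k \<ge> k0" for k
  proof (rule A_norm_le_mono)
    have "a k0 \<le> a k" using k unfolding a_def by (intro divide_right_mono power_increasing) auto
    then have aT: "a k \<ge> T0" "a k \<ge> T1" using k0 by auto
    show "A_norm_le (\<lambda>t. f t * of_real (bump (a k) \<bar>t\<bar>))
      (16 * sqrt (4 * a k * (C * a k powr (- \<alpha>)) * (E * a k powr (- \<beta>) + 2 * (C * a k powr (- \<alpha>)) / a k)))"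
    proof (rule A_norm_le_bump[OF a])
      show "0 \<le> C * a k powr (- \<alpha>)" "0 \<le> E * a k powr (- \<beta>)" using C E0 by auto
      show "norm (f t) \<le> C * a k powr (- \<alpha>)" if t: "a k \<le> \<bar>t\<bar>" for t
      proof -
        have "norm (f t) \<le> C * \<bar>t\<bar> powr (- \<alpha>)" using C(2)[of t] t aT by simp
        also have "\<dots> \<le> C * a k powr (- \<alpha>)"
          using t a[of k] \<alpha> C(1) by (intro mult_left_mono powr_mono2') auto
        finally show ?thesis .
      qed
      have ae: "AE x in lebesgue. a k \<le> \<bar>x\<bar> \<and> \<bar>x\<bar> \<le> 4 * a k \<longrightarrow> norm (deriv_at f x) \<le> E * a k powr (- \<beta>)"
        using C'
      proof eventually_elim
        case (elim x)
        show ?case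
        proof (rule impI, elim conjE)
          assume x: "a k \<le> \<bar>x\<bar>" "\<bar>x\<bar> \<le> 4 * a k"
          have "\<bar>x\<bar> powr (- \<beta>) \<le> 4 powr \<bar>\<beta>\<bar> * a k powr (- \<beta>)"
          proof (cases "\<beta> \<ge> 0")
            case True
            have "\<bar>x\<bar> powr (- \<beta>) \<le> a k powr (- \<beta>)"
              using x a[of k] True by (intro powr_mono2') auto
            also have "\<dots> \<le> 4 powr \<bar>\<beta>\<bar> * a k powr (- \<beta>)"
              using ge_one_powr_ge_zero[of 4 "\<bar>\<beta>\<bar>"] by (simp add: mult_le_cancel_right1)
            finally show ?thesis .
          next
            case False
            have "\<bar>x\<bar> powr (- \<beta>) \<le> (4 * a k) powr (- \<beta>)"
              using x False by (intro powr_mono2) auto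
            also have "\<dots> = 4 powr \<bar>\<beta>\<bar> * a k powr (- \<beta>)"
              using False a[of k] by (simp add: powr_mult)
            finally show ?thesis .
          qed
          then have "C' * \<bar>x\<bar> powr (- \<beta>) \<le> \<bar>C'\<bar> * (4 powr \<bar>\<beta>\<bar> * a k powr (- \<beta>))"
            by (intro mult_mono) auto
          then show "norm (deriv_at f x) \<le> E * a k powr (- \<beta>)"
            using elim x aT by (simp add: E_def mult.assoc)
        qed
      qed
      show "norm (f s - f t) \<le> E * a k powr (- \<beta>) * \<bar>s - t\<bar>"
        if "(s \<in> {a k..4 * a k} \<and> t \<in> {a k..4 * a k}) \<or> (s \<in> {-(4 * a k)..-a k} \<and> t \<in> {-(4 * a k)..-a k})" for s t
        by (rule locally_absolutely_continuous_increment_bound[OF lac a _ ae that]) (use E0 in simp)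
    qed
    \<comment> \<open>Support length, bound and Lipschitz constant multiply to the exponent
      \<open>1 - \<alpha> - \<beta> = - 2 * s\<close>. The slope of the bump contributes a second
      term, with exponent \<open>- 2 * \<alpha>\<close>.\<close>
    have p1: "a k * a k powr (- \<alpha>) * a k powr (- \<beta>) = (a k powr (- s))\<^sup>2"
    proof -
      have "a k * a k powr (- \<alpha>) * a k powr (- \<beta>) = a k powr (1 + - \<alpha> + - \<beta>)"
        using a[of k] by (simp only: powr_add) simp
      also have "1 + - \<alpha> + - \<beta> = - s + - s" by (simp add: s_def field_simps)
      finally show ?thesis by (simp only: powr_add power2_eq_square)
    qed
    have "4 * a k * (C * a k powr (- \<alpha>)) * (E * a k powr (- \<beta>) + 2 * (C * a k powr (- \<alpha>)) / a k)
      = (4 * C * E) * (a k * a k powr (- \<alpha>) * a k powr (- \<beta>)) + (8 * C\<^sup>2) * (a k powr (- \<alpha>))\<^sup>2"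
      using a[of k] by (simp add: field_simps power2_eq_square)
    also have "sqrt \<dots> \<le> sqrt ((4 * C * E) * (a k powr (- s))\<^sup>2) + sqrt ((8 * C\<^sup>2) * (a k powr (- \<alpha>))\<^sup>2)"
      unfolding p1 using C E0 by (intro sqrt_add_le_add_sqrt) auto
    also have "\<dots> = sqrt (4 * C * E) * a k powr (- s) + sqrt (8 * C\<^sup>2) * a k powr (- \<alpha>)"
      by (simp only: real_sqrt_mult[of _ "_\<^sup>2"] real_sqrt_abs) simp
    finally show "16 * sqrt (4 * a k * (C * a k powr (- \<alpha>)) * (E * a k powr (- \<beta>) + 2 * (C * a k powr (- \<alpha>)) / a k)) \<le> B k"
      unfolding B_def by simp
  qed
  show ?thesis
  proof (rule A_norm_le_eventual_series[OF _ Bk])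
    show "summable B"
      unfolding B_def a_def by (intro summable_mult summable_add summable_dyadic_powr s \<alpha>)
    \<comment> \<open>A bound for every \<open>k\<close>, without decay: continuity bounds
      \<open>f\<close> on the compact support, and \<open>f1\<close> bounds its slope.\<close>
    show "\<exists>K. A_norm_le (\<lambda>t. f t * of_real (bump (a k) \<bar>t\<bar>)) K" for k
    proof -
      have "compact (f ` cbox (- (4 * a k)) (4 * a k))"
        using continuous_on_subset[OF cont] by (intro compact_continuous_image) auto
      then have "bounded (f ` cbox (- (4 * a k)) (4 * a k))" by (rule compact_imp_bounded)
      then obtain M where M: "\<And>t. t \<in> cbox (- (4 * a k)) (4 * a k) \<Longrightarrow> norm (f t) \<le> M"
        unfolding bounded_iff by blast
      have "0 \<le> M" using order_trans[OF norm_ge_zero M[of 0]] a[of k] by simp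
      moreover have "AE x in lebesgue. \<bar>x\<bar> \<ge> a k \<longrightarrow> norm (deriv_at f x) \<le> enn2real (f1 f (a k))"
        by (rule f1_AE[OF a f1_finite[OF A1 a]])
      then have "AE x in lebesgue. a k \<le> \<bar>x\<bar> \<and> \<bar>x\<bar> \<le> 4 * a k \<longrightarrow> norm (deriv_at f x) \<le> enn2real (f1 f (a k))"
        by eventually_elim auto
      from locally_absolutely_continuous_increment_bound[OF lac a _ this]
      have "A_norm_le (\<lambda>t. f t * of_real (bump (a k) \<bar>t\<bar>)) (16 * sqrt (4 * a k * M * (enn2real (f1 f (a k)) + 2 * M / a k)))"
        using \<open>0 \<le> M\<close> M by (intro A_norm_le_bump[OF a]) (auto simp: abs_le_iff)
      then show ?thesis ..
    qed
    fix t :: real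
    define u where "u k = cutoff (2 * \<bar>t\<bar> / 2 ^ k)" for k
    have bu: "bump (a k) \<bar>t\<bar> = u (Suc k) - u k" for k
      by (simp add: bump_def u_def a_def field_simps)
    have "u \<longlonglongrightarrow> 1"
    proof (rule tendsto_eventually)
      obtain n0 where n0: "2 * \<bar>t\<bar> < 2 ^ n0" using real_arch_pow[of 2 "2 * \<bar>t\<bar>"] by auto
      have "u n = 1" if "n \<ge> n0" for n
      proof -
        have "(2::real) ^ n0 \<le> 2 ^ n" using that by (intro power_increasing) auto
        then have "2 * \<bar>t\<bar> \<le> 2 ^ n" using n0 by linarith
        then show ?thesis unfolding u_def by (intro cutoff_eq_1) simp
      qed
      then show "\<forall>\<^sub>F n in sequentially. u n = 1" using eventually_sequentially by blast
    qed
    from telescope_sums[OF this] have "(\<lambda>k. bump (a k) \<bar>t\<bar>) sums (1 - cutoff (2 * \<bar>t\<bar>))"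
      unfolding bu by (simp add: u_def)
    then show "(\<lambda>k. f t * of_real (bump (a k) \<bar>t\<bar>)) sums (f t * of_real (1 - cutoff (2 * \<bar>t\<bar>)))"
      by (intro sums_mult sums_of_real)
  qed
qed

theorem admissible_imp_A_real:
  assumes "\<alpha> > 0" "\<alpha> + \<beta> > 1" "admissible \<alpha> \<beta> f"
  shows "f \<in> A_real"
proof -
  have f: "continuous_on UNIV f" "locally_absolutely_continuous_on (- {0}) f" "A1 f < \<infinity>"
     "(\<lambda>t. norm (f t)) \<in> O[at_infinity](\<lambda>t. \<bar>t\<bar> powr (- \<alpha>))"
     "ae_bigo_at_infinity (deriv_at f) (\<lambda>t. \<bar>t\<bar> powr (- \<beta>))"
    using assms(3) unfolding admissible_def C0_real_def by auto
  obtain K1 where K1: "A_norm_le (\<lambda>t. (f t - f 0) * of_real (cutoff (2 * \<bar>t\<bar>))) K1"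
    using A_norm_le_near_zero[OF f(1-3)] by blast
  obtain K2 where K2: "A_norm_le (\<lambda>t. f t * of_real (1 - cutoff (2 * \<bar>t\<bar>))) K2"
    using A_norm_le_at_infinity[OF assms(1,2) f] by blast
  have "(\<lambda>t. ((f t - f 0) * of_real (cutoff (2 * \<bar>t\<bar>)) + f t * of_real (1 - cutoff (2 * \<bar>t\<bar>)))
      + f 0 * of_real (cutoff (2 * \<bar>t\<bar>))) = f"
    by (simp add: algebra_simps)
  with A_norm_le_add[OF A_norm_le_add[OF K1 K2] A_norm_le_cmult[OF A_norm_le_cutoff, of "f 0"]]
  have "A_norm_le f (K1 + K2 + norm (f 0) * (8 * sqrt 2))" by (simp only:)
  then show ?thesis unfolding A_real_iff_A_norm_le by blast
qed

section \<open>Oscillatory integrals\<close>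

lemma has_vector_derivative_exp_i:
  assumes "(\<phi> has_real_derivative d) (at t within S)"
  shows "((\<lambda>t. exp (\<i> * complex_of_real (\<phi> t))) has_vector_derivative
    (\<i> * of_real d * exp (\<i> * of_real (\<phi> t)))) (at t within S)"
proof -
  have "((\<lambda>t. \<i> * complex_of_real (\<phi> t)) has_vector_derivative \<i> * of_real d) (at t within S)"
    using assms by (intro has_vector_derivative_mult_right has_vector_derivative_of_real)
      (simp add: has_real_derivative_iff_has_vector_derivative)
  from field_vector_diff_chain_within[OF this has_field_derivative_at_within[OF DERIV_exp]]
  show ?thesis by (simp add: o_def)
qed

text \<open>Integration by parts with the antiderivative \<open>exp (\<i> \<phi>) / (\<i> \<phi>')\<close>.\<close>

lemma oscillatory_integral_first_derivative:
  fixes \<phi> \<phi>' \<phi>'' :: "real \<Rightarrow> real"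
  assumes ab: "a \<le> b" and \<mu>: "\<mu> > 0"
    and d1: "\<And>t. t \<in> {a..b} \<Longrightarrow> (\<phi> has_real_derivative \<phi>' t) (at t within {a..b})"
    and d2: "\<And>t. t \<in> {a..b} \<Longrightarrow> (\<phi>' has_real_derivative \<phi>'' t) (at t within {a..b})"
    and pos: "\<And>t. t \<in> {a..b} \<Longrightarrow> \<phi>'' t \<ge> 0"
    and big: "\<And>t. t \<in> {a..b} \<Longrightarrow> \<bar>\<phi>' t\<bar> \<ge> \<mu>"
  shows "norm (integral {a..b} (\<lambda>t. exp (\<i> * of_real (\<phi> t)))) \<le> 4 / \<mu>"
proof -
  define e where "e t = exp (\<i> * complex_of_real (\<phi> t))" for t
  define G where "G t = e t * of_real (1 / \<phi>' t) / \<i>" for t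
  define r where "r t = e t * of_real (\<phi>'' t / (\<phi>' t)\<^sup>2) / \<i>" for t
  have ne: "norm (e t) = 1" for t by (simp add: e_def norm_exp_i_times)
  have nz: "\<phi>' t \<noteq> 0" if "t \<in> {a..b}" for t using big[OF that] \<mu> by auto
  have inv: "\<bar>1 / \<phi>' t\<bar> \<le> 1 / \<mu>" if "t \<in> {a..b}" for t
    using big[OF that] \<mu> by (simp add: abs_divide frac_le)
  have de: "(e has_vector_derivative (e t * (\<i> * of_real (\<phi>' t)))) (at t within {a..b})" if "t \<in> {a..b}" for t
    using has_vector_derivative_exp_i[OF d1[OF that]] unfolding e_def by (simp add: mult.commute)
  have di: "((\<lambda>t. 1 / \<phi>' t) has_real_derivative (- (\<phi>'' t / (\<phi>' t)\<^sup>2))) (at t within {a..b})" if "t \<in> {a..b}" for t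
    using DERIV_divide[OF DERIV_const d2[OF that] nz[OF that], of 1] by (simp add: power2_eq_square)
  have dG: "(G has_vector_derivative (e t - r t)) (at t within {a..b})" if "t \<in> {a..b}" for t
  proof -
    have "((\<lambda>t. complex_of_real (1 / \<phi>' t)) has_vector_derivative of_real (- (\<phi>'' t / (\<phi>' t)\<^sup>2))) (at t within {a..b})"
      using di[OF that] has_real_derivative_iff_has_vector_derivative has_vector_derivative_of_real by blast
    from has_vector_derivative_mult[OF de[OF that] this]
    have "((\<lambda>t. e t * of_real (1 / \<phi>' t) / \<i>) has_vector_derivative
      ((e t * of_real (- (\<phi>'' t / (\<phi>' t)\<^sup>2)) + e t * (\<i> * of_real (\<phi>' t)) * of_real (1 / \<phi>' t)) / \<i>)) (at t within {a..b})"
      by (rule has_vector_derivative_divide)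
    moreover have "(\<lambda>t. e t * of_real (1 / \<phi>' t) / \<i>) = G" unfolding G_def ..
    moreover have "(e t * of_real (- (\<phi>'' t / (\<phi>' t)\<^sup>2)) + e t * (\<i> * of_real (\<phi>' t)) * of_real (1 / \<phi>' t)) / \<i> = e t - r t"
      using nz[OF that] by (simp add: r_def field_simps)
    ultimately show ?thesis by simp
  qed
  have I1: "((\<lambda>t. e t - r t) has_integral (G b - G a)) {a..b}"
    by (rule fundamental_theorem_of_calculus[OF ab dG])
  have "continuous_on {a..b} e"
    using de has_vector_derivative_continuous continuous_on_eq_continuous_within by blast
  then have Ie: "e integrable_on {a..b}" by (rule integrable_continuous_interval)
  have "(\<lambda>t. e t - (e t - r t)) integrable_on {a..b}"
    by (rule Henstock_Kurzweil_Integration.integrable_diff[OF Ie has_integral_integrable[OF I1]])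
  then have Ir: "r integrable_on {a..b}" by simp
  \<comment> \<open>Because \<open>\<phi>''\<close> has a fixed sign, the remainder is dominated by
    an exact derivative, so its integral is a difference of boundary values and does not grow with
    the interval.\<close>
  have I2: "((\<lambda>t. \<phi>'' t / (\<phi>' t)\<^sup>2) has_integral (1 / \<phi>' a - 1 / \<phi>' b)) {a..b}"
  proof -
    have "((\<lambda>t. - (\<phi>'' t / (\<phi>' t)\<^sup>2)) has_integral (1 / \<phi>' b - 1 / \<phi>' a)) {a..b}"
      using di by (intro fundamental_theorem_of_calculus[OF ab]) (simp add: has_real_derivative_iff_has_vector_derivative)
    from has_integral_neg[OF this] show ?thesis by simp
  qed
  have "norm (integral {a..b} r) \<le> integral {a..b} (\<lambda>t. \<phi>'' t / (\<phi>' t)\<^sup>2)"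
    using I2 pos by (intro integral_norm_bound_integral Ir) (auto simp: r_def norm_mult norm_divide norm_power ne)
  also have "\<dots> = 1 / \<phi>' a - 1 / \<phi>' b" using I2 by (rule integral_unique)
  also have "\<dots> \<le> 1 / \<mu> + 1 / \<mu>" using inv[of a] inv[of b] ab unfolding abs_le_iff by force
  also have "\<dots> = 2 / \<mu>" by simp
  finally have r: "norm (integral {a..b} r) \<le> 2 / \<mu>" .
  have G: "norm (G t) \<le> 1 / \<mu>" if "t \<in> {a..b}" for t
    using inv[OF that] by (simp only: G_def norm_divide norm_mult ne norm_of_real norm_ii mult_1 div_by_1)
  have "integral {a..b} e = integral {a..b} (\<lambda>t. e t - r t) + integral {a..b} r"
    using integral_diff[OF Ie Ir] by simp
  also have "\<dots> = G b - G a + integral {a..b} r" using integral_unique[OF I1] by simp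
  also have "norm \<dots> \<le> norm (G b) + norm (G a) + norm (integral {a..b} r)"
    by (intro order_trans[OF norm_triangle_ineq] add_right_mono norm_triangle_ineq4)
  also have "\<dots> \<le> 4 / \<mu>" using G[of a] G[of b] r ab by simp
  finally show ?thesis unfolding e_def .
qed

text \<open>As \<open>\<phi>'\<close> grows at rate at least \<rho>, it has modulus at least
  \<open>sqrt \<rho>\<close> farther than \<open>1 / sqrt \<rho>\<close> from its sign change. The
  two outer parts cost \<open>4 / sqrt \<rho>\<close> each by
  \<open>oscillatory_integral_first_derivative\<close>, the middle one its length, at most
  \<open>2 / sqrt \<rho>\<close>.\<close>

lemma van_der_Corput:
  fixes \<phi> \<phi>' \<phi>'' :: "real \<Rightarrow> real"
  assumes ab: "a \<le> b" and \<rho>: "\<rho> > 0"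
    and d1: "\<And>t. t \<in> {a..b} \<Longrightarrow> (\<phi> has_real_derivative \<phi>' t) (at t within {a..b})"
    and d2: "\<And>t. t \<in> {a..b} \<Longrightarrow> (\<phi>' has_real_derivative \<phi>'' t) (at t within {a..b})"
    and big: "\<And>t. t \<in> {a..b} \<Longrightarrow> \<phi>'' t \<ge> \<rho>"
  shows "norm (integral {a..b} (\<lambda>t. exp (\<i> * of_real (\<phi> t)))) \<le> 10 / sqrt \<rho>"
proof -
  define e where "e t = exp (\<i> * complex_of_real (\<phi> t))" for t
  define \<delta> where "\<delta> = 1 / sqrt \<rho>"
  have \<delta>: "\<delta> > 0" "\<rho> * \<delta> = sqrt \<rho>" using \<rho> by (auto simp: \<delta>_def real_div_sqrt)
  have c\<phi>: "continuous_on {a..b} \<phi>" "continuous_on {a..b} \<phi>'"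
    using d1 d2 by (meson DERIV_continuous_on)+
  have ce: "continuous_on {a..b} e" unfolding e_def by (intro continuous_intros c\<phi>)
  have ie: "e integrable_on {u..v}" if "{u..v} \<subseteq> {a..b}" for u v
    using continuous_on_subset[OF ce that] by (rule integrable_continuous_interval)
  have mono: "\<phi>' v - \<phi>' u \<ge> \<rho> * (v - u)" if uv: "u \<in> {a..b}" "v \<in> {a..b}" "u \<le> v" for u v
  proof -
    show ?thesis
    proof (cases "u < v")
      case True
      have "\<exists>x\<in>{u<..<v}. \<phi>' v - \<phi>' u = (\<lambda>h. \<phi>'' x * h) (v - u)"
      proof (rule mvt_simple[OF True])
        fix x assume "u \<le> x" "x \<le> v"
        then have "(\<phi>' has_real_derivative \<phi>'' x) (at x within {u..v})"
          using uv d2[of x] by (auto intro: DERIV_subset)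
        then show "(\<phi>' has_derivative (\<lambda>h. \<phi>'' x * h)) (at x within {u..v})"
          by (simp add: has_field_derivative_def)
      qed
      then obtain x where "x \<in> {u<..<v}" "\<phi>' v - \<phi>' u = \<phi>'' x * (v - u)" by auto
      then show ?thesis using big[of x] uv by (simp add: mult_right_mono)
    qed (use uv in simp)
  qed
  \<comment> \<open>A zero of \<open>\<phi>'\<close> or, if it has constant sign, the end point
    where it is closest to zero; the disjunctions record its sign at \<open>c\<close> for whichever
    side of \<open>c\<close> is present.\<close>
  obtain c where c: "c \<in> {a..b}" "c = a \<or> \<phi>' c \<le> 0" "c = b \<or> \<phi>' c \<ge> 0"
  proof -
    consider "\<phi>' a \<ge> 0" | "\<phi>' b \<le> 0" | "\<phi>' a \<le> 0" "\<phi>' b \<ge> 0" by linarith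
    then show ?thesis
    proof cases
      case 3
      then obtain x where "a \<le> x" "x \<le> b" "\<phi>' x = 0" using IVT'[of \<phi>' a 0 b] ab c\<phi> by auto
      then show ?thesis by (intro that[of x]) auto
    qed (use ab in \<open>auto intro: that[of a] that[of b]\<close>)
  qed
  define p where "p = max a (c - \<delta>)"
  define q where "q = min b (c + \<delta>)"
  have pq: "a \<le> p" "p \<le> q" "q \<le> b" "q - p \<le> 2 * \<delta>" using c(1) \<delta>(1) by (auto simp: p_def q_def)
  have part: "norm (integral {u..v} e) \<le> 4 / sqrt \<rho>"
    if uv: "u \<le> v" "{u..v} \<subseteq> {a..b}" and far: "\<And>t. t \<in> {u..v} \<Longrightarrow> \<bar>\<phi>' t\<bar> \<ge> sqrt \<rho>" for u v
    unfolding e_def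
  proof (rule oscillatory_integral_first_derivative[OF uv(1) _ _ _ _ far])
    show "(\<phi> has_real_derivative \<phi>' t) (at t within {u..v})" "(\<phi>' has_real_derivative \<phi>'' t) (at t within {u..v})"
      "0 \<le> \<phi>'' t" if "t \<in> {u..v}" for t
      using that uv d1[of t] d2[of t] big[of t] \<rho> by (auto intro: DERIV_subset)
  qed (use \<rho> in auto)
  have left: "norm (integral {a..p} e) \<le> 4 / sqrt \<rho>"
  proof (cases "c - \<delta> \<le> a")
    case True
    then show ?thesis using \<rho> by (simp add: p_def)
  next
    case False
    show ?thesis
    proof (rule part[OF pq(1)])
      fix t assume t: "t \<in> {a..p}"
      have "\<rho> * \<delta> \<le> \<rho> * (c - t)" using t False \<rho> by (intro mult_left_mono) (auto simp: p_def)
      also have "\<dots> \<le> \<phi>' c - \<phi>' t" using t c(1) \<delta>(1) False by (intro mono) (auto simp: p_def)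
      finally show "sqrt \<rho> \<le> \<bar>\<phi>' t\<bar>" using c(2) False \<delta> by auto
    qed (use pq in auto)
  qed
  have right: "norm (integral {q..b} e) \<le> 4 / sqrt \<rho>"
  proof (cases "c + \<delta> \<ge> b")
    case True
    then show ?thesis using \<rho> by (simp add: q_def)
  next
    case False
    show ?thesis
    proof (rule part[OF pq(3)])
      fix t assume t: "t \<in> {q..b}"
      have "\<rho> * \<delta> \<le> \<rho> * (t - c)" using t False \<rho> by (intro mult_left_mono) (auto simp: q_def)
      also have "\<dots> \<le> \<phi>' t - \<phi>' c" using t c(1) \<delta>(1) False by (intro mono) (auto simp: q_def)
      finally show "sqrt \<rho> \<le> \<bar>\<phi>' t\<bar>" using c(3) False \<delta> by auto
    qed (use pq in auto)
  qed
  have "norm (integral {p..q} e) \<le> 1 * (q - p)"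
    using pq by (intro integral_bound continuous_on_subset[OF ce]) (auto simp: e_def norm_exp_i_times)
  also have "\<dots> \<le> 2 / sqrt \<rho>" using pq by (simp add: \<delta>_def)
  finally have mid: "norm (integral {p..q} e) \<le> 2 / sqrt \<rho>" .
  have "integral {a..b} e = integral {a..p} e + integral {p..q} e + integral {q..b} e"
    using Henstock_Kurzweil_Integration.integral_combine[of a p b e] Henstock_Kurzweil_Integration.integral_combine[of p q b e]
      pq ie[of a b] ie[of p b] by (simp add: add.assoc)
  also have "norm \<dots> \<le> norm (integral {a..p} e) + norm (integral {p..q} e) + norm (integral {q..b} e)"
    by (intro order_trans[OF norm_triangle_ineq] add_right_mono norm_triangle_ineq)
  also have "\<dots> \<le> 4 / sqrt \<rho> + 2 / sqrt \<rho> + 4 / sqrt \<rho>" using left mid right by linarith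
  also have "\<dots> = 10 / sqrt \<rho>" by (simp add: field_simps)
  finally show ?thesis unfolding e_def .
qed

text \<open>Fubini moves the transform from \<open>g\<close> to \<open>W\<close>: the pairing is the
  integral of \<open>g\<close> against the transform of \<open>W\<close>, which is bounded uniformly
  by \<open>C\<close>.\<close>

lemma transform_pairing_bound:
  fixes g W :: "real \<Rightarrow> complex"
  assumes g: "integrable lborel g" and W: "integrable lborel W"
    and bd: "\<And>x. norm (LINT t|lborel. W t * exp (\<i> * of_real (x * t))) \<le> C"
  shows "norm (LINT t|lborel. W t * (LINT x|lborel. g x * exp (\<i> * of_real (x * t)))) \<le> C * (LINT x|lborel. norm (g x))"
proof -
  let ?e = "\<lambda>x t. exp (\<i> * complex_of_real (x * t))"
  let ?H = "\<lambda>x t. g x * W t * ?e x t"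
  have [measurable]: "g \<in> borel_measurable borel" "W \<in> borel_measurable borel" using g W by auto
  have ne: "norm (?e x t) = 1" for x t by (simp add: norm_exp_i_times del: of_real_mult)
  have nH: "norm (?H x t) = norm (g x) * norm (W t)" for x t by (simp only: norm_mult ne mult_1_right)
  have iW: "integrable lborel (\<lambda>t. W t * ?e x t)" for x
    by (rule Bochner_Integration.integrable_bound[OF W]) (auto simp: norm_mult ne simp del: of_real_mult)
  have int: "integrable (lborel \<Otimes>\<^sub>M lborel) (\<lambda>(x, t). ?H x t)"
  proof (rule lborel_pair.Fubini_integrable)
    show "(\<lambda>(x, t). ?H x t) \<in> borel_measurable (lborel \<Otimes>\<^sub>M lborel)" by measurable
    show "integrable lborel (\<lambda>x. LINT t|lborel. norm (case (x, t) of (x, t) \<Rightarrow> ?H x t))"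
      using g by (simp only: prod.case nH) simp
    show "AE x in lborel. integrable lborel (\<lambda>t. case (x, t) of (x, t) \<Rightarrow> ?H x t)"
      using iW by (simp add: mult.assoc del: of_real_mult)
  qed
  have "(LINT t|lborel. W t * (LINT x|lborel. g x * ?e x t)) = (LINT t|lborel. LINT x|lborel. ?H x t)"
    by (simp add: mult_ac flip: integral_mult_right_zero del: of_real_mult)
  also have "\<dots> = (LINT x|lborel. LINT t|lborel. ?H x t)"
    by (rule lborel_pair.Fubini_integral[OF int])
  also have "\<dots> = (LINT x|lborel. g x * (LINT t|lborel. W t * ?e x t))"
    by (simp add: mult_ac flip: integral_mult_right_zero del: of_real_mult)
  finally have eq: "(LINT t|lborel. W t * (LINT x|lborel. g x * ?e x t)) = (LINT x|lborel. g x * (LINT t|lborel. W t * ?e x t))" .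
  have m: "(\<lambda>x. LINT t|lborel. W t * ?e x t) \<in> borel_measurable lborel" by measurable
  have b: "norm (g x * (LINT t|lborel. W t * ?e x t)) \<le> norm (g x) * C" for x
    unfolding norm_mult by (rule mult_left_mono[OF bd norm_ge_zero])
  have "norm (LINT x|lborel. g x * (LINT t|lborel. W t * ?e x t)) \<le> (LINT x|lborel. norm (g x) * C)"
  proof (rule Bochner_Integration.integral_norm_bound_integral)
    show "integrable lborel (\<lambda>x. norm (g x) * C)" using g by simp
    show "integrable lborel (\<lambda>x. g x * (LINT t|lborel. W t * ?e x t))"
    proof (rule Bochner_Integration.integrable_bound[OF \<open>integrable lborel (\<lambda>x. norm (g x) * C)\<close>])
      show "AE x in lborel. norm (g x * (LINT t|lborel. W t * ?e x t)) \<le> norm (norm (g x) * C)"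
        using b by (intro AE_I2) (metis abs_ge_self order_trans real_norm_def)
    qed (use m in measurable)
  qed (rule b)
  then show ?thesis unfolding eq by (simp add: mult.commute)
qed

section \<open>The chirp and its pairing with characters\<close>

definition chirp :: "real \<Rightarrow> real \<Rightarrow> real \<Rightarrow> complex" where
  "chirp \<alpha> \<gamma> t = of_real (t powr (- \<alpha>)) * exp (\<i> * of_real (t powr \<gamma>))"

definition chirp_deriv :: "real \<Rightarrow> real \<Rightarrow> real \<Rightarrow> complex" where
  "chirp_deriv \<alpha> \<gamma> t = (of_real (- \<alpha> * t powr (- \<alpha> - 1)) + \<i> * of_real (\<gamma> * t powr (\<gamma> - 1 - \<alpha>)))
     * exp (\<i> * of_real (t powr \<gamma>))"

text \<open>The arguments are clamped so that the Lipschitz estimate needs no case distinction.\<close>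

definition chirp_ext :: "real \<Rightarrow> real \<Rightarrow> real \<Rightarrow> complex" where
  "chirp_ext \<alpha> \<gamma> t = of_real (max 0 (min 1 t) - 1) * exp \<i> + chirp \<alpha> \<gamma> (max 1 t)"

lemma chirp_one: "chirp \<alpha> \<gamma> 1 = exp \<i>"
  by (simp add: chirp_def)

lemma chirp_ext_simps:
  "t \<le> 0 \<Longrightarrow> chirp_ext \<alpha> \<gamma> t = 0"
  "0 \<le> t \<Longrightarrow> t \<le> 1 \<Longrightarrow> chirp_ext \<alpha> \<gamma> t = of_real t * exp \<i>"
  "1 \<le> t \<Longrightarrow> chirp_ext \<alpha> \<gamma> t = chirp \<alpha> \<gamma> t"
  by (auto simp: chirp_ext_def chirp_one algebra_simps)

lemma has_vector_derivative_chirp: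
  assumes "t > 0"
  shows "(chirp \<alpha> \<gamma> has_vector_derivative chirp_deriv \<alpha> \<gamma> t) (at t within S)"
proof -
  have 1: "((\<lambda>t. complex_of_real (t powr (- \<alpha>))) has_vector_derivative of_real (- \<alpha> * t powr (- \<alpha> - 1))) (at t within S)"
    using assms by (intro has_vector_derivative_of_real)
      (auto intro!: derivative_eq_intros simp flip: has_real_derivative_iff_has_vector_derivative)
  have 2: "((\<lambda>t. exp (\<i> * complex_of_real (t powr \<gamma>))) has_vector_derivative
      \<i> * of_real (\<gamma> * t powr (\<gamma> - 1)) * exp (\<i> * of_real (t powr \<gamma>))) (at t within S)"
    using assms by (intro has_vector_derivative_exp_i) (auto intro!: derivative_eq_intros)
  have 3: "t powr (- \<alpha>) * (\<gamma> * t powr (\<gamma> - 1)) = \<gamma> * t powr (\<gamma> - 1 - \<alpha>)"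
    by (simp add: algebra_simps flip: powr_add)
  have "complex_of_real (t powr (- \<alpha>)) * (\<i> * of_real (\<gamma> * t powr (\<gamma> - 1)) * exp (\<i> * of_real (t powr \<gamma>)))
      + of_real (- \<alpha> * t powr (- \<alpha> - 1)) * exp (\<i> * of_real (t powr \<gamma>)) = chirp_deriv \<alpha> \<gamma> t"
    unfolding chirp_deriv_def 3[symmetric] by (simp add: algebra_simps)
  then show ?thesis
    using has_vector_derivative_mult[OF 1 2] unfolding chirp_def [abs_def] by simp
qed

lemma norm_chirp: "norm (chirp \<alpha> \<gamma> t) = t powr (- \<alpha>)"
  by (simp add: chirp_def norm_mult norm_exp_i_times)

text \<open>The orders \<open>- \<alpha> - 1\<close> and \<open>\<gamma> - 1 - \<alpha>\<close> come
  from differentiating the amplitude and the phase. The case \<beta> = 0 gives the Lipschitz bound,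
  the general one the required decay.\<close>

lemma norm_chirp_deriv_le:
  assumes "t \<ge> 1" "\<alpha> \<ge> 0" "\<gamma> \<ge> 0" "\<gamma> - 1 - \<alpha> \<le> - \<beta>" "- \<alpha> - 1 \<le> - \<beta>"
  shows "norm (chirp_deriv \<alpha> \<gamma> t) \<le> (\<alpha> + \<gamma>) * t powr (- \<beta>)"
proof -
  have "norm (chirp_deriv \<alpha> \<gamma> t) \<le> \<alpha> * t powr (- \<alpha> - 1) + \<gamma> * t powr (\<gamma> - 1 - \<alpha>)"
    unfolding chirp_deriv_def norm_mult norm_exp_i_times mult_1_right
    by (rule order_trans[OF norm_triangle_ineq]) (use assms in \<open>simp add: norm_mult\<close>)
  also have "\<dots> \<le> \<alpha> * t powr (- \<beta>) + \<gamma> * t powr (- \<beta>)"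
    using assms by (intro add_mono mult_left_mono powr_mono) auto
  finally show ?thesis by (simp add: algebra_simps)
qed

lemma powr_integral_lower_bound:
  fixes \<alpha> R :: real
  assumes "\<alpha> \<ge> 0" "R \<ge> 1"
  shows "integral {1..R} (\<lambda>t. t powr (- \<alpha>)) \<ge> (R - 1) * R powr (- \<alpha>)"
proof -
  have "((\<lambda>t. R powr (- \<alpha>)) has_integral (R - 1) * R powr (- \<alpha>)) {1..R}"
    using has_integral_const_real[of "R powr (- \<alpha>)" 1 R] assms by simp
  moreover have "(\<lambda>t. t powr (- \<alpha>)) integrable_on {1..R}"
    by (intro integrable_continuous_interval continuous_intros) auto
  ultimately show ?thesis
    using assms by (intro has_integral_le[OF _ integrable_integral]) (auto intro!: powr_mono2')
qed

lemma inverse_integral: "R \<ge> 1 \<Longrightarrow> integral {1..R} (\<lambda>t. t powr (- 1)) = ln R" for R :: real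
proof (rule integral_unique)
  assume R: "R \<ge> 1"
  have "((\<lambda>t. t powr (- 1)) has_integral (ln R - ln 1)) {1..R}"
    using R by (intro fundamental_theorem_of_calculus)
      (auto intro!: derivative_eq_intros simp: powr_minus_divide simp flip: has_real_derivative_iff_has_vector_derivative)
  then show "((\<lambda>t. t powr (- 1)) has_integral ln R) {1..R}" by simp
qed

text \<open>The linear term \<open>x * t\<close> does not affect the second derivative of the phase,
  so the bound is uniform in \<open>x\<close>. For \<gamma> \<le> 2 the modulus
  \<open>\<gamma> * \<bar>\<gamma> - 1\<bar> * t powr (\<gamma> - 2)\<close> is smallest at
  \<open>R\<close>. The sign \<sigma> makes the phase convex; for \<gamma> > 1 this conjugates the
  exponential, which leaves the norm of the integral unchanged.\<close>

lemma chirp_character_integral_bound: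
  assumes \<gamma>: "\<gamma> > 0" "\<gamma> \<noteq> 1" "\<gamma> \<le> 2" and R: "R \<ge> 1"
  shows "norm (integral {1..R} (\<lambda>t. exp (\<i> * of_real (x * t - t powr \<gamma>)))) \<le> 10 / sqrt (\<gamma> * \<bar>\<gamma> - 1\<bar> * R powr (\<gamma> - 2))"
proof -
  define \<sigma> where "\<sigma> = sgn (\<gamma> - 1)"
  define \<phi> where "\<phi> t = \<sigma> * (t powr \<gamma> - x * t)" for t
  have \<sigma>: "\<sigma> = 1 \<or> \<sigma> = -1" "\<sigma> * (\<gamma> - 1) = \<bar>\<gamma> - 1\<bar>" using \<gamma> by (auto simp: \<sigma>_def sgn_if)
  have "norm (integral {1..R} (\<lambda>t. exp (\<i> * of_real (\<phi> t)))) \<le> 10 / sqrt (\<gamma> * \<bar>\<gamma> - 1\<bar> * R powr (\<gamma> - 2))"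
  proof (rule van_der_Corput[OF R])
    show "0 < \<gamma> * \<bar>\<gamma> - 1\<bar> * R powr (\<gamma> - 2)" using \<gamma> R by simp
    fix t assume t: "t \<in> {1..R}"
    then have t0: "t > 0" by simp
    show "(\<phi> has_real_derivative (\<sigma> * (\<gamma> * t powr (\<gamma> - 1) - x))) (at t within {1..R})"
      unfolding \<phi>_def using t0 by (auto intro!: derivative_eq_intros)
    show "((\<lambda>t. \<sigma> * (\<gamma> * t powr (\<gamma> - 1) - x)) has_real_derivative (\<sigma> * (\<gamma> * ((\<gamma> - 1) * t powr (\<gamma> - 2))))) (at t within {1..R})"
      using t0 by (auto intro!: derivative_eq_intros)
    have "R powr (\<gamma> - 2) \<le> t powr (\<gamma> - 2)" using t t0 \<gamma> by (intro powr_mono2') auto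
    then have "\<gamma> * \<bar>\<gamma> - 1\<bar> * R powr (\<gamma> - 2) \<le> \<gamma> * \<bar>\<gamma> - 1\<bar> * t powr (\<gamma> - 2)" using \<gamma> by (intro mult_left_mono) auto
    then show "\<gamma> * \<bar>\<gamma> - 1\<bar> * R powr (\<gamma> - 2) \<le> \<sigma> * (\<gamma> * ((\<gamma> - 1) * t powr (\<gamma> - 2)))"
      unfolding \<sigma>(2)[symmetric] by (simp add: mult_ac)
  qed
  moreover have "norm (integral {1..R} (\<lambda>t. exp (\<i> * of_real (x * t - t powr \<gamma>)))) = norm (integral {1..R} (\<lambda>t. exp (\<i> * of_real (\<phi> t))))"
    using \<sigma>(1)
  proof
    assume "\<sigma> = 1"
    then have "exp (\<i> * of_real (x * t - t powr \<gamma>)) = cnj (exp (\<i> * of_real (\<phi> t)))" for t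
      by (simp add: \<phi>_def exp_cnj algebra_simps)
    then show ?thesis by (simp only: integral_cnj[symmetric] complex_mod_cnj)
  next
    assume "\<sigma> = -1"
    then show ?thesis by (simp add: \<phi>_def)
  qed
  ultimately show ?thesis by simp
qed

section \<open>The counterexample\<close>

lemma chirp_ext_not_A_real:
  assumes \<gamma>: "\<gamma> > 0" "\<gamma> \<noteq> 1" "\<gamma> \<le> 2" and \<alpha>: "\<alpha> > 0" and slow: "(\<alpha> < 1 \<and> 2 * \<alpha> < \<gamma>) \<or> (\<alpha> = 1 \<and> \<gamma> = 2)"
  shows "chirp_ext \<alpha> \<gamma> \<notin> A_real"
proof
  assume "chirp_ext \<alpha> \<gamma> \<in> A_real"
  then obtain g :: "real \<Rightarrow> complex" where g: "integrable lborel g"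
    "\<And>y. chirp_ext \<alpha> \<gamma> y = (LINT x|lborel. g x * exp (\<i> * complex_of_real (x * y)))"
    unfolding A_real_def by blast
  define N where "N = (LINT x|lborel. norm (g x))"
  define k where "k = \<gamma> * \<bar>\<gamma> - 1\<bar>"
  have k: "k > 0" using \<gamma> by (simp add: k_def)
  have bound: "integral {1..R} (\<lambda>t. t powr (- \<alpha>)) \<le> 10 / sqrt k * N * R powr (1 - \<gamma> / 2)" if R: "R \<ge> 1" for R
  proof -
    \<comment> \<open>The conjugate oscillation, cut off to \<open>[1, R]\<close>: multiplied by the
      chirp it leaves the positive amplitude \<open>t powr (- \<alpha>)\<close>.\<close>
    define W where "W t = indicator {1..R} t *\<^sub>R exp (- (\<i> * complex_of_real (t powr \<gamma>)))" for t
    have cont: "continuous_on {1..R} (\<lambda>t. exp (- (\<i> * complex_of_real (t powr \<gamma>))))"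
      by (intro continuous_intros) auto
    have sW: "set_integrable lborel {1..R} (\<lambda>t. exp (- (\<i> * complex_of_real (t powr \<gamma>))) * h t)"
      if "continuous_on {1..R} h" for h :: "real \<Rightarrow> complex"
      using that cont by (intro borel_integrable_atLeastAtMost' continuous_on_mult) auto
    have iW: "integrable lborel W"
      using sW[of "\<lambda>_. 1"] unfolding W_def set_integrable_def by simp
    have Wi: "(LINT t|lborel. W t * h t) = integral {1..R} (\<lambda>t. exp (- (\<i> * complex_of_real (t powr \<gamma>))) * h t)"
      if "continuous_on {1..R} h" for h :: "real \<Rightarrow> complex"
      using set_borel_integral_eq_integral(2)[OF sW[OF that]] unfolding W_def set_lebesgue_integral_def by simp
    have "norm (LINT t|lborel. W t * (LINT x|lborel. g x * exp (\<i> * of_real (x * t)))) \<le> 10 / sqrt (k * R powr (\<gamma> - 2)) * (LINT x|lborel. norm (g x))"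
    proof (rule transform_pairing_bound[OF g(1) iW])
      fix x
      have "(LINT t|lborel. W t * exp (\<i> * of_real (x * t))) = integral {1..R} (\<lambda>t. exp (- (\<i> * complex_of_real (t powr \<gamma>))) * exp (\<i> * of_real (x * t)))"
        by (intro Wi continuous_intros)
      also have "\<dots> = integral {1..R} (\<lambda>t. exp (\<i> * of_real (x * t - t powr \<gamma>)))"
        by (simp add: exp_add[symmetric] algebra_simps)
      finally show "norm (LINT t|lborel. W t * exp (\<i> * of_real (x * t))) \<le> 10 / sqrt (k * R powr (\<gamma> - 2))"
        using chirp_character_integral_bound[OF \<gamma> R, of x] by (simp add: k_def)
    qed
    also have "(LINT t|lborel. W t * (LINT x|lborel. g x * exp (\<i> * of_real (x * t)))) = (LINT t|lborel. W t * complex_of_real (t powr (- \<alpha>) * indicator {1..R} t) * exp (\<i> * complex_of_real (t powr \<gamma>)))"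
      unfolding g(2)[symmetric]
      by (intro Bochner_Integration.integral_cong refl) (auto simp: W_def chirp_ext_simps chirp_def indicator_def)
    also have "\<dots> = (LINT t|lborel. W t * (complex_of_real (t powr (- \<alpha>)) * exp (\<i> * complex_of_real (t powr \<gamma>))))"
      by (intro Bochner_Integration.integral_cong refl) (auto simp: W_def indicator_def)
    also have "\<dots> = integral {1..R} (\<lambda>t. exp (- (\<i> * complex_of_real (t powr \<gamma>))) * (complex_of_real (t powr (- \<alpha>)) * exp (\<i> * complex_of_real (t powr \<gamma>))))"
      by (intro Wi continuous_intros) auto
    also have "\<dots> = integral {1..R} (\<lambda>t. complex_of_real (t powr (- \<alpha>)))"
      by (simp add: exp_minus field_simps)
    also have "\<dots> = complex_of_real (integral {1..R} (\<lambda>t. t powr (- \<alpha>)))"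
    proof -
      have "(\<lambda>t. t powr (- \<alpha>)) integrable_on {1..R}"
        by (intro integrable_continuous_interval continuous_intros) auto
      from has_integral_linear[OF integrable_integral[OF this] bounded_linear_of_real]
      show ?thesis by (intro integral_unique) (simp add: o_def)
    qed
    finally have "integral {1..R} (\<lambda>t. t powr (- \<alpha>)) \<le> 10 / sqrt (k * R powr (\<gamma> - 2)) * N"
      unfolding N_def by simp
    also have "10 / sqrt (k * R powr (\<gamma> - 2)) = 10 / sqrt k * R powr (1 - \<gamma> / 2)"
    proof -
      have "sqrt (R powr (\<gamma> - 2)) = R powr ((\<gamma> - 2) / 2)"
        using R by (simp add: powr_half_sqrt[symmetric] powr_powr)
      moreover have "R powr (1 - \<gamma> / 2) = 1 / R powr ((\<gamma> - 2) / 2)"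
      proof -
        have "1 - \<gamma> / 2 = - ((\<gamma> - 2) / 2)" by (simp add: field_simps)
        then show ?thesis by (simp only: powr_minus_divide)
      qed
      ultimately show ?thesis by (simp add: real_sqrt_mult)
    qed
    finally show ?thesis by (simp add: mult_ac)
  qed
  define K where "K = 10 / sqrt k * N"
  show False
    using slow
  proof
    assume a: "\<alpha> < 1 \<and> 2 * \<alpha> < \<gamma>"
    \<comment> \<open>A lower bound of order \<open>R powr (1 - \<alpha>)\<close> meets the upper
      bound \<open>K * R powr (1 - \<gamma> / 2)\<close>; \<open>R \<ge> 2\<close> allows
      \<open>R - 1\<close> to be replaced by \<open>R / 2\<close>.\<close>
    have le: "R powr (\<gamma> / 2 - \<alpha>) \<le> 2 * K" if R: "R \<ge> 2" for R
    proof -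
      have "(R / 2) * R powr (- \<alpha>) \<le> (R - 1) * R powr (- \<alpha>)" using R by (intro mult_right_mono) auto
      also have "\<dots> \<le> integral {1..R} (\<lambda>t. t powr (- \<alpha>))" using \<alpha> R by (intro powr_integral_lower_bound) auto
      also have "\<dots> \<le> K * R powr (1 - \<gamma> / 2)" using bound[of R] R by (simp add: K_def)
      finally have "(R / 2) * R powr (- \<alpha>) * R powr (\<gamma> / 2 - 1) \<le> K * R powr (1 - \<gamma> / 2) * R powr (\<gamma> / 2 - 1)"
        by (intro mult_right_mono) auto
      moreover have "R * R powr (- \<alpha>) * R powr (\<gamma> / 2 - 1) = R powr (\<gamma> / 2 - \<alpha>)"
      proof -
        have "R * R powr (- \<alpha>) * R powr (\<gamma> / 2 - 1) = R powr (1 + - \<alpha> + (\<gamma> / 2 - 1))"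
          using R by (simp only: powr_add) simp
        then show ?thesis by (simp add: algebra_simps)
      qed
      moreover have "R powr (1 - \<gamma> / 2) * R powr (\<gamma> / 2 - 1) = 1"
        using R by (simp flip: powr_add)
      ultimately show ?thesis by (simp add: mult.assoc)
    qed
    define s where "s = \<gamma> / 2 - \<alpha>"
    have s: "s > 0" using a by (simp add: s_def)
    define R where "R = max 2 ((2 * \<bar>K\<bar> + 1) powr (1 / s))"
    have "2 * \<bar>K\<bar> + 1 = ((2 * \<bar>K\<bar> + 1) powr (1 / s)) powr s" using s by (simp add: powr_powr)
    also have "\<dots> \<le> R powr s" using s by (intro powr_mono2) (auto simp: R_def)
    also have "\<dots> \<le> 2 * K" using le[of R] by (simp add: R_def s_def)
    finally show False by linarith
  next
    \<comment> \<open>Here the bound contains \<open>R powr 0\<close>, so it is constant while the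
      integral is \<open>ln R\<close>.\<close>
    assume a: "\<alpha> = 1 \<and> \<gamma> = 2"
    have "ln R \<le> K" if "R \<ge> 1" for R
      using bound[OF that] inverse_integral[OF that] a that by (simp add: K_def)
    from this[of "exp (\<bar>K\<bar> + 1)"] show False by simp
  qed
qed

section \<open>Admissibility of the counterexample\<close>

text \<open>The condition \<gamma> \<le> 1 + \<alpha> bounds the derivative of the chirp on the
  half-line from \<open>1\<close>; the linear ramp adds the constant \<open>1\<close>, and both
  clamps are contractions.\<close>

lemma chirp_ext_lipschitz:
  assumes "\<alpha> \<ge> 0" "\<gamma> \<ge> 0" "\<gamma> \<le> 1 + \<alpha>"
  shows "norm (chirp_ext \<alpha> \<gamma> s - chirp_ext \<alpha> \<gamma> t) \<le> (1 + \<alpha> + \<gamma>) * \<bar>s - t\<bar>"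
proof -
  have "norm (chirp \<alpha> \<gamma> (max 1 s) - chirp \<alpha> \<gamma> (max 1 t)) \<le> (\<alpha> + \<gamma>) * norm (max 1 s - max 1 t)"
  proof (rule differentiable_bound[of "{1..}" _ "\<lambda>t h. h *\<^sub>R chirp_deriv \<alpha> \<gamma> t"])
    show "(chirp \<alpha> \<gamma> has_derivative (\<lambda>h. h *\<^sub>R chirp_deriv \<alpha> \<gamma> x)) (at x within {1..})" if "x \<in> {1..}" for x
      using has_vector_derivative_chirp[of x] that by (simp add: has_vector_derivative_def)
    show "onorm (\<lambda>h. h *\<^sub>R chirp_deriv \<alpha> \<gamma> x) \<le> \<alpha> + \<gamma>" if x: "x \<in> {1..}" for x
    proof (rule onorm_le)
      fix h :: real
      have "norm (chirp_deriv \<alpha> \<gamma> x) \<le> \<alpha> + \<gamma>"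
        using norm_chirp_deriv_le[of x \<alpha> \<gamma> 0] assms x by simp
      then show "norm (h *\<^sub>R chirp_deriv \<alpha> \<gamma> x) \<le> (\<alpha> + \<gamma>) * norm h"
        by (simp add: mult.commute[of "\<bar>h\<bar>"] mult_right_mono)
    qed
  qed auto
  also have "\<dots> \<le> (\<alpha> + \<gamma>) * \<bar>s - t\<bar>" using assms by (intro mult_left_mono) auto
  finally have 1: "norm (chirp \<alpha> \<gamma> (max 1 s) - chirp \<alpha> \<gamma> (max 1 t)) \<le> (\<alpha> + \<gamma>) * \<bar>s - t\<bar>" .
  have "chirp_ext \<alpha> \<gamma> s - chirp_ext \<alpha> \<gamma> t = of_real (max 0 (min 1 s) - max 0 (min 1 t)) * exp \<i>
      + (chirp \<alpha> \<gamma> (max 1 s) - chirp \<alpha> \<gamma> (max 1 t))"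
    by (simp add: chirp_ext_def algebra_simps)
  also have "norm \<dots> \<le> \<bar>max 0 (min 1 s) - max 0 (min 1 t)\<bar> + norm (chirp \<alpha> \<gamma> (max 1 s) - chirp \<alpha> \<gamma> (max 1 t))"
    by (rule order_trans[OF norm_triangle_ineq]) (simp add: norm_mult del: of_real_diff)
  also have "\<dots> \<le> \<bar>s - t\<bar> + (\<alpha> + \<gamma>) * \<bar>s - t\<bar>"
    using 1 by (intro add_mono) (auto simp: max_def min_def abs_if)
  finally show ?thesis by (simp add: algebra_simps)
qed

lemma lipschitz_imp_absolutely_continuous_on:
  assumes L: "L \<ge> 0" and lip: "\<And>s t. norm (f s - f t) \<le> L * \<bar>s - t\<bar>"
  shows "absolutely_continuous_on S f"
  unfolding absolutely_continuous_on_def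
proof (intro allI impI)
  fix e :: real assume e: "e > 0"
  have "(\<Sum>k\<in>d. norm (f (Sup k) - f (Inf k))) < e"
    if d: "d division_of \<Union>d \<and> \<Union>d \<subseteq> S \<and> (\<Sum>k\<in>d. Sup k - Inf k) < e / (L + 1)" for d
  proof -
    have nn: "Sup k - Inf k \<ge> 0" if k: "k \<in> d" for k :: "real set"
    proof -
      obtain u v where "k = {u..v}" "k \<noteq> {}" using division_ofD(3,4)[of d "\<Union>d" k] d k by auto
      then show ?thesis by simp
    qed
    have "(\<Sum>k\<in>d. norm (f (Sup k) - f (Inf k))) \<le> (\<Sum>k\<in>d. (L + 1) * (Sup k - Inf k))"
    proof (rule sum_mono)
      fix k assume k: "k \<in> d"
      have "norm (f (Sup k) - f (Inf k)) \<le> L * (Sup k - Inf k)" using lip[of "Sup k" "Inf k"] nn[OF k] by simp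
      then show "norm (f (Sup k) - f (Inf k)) \<le> (L + 1) * (Sup k - Inf k)" using nn[OF k] by (simp add: algebra_simps)
    qed
    also have "\<dots> = (L + 1) * (\<Sum>k\<in>d. Sup k - Inf k)" by (rule sum_distrib_left[symmetric])
    also have "\<dots> < e" using d L by (simp add: field_simps)
    finally show ?thesis .
  qed
  moreover have "e / (L + 1) > 0" using e L by simp
  ultimately show "\<exists>\<delta>>0. \<forall>d. d division_of \<Union>d \<and> \<Union>d \<subseteq> S \<and> (\<Sum>k\<in>d. Sup k - Inf k) < \<delta> \<longrightarrow>
      (\<Sum>k\<in>d. norm (f (Sup k) - f (Inf k))) < e"
    by blast
qed

lemma chirp_ext_deriv:
  shows "t < 0 \<Longrightarrow> deriv_at (chirp_ext \<alpha> \<gamma>) t = 0"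
    and "0 < t \<Longrightarrow> t < 1 \<Longrightarrow> deriv_at (chirp_ext \<alpha> \<gamma>) t = exp \<i>"
    and "1 < t \<Longrightarrow> deriv_at (chirp_ext \<alpha> \<gamma>) t = chirp_deriv \<alpha> \<gamma> t"
proof -
  assume t: "t < 0"
  have "(chirp_ext \<alpha> \<gamma> has_vector_derivative 0) (at t)"
    by (rule has_vector_derivative_transform_within_open[of "\<lambda>_. 0" _ _ "{..<0}"]) (use t in \<open>auto simp: chirp_ext_simps\<close>)
  then show "deriv_at (chirp_ext \<alpha> \<gamma>) t = 0" by (rule vector_derivative_at)
next
  assume t: "0 < t" "t < 1"
  have "((\<lambda>t. of_real t * exp \<i>) has_vector_derivative (of_real 1 * exp \<i>)) (at t)"
    by (intro has_vector_derivative_mult_left has_vector_derivative_of_real) auto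
  then have "(chirp_ext \<alpha> \<gamma> has_vector_derivative (of_real 1 * exp \<i>)) (at t)"
    by (rule has_vector_derivative_transform_within_open[of _ _ _ "{0<..<1}"]) (use t in \<open>auto simp: chirp_ext_simps\<close>)
  then show "deriv_at (chirp_ext \<alpha> \<gamma>) t = exp \<i>" using vector_derivative_at by fastforce
next
  assume t: "1 < t"
  have "(chirp \<alpha> \<gamma> has_vector_derivative chirp_deriv \<alpha> \<gamma> t) (at t)" using t by (intro has_vector_derivative_chirp) simp
  then have "(chirp_ext \<alpha> \<gamma> has_vector_derivative chirp_deriv \<alpha> \<gamma> t) (at t)"
    by (rule has_vector_derivative_transform_within_open[of _ _ _ "{1<..}"]) (use t in \<open>auto simp: chirp_ext_simps\<close>)
  then show "deriv_at (chirp_ext \<alpha> \<gamma>) t = chirp_deriv \<alpha> \<gamma> t" by (rule vector_derivative_at)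
qed

text \<open>Comparison with a power: \<open>ln u \<le> u - 1\<close> at
  \<open>u = sqrt (2 / t)\<close> bounds the logarithm by a multiple of
  \<open>t powr (- 1 / 2)\<close>, which is integrable at the origin.\<close>

lemma log_nn_integral_finite:
  "(\<integral>\<^sup>+ t \<in> {0<..<1}. ennreal C * ennreal (ln (2 / t)) \<partial>lebesgue) < \<infinity>"
proof -
  have I: "((\<lambda>t. t powr (- 1 / 2)) has_integral (1 powr (- 1 / 2 + 1) / (- 1 / 2 + 1))) {0..1::real}"
    by (rule has_integral_powr_from_0) auto
  have le: "ln (2 / t) \<le> 4 * t powr (- 1 / 2)" if t: "t \<in> {0<..<1}" for t :: real
  proof -
    have "ln (2 / t) = 2 * ln (sqrt (2 / t))" using t by (simp add: ln_sqrt)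
    also have "\<dots> \<le> 2 * sqrt (2 / t)"
      using t ln_le_minus_one[of "sqrt (2 / t)"] by (intro mult_left_mono) auto
    also have "\<dots> = 2 * sqrt 2 * t powr (- 1 / 2)"
      using t by (simp add: real_sqrt_divide powr_minus_divide powr_half_sqrt)
    also have "\<dots> \<le> 4 * t powr (- 1 / 2)"
      using real_sqrt_le_mono[of 2 4] by (intro mult_right_mono) auto
    finally show ?thesis .
  qed
  have "(\<integral>\<^sup>+ t \<in> {0<..<1}. ennreal C * ennreal (ln (2 / t)) \<partial>lebesgue)
      \<le> (\<integral>\<^sup>+ t. ennreal C * (ennreal 4 * ennreal (indicator {0..1} t * t powr (- 1 / 2))) \<partial>lebesgue)"
  proof (rule nn_integral_mono)
    fix t :: real
    show "ennreal C * ennreal (ln (2 / t)) * indicator {0<..<1} t \<le> ennreal C * (ennreal 4 * ennreal (indicator {0..1} t * t powr (- 1 / 2)))"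
    proof (cases "t \<in> {0<..<1}")
      case True
      have "ennreal (ln (2 / t)) \<le> ennreal (4 * t powr (- 1 / 2))" by (rule ennreal_leI[OF le[OF True]])
      also have "\<dots> = ennreal 4 * ennreal (indicator {0..1} t * t powr (- 1 / 2))"
        using True by (simp add: ennreal_mult)
      finally show ?thesis using True by (simp add: mult_left_mono)
    qed simp
  qed
  also have "\<dots> = ennreal C * (ennreal 4 * (\<integral>\<^sup>+ t. ennreal (indicator {0..1} t * t powr (- 1 / 2)) \<partial>lborel))"
    by (simp add: nn_integral_cmult nn_integral_completion)
  also have "(\<integral>\<^sup>+ t. ennreal (indicator {0..1} t * t powr (- 1 / 2)) \<partial>lborel) = ennreal (1 powr (- 1 / 2 + 1) / (- 1 / 2 + 1))"
    by (rule nn_integral_has_integral_lebesgue[OF _ I]) simp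
  also have "ennreal C * (ennreal 4 * ennreal (1 powr (- 1 / 2 + 1) / (- 1 / 2 + 1))) < \<infinity>"
    by (simp add: ennreal_mult_less_top)
  finally show ?thesis .
qed

lemma chirp_ext_A1_finite:
  assumes "\<alpha> \<ge> 0" "\<gamma> \<ge> 0" "\<gamma> \<le> 1 + \<alpha>"
  shows "A1 (chirp_ext \<alpha> \<gamma>) < \<infinity>"
proof -
  let ?f = "chirp_ext \<alpha> \<gamma>" and ?C = "1 + \<alpha> + \<gamma>"
  \<comment> \<open>At \<open>0\<close> and \<open>1\<close> the derivative may be an unspecified
    value; keeping it there as a constant turns the function into a finite case distinction that is
    visibly Borel measurable.\<close>
  let ?D = "\<lambda>t. if t < 0 then 0 else if t = 0 then deriv_at ?f 0 else if t < 1 then exp \<i>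
    else if t = 1 then deriv_at ?f 1 else chirp_deriv \<alpha> \<gamma> t"
  have "deriv_at ?f = ?D"
    by (intro ext) (auto simp: chirp_ext_deriv)
  moreover have "?D \<in> borel_measurable borel" unfolding chirp_deriv_def by measurable
  ultimately have "deriv_at ?f \<in> borel_measurable borel" by (simp only:)
  then have m: "(\<lambda>s. ennreal (norm (deriv_at ?f s))) \<in> borel_measurable lebesgue"
    by (intro measurable_completion) (simp add: measurable_lborel1)
  have bd: "norm (deriv_at ?f s) \<le> ?C" if s: "s \<noteq> 0" "s \<noteq> 1" for s
  proof -
    consider "s < 0" | "0 < s" "s < 1" | "1 < s" using s by linarith
    then show ?thesis
    proof cases
      case 3
      then show ?thesis using norm_chirp_deriv_le[of s \<alpha> \<gamma> 0] assms by (simp add: chirp_ext_deriv)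
    qed (use assms in \<open>simp_all add: chirp_ext_deriv\<close>)
  qed
  have f1: "f1 ?f t \<le> ennreal ?C" for t
    unfolding f1_def
  proof (rule esssup_I)
    show "(\<lambda>s. ennreal (norm (deriv_at ?f s))) \<in> borel_measurable (lebesgue_on {s. \<bar>t\<bar> \<le> \<bar>s\<bar>})"
      by (rule measurable_restrict_space1[OF m])
    have S: "{s. \<bar>t\<bar> \<le> \<bar>s\<bar>} \<in> sets lebesgue" by (rule abs_ge_sets_lebesgue)
    have "negligible {0, 1::real}" by (simp add: negligible_finite)
    then have "AE s in lebesgue. s \<notin> {0, 1}" using AE_not_in negligible_iff_null_sets by blast
    then have "AE s in lebesgue. s \<in> {s. \<bar>t\<bar> \<le> \<bar>s\<bar>} \<longrightarrow> ennreal (norm (deriv_at ?f s)) \<le> ennreal ?C"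
      by eventually_elim (use bd in \<open>auto intro: ennreal_leI\<close>)
    then show "AE s in lebesgue_on {s. \<bar>t\<bar> \<le> \<bar>s\<bar>}. ennreal (norm (deriv_at ?f s)) \<le> ennreal ?C"
      using S by (subst AE_restrict_space_iff) auto
  qed
  have "A1 ?f \<le> (\<integral>\<^sup>+ t \<in> {0<..<1}. ennreal ?C * ennreal (ln (2 / t)) \<partial>lebesgue)"
    unfolding A1_def by (intro nn_integral_mono mult_right_mono f1) auto
  then show ?thesis using log_nn_integral_finite by (rule le_less_trans)
qed

lemma chirp_ext_admissible:
  assumes \<alpha>: "\<alpha> > 0" and \<gamma>: "\<gamma> \<ge> 0" "\<gamma> \<le> 1 + \<alpha>" "\<gamma> - 1 - \<alpha> \<le> - \<beta>" "- \<alpha> - 1 \<le> - \<beta>"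
  shows "admissible \<alpha> \<beta> (chirp_ext \<alpha> \<gamma>)"
  unfolding admissible_def
proof (intro conjI)
  let ?f = "chirp_ext \<alpha> \<gamma>"
  have lip: "norm (?f s - ?f t) \<le> (1 + \<alpha> + \<gamma>) * \<bar>s - t\<bar>" for s t
    using assms by (intro chirp_ext_lipschitz) auto
  have decay: "norm (?f t) \<le> \<bar>t\<bar> powr (- \<alpha>)" if "\<bar>t\<bar> \<ge> 1" for t
    using that by (cases "t \<ge> 0") (auto simp: chirp_ext_simps norm_chirp)
  have ev: "\<forall>\<^sub>F t in at_infinity. norm (?f t) \<le> \<bar>t\<bar> powr (- \<alpha>)"
    using decay unfolding eventually_at_infinity by (intro exI[of _ 1]) auto
  have "(1 + \<alpha> + \<gamma>)-lipschitz_on UNIV ?f"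
    by (rule lipschitz_onI) (use lip \<alpha> \<gamma> in \<open>auto simp: dist_norm\<close>)
  then have "continuous_on UNIV ?f" by (rule lipschitz_on_continuous_on)
  moreover have "(?f \<longlongrightarrow> 0) at_infinity"
  proof (rule Lim_null_comparison[OF ev])
    show "((\<lambda>t::real. \<bar>t\<bar> powr (- \<alpha>)) \<longlongrightarrow> 0) at_infinity"
      using \<alpha> filterlim_norm_at_top[where 'a=real] by (intro tendsto_neg_powr) (auto simp: real_norm_def[abs_def])
  qed
  ultimately show "?f \<in> C0_real" by (simp add: C0_real_def)
  show "locally_absolutely_continuous_on (- {0}) ?f"
    unfolding locally_absolutely_continuous_on_def
    using \<alpha> \<gamma>(1) by (intro allI impI lipschitz_imp_absolutely_continuous_on[OF _ lip]) simp
  show "A1 ?f < \<infinity>" using assms by (intro chirp_ext_A1_finite) auto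
  show "(\<lambda>t. norm (?f t)) \<in> O[at_infinity](\<lambda>t. \<bar>t\<bar> powr (- \<alpha>))"
    using ev by (intro landau_o.bigI[of 1]) auto
  have "norm (deriv_at ?f t) \<le> (\<alpha> + \<gamma>) * \<bar>\<bar>t\<bar> powr (- \<beta>)\<bar>" if "\<bar>t\<bar> \<ge> 2" for t
  proof (cases "t \<ge> 0")
    case True
    then show ?thesis using norm_chirp_deriv_le[of t \<alpha> \<gamma> \<beta>] assms that by (simp add: chirp_ext_deriv)
  next
    case False
    then show ?thesis using assms by (simp add: chirp_ext_deriv)
  qed
  then show "ae_bigo_at_infinity (deriv_at ?f) (\<lambda>t. \<bar>t\<bar> powr (- \<beta>))"
    unfolding ae_bigo_at_infinity_def by (intro exI[of _ "\<alpha> + \<gamma>"] exI[of _ 2] AE_I2) auto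
qed

theorem exists_admissible_not_A_real:
  assumes "0 < \<alpha>" "\<alpha> \<le> 1" "\<alpha> + \<beta> < 1"
  shows "\<exists>f. admissible \<alpha> \<beta> f \<and> f \<notin> A_real"
proof (cases "\<alpha> = 1")
  case True
  then show ?thesis
    using assms chirp_ext_admissible[of \<alpha> 2 \<beta>] chirp_ext_not_A_real[of 2 \<alpha>] by auto
next
  case False
  \<comment> \<open>The largest exponent for which the derivative is both bounded and of the order
    required by \<beta>; it exceeds \<open>2 * \<alpha>\<close> because \<alpha> < 1 and \<alpha> +
    \<beta> < 1.\<close>
  define m where "m = 1 + \<alpha> - max \<beta> 0"
  \<comment> \<open>At exponent \<open>1\<close> the phase would be linear; in that case
    \<open>2 * \<alpha> < 1\<close>, and the midpoint of \<open>2 * \<alpha>\<close> and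
    \<open>1\<close> is taken instead.\<close>
  define \<gamma> where "\<gamma> = (if m = 1 then (2 * \<alpha> + 1) / 2 else m)"
  have "2 * \<alpha> < m" "m \<le> 2" using assms False by (auto simp: m_def)
  then have "2 * \<alpha> < \<gamma>" "\<gamma> \<le> m" "\<gamma> \<noteq> 1" using assms by (auto simp: \<gamma>_def)
  then have "\<gamma> > 0" "\<gamma> \<noteq> 1" "\<gamma> \<le> 2" "2 * \<alpha> < \<gamma>" "\<gamma> \<le> 1 + \<alpha>" "\<gamma> - 1 - \<alpha> \<le> - \<beta>"
    using assms \<open>m \<le> 2\<close> by (auto simp: m_def)
  then show ?thesis
    using assms False chirp_ext_admissible[of \<alpha> \<gamma> \<beta>] chirp_ext_not_A_real[of \<gamma> \<alpha>] by auto
qed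

theorem corollary1p2:
  shows "(\<forall>(\<alpha>::real) (\<beta>::real). \<alpha> > 0 \<and> \<alpha> + \<beta> > 1 \<longrightarrow>
            (\<forall>f :: real \<Rightarrow> complex. admissible \<alpha> \<beta> f \<longrightarrow> f \<in> A_real)) \<and>
         (\<forall>(\<alpha>::real) (\<beta>::real). 0 < \<alpha> \<and> \<alpha> \<le> 1 \<and> \<alpha> + \<beta> < 1 \<longrightarrow>
            \<not> (\<forall>f :: real \<Rightarrow> complex. admissible \<alpha> \<beta> f \<longrightarrow> f \<in> A_real))"
  using admissible_imp_A_real exists_admissible_not_A_real by meson

end
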